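(* Let $k$ be a perfect field with $\operatorname{char}k\neq2,3$, and let $C_1/k$, $C_2/k$ be curves of genus 2 with $A_i=\operatorname{Aut}(C_i)\simeq D_{12}$ ($i=1,2$). If $C_1$ and $C_2$ are $\overline k$-isomorphic and $A_1$ and $A_2$ are isomorphic as $G_k$-groups, then $C_1$ and $C_2$ differ by a hyperelliptic twist, i.e. there is $d\in k^*$ such that if $C_1$ has model $Y^2=F(X)$ then $C_2$ is $k$-isomorphic to $Y^2=dF(X)$.
   Context: $\overline k$ is an algebraic closure of $k$ and $G_k=\operatorname{Gal}(\overline k/k)$; $\operatorname{Aut}(C)$ denotes the automorphisms over $\overline k$, a $G_k$-group via $\phi\mapsto{}^\sigma\phi$. Curves of genus 2 over $k$ are given by hyperelliptic models $Y^2=F(X)$, $F\in k[X]$ squarefree of degree 5 or 6. *)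

theory Defs
  imports "HOL-Algebra.Algebraic_Closure_Type" "HOL-Algebra.Bij"
begin

text \<open>The base field \<open>k\<close> is a type \<open>'k\<close> of sort \<open>field\<close>, its algebraic closure is
  \<open>'k alg_closure\<close>, and \<open>k\<close> embeds via \<^const>\<open>to_ac\<close>.\<close>

text \<open>Perfect: every irreducible polynomial has only simple roots in the algebraic closure.\<close>

definition perfect_field :: "'k::field itself \<Rightarrow> bool" where
  "perfect_field _ \<longleftrightarrow>
     (\<forall>p :: 'k poly. Factorial_Ring.irreducible p \<longrightarrow>
        rsquarefree (map_poly to_ac p :: 'k alg_closure poly))"

definition galois_group :: "('k::field alg_closure \<Rightarrow> 'k alg_closure) set" where
  "galois_group = {\<sigma>. bij \<sigma> \<and> (\<forall>x y. \<sigma> (x + y) = \<sigma> x + \<sigma> y) \<and>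
                      (\<forall>x y. \<sigma> (x * y) = \<sigma> x * \<sigma> y) \<and> (\<forall>a. \<sigma> (to_ac a) = to_ac a)}"


section \<open>Genus 2 curves as smooth projective curves\<close>

text \<open>The smooth projective curve with affine model \<open>Y\<^sup>2 = F(X)\<close>, for \<open>F\<close> squarefree
  of degree 5 or 6 (characteristic not 2), is the hypersurface
  \<open>Y\<^sup>2 = \<Sum>i\<le>6. a\<^sub>i X\<^sup>i Z\<^sup>6\<^sup>-\<^sup>i\<close> in the weighted projective plane
  with weights 1, 3, 1; it is smooth also at the points with \<open>Z = 0\<close>.  It is identified with its
  set of points over the algebraic closure.  A point of the weighted projective plane is an orbit
  of nonzero triples under \<open>t \<cdot> (X, Y, Z) = (t X, t\<^sup>3 Y, t Z)\<close>.\<close>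

type_synonym 'a wpoint = "('a \<times> 'a \<times> 'a) set"

definition wpoint :: "'a::field \<times> 'a \<times> 'a \<Rightarrow> 'a wpoint" where
  "wpoint = (\<lambda>(x, y, z). {(t * x, t ^ 3 * y, t * z) | t. t \<noteq> 0})"

definition genus2_model :: "'k::field poly \<Rightarrow> bool" where
  "genus2_model F \<longleftrightarrow> squarefree F \<and> Polynomial.degree F \<in> {5, 6}"

definition curve :: "'k::field poly \<Rightarrow> 'k alg_closure wpoint set" where
  "curve F = {wpoint (x, y, z) | x y z. (x, y, z) \<noteq> (0, 0, 0) \<and>
      y ^ 2 = (\<Sum>i\<le>6. to_ac (Polynomial.coeff F i) * x ^ i * z ^ (6 - i))}"

text \<open>Forms of weighted degree \<open>d\<close> with coefficients in a subfield \<open>L\<close>: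
  \<open>c i j\<close> is the coefficient of \<open>X\<^sup>i Y\<^sup>j Z\<^sup>l\<close>, where
  \<open>i + 3 j + l = d\<close>.\<close>

definition wform :: "'a::field set \<Rightarrow> nat \<Rightarrow> ('a \<times> 'a \<times> 'a \<Rightarrow> 'a) \<Rightarrow> bool" where
  "wform L d f \<longleftrightarrow> (\<exists>c :: nat \<Rightarrow> nat \<Rightarrow> 'a. (\<forall>i j. c i j \<in> L) \<and>
     f = (\<lambda>(x, y, z). \<Sum>(i, j) | i + 3 * j \<le> d. c i j * x ^ i * y ^ j * z ^ (d - (i + 3 * j))))"

text \<open>Morphisms over \<open>L\<close>: near every point \<open>P\<close> the map is given by forms over \<open>L\<close> of
  degrees \<open>d\<close>, \<open>3 d\<close>, \<open>d\<close> that do not all vanish at \<open>P\<close>.  The formula is required at every point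
  of the curve where the three forms do not all vanish: this is a Zariski open set, and since
  the curve is irreducible a formula valid near \<open>P\<close> is valid on all of it.\<close>

definition morphism_over ::
    "'a::field set \<Rightarrow> 'a wpoint set \<Rightarrow> 'a wpoint set \<Rightarrow> ('a wpoint \<Rightarrow> 'a wpoint) \<Rightarrow> bool" where
  "morphism_over L C D \<phi> \<longleftrightarrow> \<phi> ` C \<subseteq> D \<and>
     (\<forall>P\<in>C. \<exists>d f g h. wform L d f \<and> wform L (3 * d) g \<and> wform L d h \<and>
        (\<exists>p. wpoint p = P \<and> (f p, g p, h p) \<noteq> (0, 0, 0)) \<and>
        (\<forall>q. wpoint q \<in> C \<and> (f q, g q, h q) \<noteq> (0, 0, 0) \<longrightarrow>
              \<phi> (wpoint q) = wpoint (f q, g q, h q)))"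

definition isomorphism_over ::
    "'a::field set \<Rightarrow> 'a wpoint set \<Rightarrow> 'a wpoint set \<Rightarrow> ('a wpoint \<Rightarrow> 'a wpoint) \<Rightarrow> bool" where
  "isomorphism_over L C D \<phi> \<longleftrightarrow>
     bij_betw \<phi> C D \<and> morphism_over L C D \<phi> \<and> morphism_over L D C (inv_into C \<phi>)"

definition isomorphic_over :: "'a::field set \<Rightarrow> 'a wpoint set \<Rightarrow> 'a wpoint set \<Rightarrow> bool" where
  "isomorphic_over L C D \<longleftrightarrow> (\<exists>\<phi>. isomorphism_over L C D \<phi>)"

abbreviation geom_isomorphic :: "'k::field poly \<Rightarrow> 'k poly \<Rightarrow> bool" where
  "geom_isomorphic F G \<equiv> isomorphic_over UNIV (curve F) (curve G)"

abbreviation k_isomorphic :: "'k::field poly \<Rightarrow> 'k poly \<Rightarrow> bool" where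
  "k_isomorphic F G \<equiv> isomorphic_over (range to_ac) (curve F) (curve G)"


section \<open>Automorphism groups with Galois action\<close>

text \<open>As in \<^const>\<open>BijGroup\<close>, automorphisms are extensional functions.\<close>

definition Aut :: "'k::field poly \<Rightarrow>
    ('k alg_closure wpoint \<Rightarrow> 'k alg_closure wpoint) monoid" where
  "Aut F = (BijGroup (curve F))
     \<lparr>carrier := {\<phi> \<in> Bij (curve F). isomorphism_over UNIV (curve F) (curve F) \<phi>}\<rparr>"

definition galois_point :: "('a \<Rightarrow> 'a) \<Rightarrow> 'a wpoint \<Rightarrow> 'a wpoint" where
  "galois_point \<sigma> P = (\<lambda>(x, y, z). (\<sigma> x, \<sigma> y, \<sigma> z)) ` P"

text \<open>The conjugate of \<open>\<phi>\<close> by \<open>\<sigma>\<close>, i.e. the map obtained by applying \<open>\<sigma>\<close> to the coefficients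
  of the forms defining \<open>\<phi>\<close>.\<close>

definition galois_conj :: "('k::field alg_closure \<Rightarrow> 'k alg_closure) \<Rightarrow> 'k poly \<Rightarrow>
    ('k alg_closure wpoint \<Rightarrow> 'k alg_closure wpoint) \<Rightarrow>
    'k alg_closure wpoint \<Rightarrow> 'k alg_closure wpoint" where
  "galois_conj \<sigma> F \<phi> =
     (\<lambda>P \<in> curve F. galois_point \<sigma> (\<phi> (galois_point (inv_into UNIV \<sigma>) P)))"

definition Aut_galois_isomorphic :: "'k::field poly \<Rightarrow> 'k poly \<Rightarrow> bool" where
  "Aut_galois_isomorphic F G \<longleftrightarrow> (\<exists>\<psi> \<in> iso (Aut F) (Aut G).
     \<forall>\<sigma> \<in> galois_group. \<forall>\<phi> \<in> carrier (Aut F).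
       \<psi> (galois_conj \<sigma> F \<phi>) = galois_conj \<sigma> G (\<psi> \<phi>))"

text \<open>The dihedral group of order \<open>2 n\<close>: the pair \<open>(a, s)\<close> stands for the rotation by \<open>a\<close>
  steps, preceded by a reflection if \<open>s\<close> holds.\<close>

definition dihedral_group :: "nat \<Rightarrow> (int \<times> bool) monoid" where
  "dihedral_group n =
     \<lparr>carrier = {0..<int n} \<times> UNIV,
      monoid.mult = (\<lambda>(a, s) (b, t). ((if s then a - b else a + b) mod int n, s \<noteq> t)),
      one = (0, False)\<rparr>"

end

theory Submission
  imports Defs
begin

text \<open>An isomorphism of genus 2 curves is linear, \<open>(X, Y, Z) \<mapsto> (a X + b Z, e Y, c X + d Z)\<close>: the
  pullback \<open>u\<close> of the coordinate \<open>x\<close> is \<open>p + q y\<close> with rational \<open>p\<close>, \<open>q\<close>, and comparing degrees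
  in the minimal polynomial of \<open>u\<close> over \<open>K(x)\<close> gives \<open>q = 0\<close> and then that \<open>p\<close> is a Moebius
  transformation.

  Let \<open>\<Phi>\<close> be a geometric isomorphism from \<open>C\<^sub>1\<close> to \<open>C\<^sub>2\<close> and \<open>\<psi>\<close> a Galois equivariant
  isomorphism of the automorphism groups. Every automorphism of \<open>D\<^sub>1\<^sub>2\<close> is inner modulo the centre,
  so \<open>\<Phi>\<close> can be changed by an automorphism of \<open>C\<^sub>1\<close> such that \<open>\<psi>\<close> is conjugation by \<open>\<Phi>\<close> up to
  the hyperelliptic involution \<open>\<iota>\<close>, which generates the centre. Equivariance then makes the cocycle
  \<open>\<Phi>\<^sup>-\<^sup>1 \<circ> \<sigma>(\<Phi>)\<close> commute with all automorphisms modulo \<open>\<iota>\<close>, so it is \<open>1\<close> or \<open>\<iota>\<close>, because \<open>S\<^sub>3\<close> has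
  trivial centre. Hence the class of \<open>(a, b; c, d)\<close> in \<open>PGL\<^sub>2\<close> is Galois invariant; scaled to have
  entries in \<open>k\<close>, the matrix has \<open>e\<^sup>2\<close> in \<open>k\<close>, and \<open>d = e\<^sup>2\<close> is the twist.\<close>

text \<open>Working modulo the centre is forced: the dihedral group of order 12 has an outer
  automorphism, which fixes the rotations and multiplies every reflection by the half-turn, so group
  theory alone does not make \<psi> conjugation by an isomorphism of the curves. The loss is
  harmless: the half-turn is the hyperelliptic involution, and an ambiguity by it is exactly what a
  hyperelliptic twist allows. A tuple (a, b, c, d, e) describes a map only up to (t, 0, 0, t, t^3),
  because points are weighted projective. Dividing by a nonzero matrix entry removes this scalar;
  what is left of the cocycle is the sign in \<sigma>(e) = e or -e. Perfectness enters twice: a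
  squarefree F keeps simple roots over the closure, and elements fixed by the Galois group lie in k.
  No function field is constructed. Rational functions are functions on affine points, compared up
  to finite sets, so every conclusion about a morphism has to be carried from almost all points to
  all of them, those at infinity included.\<close>

instance alg_closure :: (field) field_gcd ..

section \<open>Polynomial functions on an affine hyperelliptic curve\<close>

text \<open>If there were finitely many elements a, the product of all X - a, increased by 1, would
  be a non-constant polynomial without a root.\<close>

lemma infinite_UNIV_alg_closed: "infinite (UNIV :: 'a::alg_closed_field set)"
proof
  assume fin: "finite (UNIV :: 'a set)"
  define p :: "'a poly" where "p = (\<Prod>a\<in>UNIV. [:- a, 1:]) + 1"
  have "Polynomial.degree (\<Prod>a\<in>(UNIV::'a set). [:- a, 1:]) = card (UNIV :: 'a set)"
    by (subst degree_prod_eq_sum_degree) auto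
  moreover have "card (UNIV :: 'a set) > 0" using fin by (simp add: card_gt_0_iff)
  ultimately have "Polynomial.degree p > 0" unfolding p_def by (subst degree_add_eq_left) auto
  then obtain x where "poly p x = 0" using alg_closed_imp_poly_has_root by blast
  moreover have "(\<Prod>a\<in>UNIV. x - a) = 0" using fin by (subst prod_zero_iff) auto
  ultimately show False by (simp add: p_def poly_prod)
qed

lemma infinite_nonroots:
  fixes p :: "'a::alg_closed_field poly"
  assumes "p \<noteq> 0"
  shows "infinite {x. poly p x \<noteq> 0}"
proof -
  have "{x. poly p x \<noteq> 0} = - {x. poly p x = 0}" by auto
  then show ?thesis using poly_roots_finite[OF assms] infinite_UNIV_alg_closed[where 'a = 'a]
    by (simp add: Compl_eq_Diff_UNIV Diff_infinite_finite)
qed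

lemma finite_square_roots: "finite {y::'a::field. y\<^sup>2 = c}"
proof -
  have "[:-c, 0, 1:] \<noteq> 0" by simp
  from poly_roots_finite[OF this] show ?thesis
    by (rule rev_finite_subset) (auto simp: power2_eq_square)
qed

text \<open>A root x of the cofactor F / gcd F H is a root of F, hence of H, hence of the gcd; then
  x is a double root of F.\<close>

lemma rsquarefree_dvd:
  fixes F H :: "'a::{alg_closed_field, field_gcd} poly"
  assumes F: "rsquarefree F" and roots: "\<And>x. poly F x = 0 \<Longrightarrow> poly H x = 0"
  shows "F dvd H"
proof -
  define g where "g = gcd F H"
  obtain q where q: "F = g * q" unfolding g_def by (meson dvdE gcd_dvd1)
  have F0: "F \<noteq> 0" using F by (simp add: rsquarefree_def)
  have "Polynomial.degree q = 0"
  proof (rule ccontr)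
    assume "Polynomial.degree q \<noteq> 0"
    then obtain x where x: "poly q x = 0" using alg_closed_imp_poly_has_root by blast
    then have Fx: "poly F x = 0" by (simp add: q)
    then have "[:-x, 1:] dvd F" "[:-x, 1:] dvd H" using roots by (simp_all add: poly_eq_0_iff_dvd)
    then have "[:-x, 1:] dvd g" by (simp add: g_def)
    then have "[:-x, 1:] ^ 2 dvd F" using x unfolding q power2_eq_square
      by (intro mult_dvd_mono) (simp_all add: poly_eq_0_iff_dvd)
    then have "2 \<le> Polynomial.order x F" using F0 order_divides by blast
    then show False using F by (auto simp: rsquarefree_def dest!: spec[of _ x])
  qed
  then have "is_unit q" using F0 q is_unit_iff_degree[of q] by auto
  then have "F dvd g" unfolding q by simp
  then show ?thesis unfolding g_def by simp
qed

text \<open>Parity: at a root of F the right-hand side vanishes to odd order, so H must vanish there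
  too.\<close>

lemma rsquarefree_dvd_of_square_eq:
  fixes F H :: "'a::{alg_closed_field, field_gcd} poly"
  assumes F: "rsquarefree F" and S: "S \<noteq> 0" and eq: "S\<^sup>2 * H = T\<^sup>2 * F"
  shows "F dvd H"
proof (cases "H = 0")
  case False
  have F0: "F \<noteq> 0" using F by (simp add: rsquarefree_def)
  have T: "T \<noteq> 0" using eq S False by auto
  show ?thesis
  proof (rule rsquarefree_dvd[OF F])
    fix x assume x: "poly F x = 0"
    then have "Polynomial.order x F = 1" using F F0 rsquarefree_root_order by blast
    moreover have "Polynomial.order x (S\<^sup>2 * H) = 2 * Polynomial.order x S + Polynomial.order x H"
      unfolding power2_eq_square using S False by (subst order_mult; simp add: order_mult)
    moreover have "Polynomial.order x (T\<^sup>2 * F) = 2 * Polynomial.order x T + Polynomial.order x F"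
      unfolding power2_eq_square using T F0 by (subst order_mult; simp add: order_mult)
    ultimately have "2 * Polynomial.order x S + Polynomial.order x H = 2 * Polynomial.order x T + 1"
      using eq by simp
    then have "Polynomial.order x H \<noteq> 0" by presburger
    then show "poly H x = 0" using order_0I[of H x] by auto
  qed
qed simp

text \<open>Degree 5 belongs here because the curve uses F as a binary form of degree 6, which then
  has a simple root at infinity.\<close>

definition simple_sextic :: "'a::field poly \<Rightarrow> bool" where
  "simple_sextic F \<longleftrightarrow> rsquarefree F \<and> Polynomial.degree F \<in> {5, 6}"

text \<open>\<open>A^2 - B^2 * F\<close> is the norm of A + B y from K(x, y) to K(x). The two sides
  of the equation have orders of different parity at a root of F.\<close>

lemma norm_eq_0D:
  fixes F :: "'a::{alg_closed_field, field_gcd} poly"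
  assumes F: "simple_sextic F" and eq: "A\<^sup>2 = B\<^sup>2 * F"
  shows "A = 0 \<and> B = 0"
proof (cases "A = 0")
  case False
  have "Polynomial.degree F > 0" using F by (auto simp: simple_sextic_def)
  then obtain x where x: "poly F x = 0" using alg_closed_imp_poly_has_root by blast
  have F0: "F \<noteq> 0" "B \<noteq> 0" using eq False by auto
  have "Polynomial.order x F = 1" using F x F0 by (auto simp: simple_sextic_def rsquarefree_root_order)
  moreover have "Polynomial.order x (A\<^sup>2) = 2 * Polynomial.order x A"
    unfolding power2_eq_square using False by (simp add: order_mult)
  moreover have "Polynomial.order x (B\<^sup>2 * F) = 2 * Polynomial.order x B + Polynomial.order x F"
    unfolding power2_eq_square using F0 by (subst order_mult; simp add: order_mult)
  ultimately have "2 * Polynomial.order x A = 2 * Polynomial.order x B + 1" using eq by simp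
  then show ?thesis by presburger
qed (use eq F in \<open>auto simp: simple_sextic_def\<close>)

definition affine_curve :: "'a::field poly \<Rightarrow> ('a \<times> 'a) set" where
  "affine_curve F = {p. (snd p)\<^sup>2 = poly F (fst p)}"

text \<open>"At all but finitely many affine points": the substitute for equality in the function
  field. It composes well, since conjunctions and consequences of generic statements are
  generic.\<close>

definition generic :: "'a::field poly \<Rightarrow> ('a \<times> 'a) filter" where
  "generic F = inf cofinite (principal (affine_curve F))"

lemma eventually_generic:
  "eventually P (generic F) \<longleftrightarrow> finite {p \<in> affine_curve F. \<not> P p}"
proof -
  have "{x. \<not> (x \<in> affine_curve F \<longrightarrow> P x)} = {p \<in> affine_curve F. \<not> P p}" by auto
  then show ?thesis
    by (simp add: generic_def eventually_inf_principal eventually_cofinite)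
qed

lemma generic_on_curve: "eventually (\<lambda>p. (snd p)\<^sup>2 = poly F (fst p)) (generic F)"
proof -
  have "{p \<in> affine_curve F. (snd p)\<^sup>2 \<noteq> poly F (fst p)} = {}" by (auto simp: affine_curve_def)
  then show ?thesis by (simp only: eventually_generic finite.emptyI)
qed

lemma finite_affine_curve_over:
  assumes "finite W"
  shows "finite {p \<in> affine_curve F. fst p \<in> W}"
proof -
  have "{p \<in> affine_curve F. fst p \<in> W} \<subseteq> (SIGMA x:W. {y. y\<^sup>2 = poly F x})"
    by (auto simp: affine_curve_def)
  then show ?thesis
    by (rule finite_subset) (intro finite_SigmaI assms finite_square_roots)
qed

lemma infinite_affine_curve: "infinite (affine_curve (F :: 'a::alg_closed_field poly))"
proof
  assume "finite (affine_curve F)"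
  then have "finite (fst ` affine_curve F)" by simp
  moreover have "fst ` affine_curve F = UNIV"
  proof -
    have "x \<in> fst ` affine_curve F" for x
    proof -
      obtain y where "y\<^sup>2 = poly F x" using nth_root_exists[of 2 "poly F x"] by auto
      then have "(x, y) \<in> affine_curve F" by (simp add: affine_curve_def)
      then show ?thesis by (metis fst_conv image_eqI)
    qed
    then show ?thesis by auto
  qed
  ultimately show False using infinite_UNIV_alg_closed by metis
qed

lemma generic_poly_neq_0: "p \<noteq> 0 \<Longrightarrow> eventually (\<lambda>q. poly p (fst q) \<noteq> 0) (generic F)"
  using finite_affine_curve_over[of "{x. poly p x = 0}" F] poly_roots_finite[of p]
  by (simp add: eventually_generic)

text \<open>This consequence of being a simple sextic is what the study of zeros relies on; it is
  named so that the results also apply to the equation of the chart at infinity.\<close>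

definition non_square :: "'a::field poly \<Rightarrow> bool" where
  "non_square F \<longleftrightarrow> (\<forall>A B. A\<^sup>2 = B\<^sup>2 * F \<longrightarrow> A = 0 \<and> B = 0)"

lemma non_square_simple_sextic:
  "simple_sextic F \<Longrightarrow> non_square (F :: 'a::{alg_closed_field, field_gcd} poly)"
  using norm_eq_0D unfolding non_square_def by blast

text \<open>The zeros of A + B y lie over the roots of its norm, and only finitely many points of
  the curve lie over a finite set.\<close>

lemma zero_on_infinite_subset:
  fixes F :: "'a::field poly"
  assumes F: "non_square F"
    and inf: "infinite {p \<in> affine_curve F. poly A (fst p) + poly B (fst p) * snd p = 0}"
  shows "A = 0 \<and> B = 0"
proof (rule ccontr)
  assume "\<not> (A = 0 \<and> B = 0)"
  then have N: "A\<^sup>2 - B\<^sup>2 * F \<noteq> 0" using F unfolding non_square_def by auto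
  have "{p \<in> affine_curve F. poly A (fst p) + poly B (fst p) * snd p = 0} \<subseteq>
    {p \<in> affine_curve F. fst p \<in> {x. poly (A\<^sup>2 - B\<^sup>2 * F) x = 0}}"
  proof safe
    fix x y assume "(x, y) \<in> affine_curve F" "poly A (fst (x, y)) + poly B (fst (x, y)) * snd (x, y) = 0"
    then have "poly A x = - (poly B x * y)" "y\<^sup>2 = poly F x"
      by (auto simp: affine_curve_def eq_neg_iff_add_eq_0)
    then show "poly (A\<^sup>2 - B\<^sup>2 * F) (fst (x, y)) = 0" by (simp add: power_mult_distrib)
  qed
  then show False
    using inf finite_affine_curve_over[OF poly_roots_finite[OF N], of F] finite_subset by blast
qed

text \<open>Linear independence of 1 and y over K(x). This is the tool for comparing coefficients in
  all later identities.\<close>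

lemma generic_zeroD:
  fixes F :: "'a::{alg_closed_field, field_gcd} poly"
  assumes F: "simple_sextic F"
    and ev: "eventually (\<lambda>p. poly A (fst p) + poly B (fst p) * snd p = 0) (generic F)"
  shows "A = 0" and "B = 0"
proof -
  let ?Z = "{p \<in> affine_curve F. poly A (fst p) + poly B (fst p) * snd p = 0}"
  let ?N = "{p \<in> affine_curve F. poly A (fst p) + poly B (fst p) * snd p \<noteq> 0}"
  have "finite ?N" using ev by (simp add: eventually_generic)
  moreover have "affine_curve F = ?Z \<union> ?N" by auto
  ultimately have "infinite ?Z" using infinite_affine_curve[of F] finite_UnI[of ?Z ?N] by auto
  from zero_on_infinite_subset[OF non_square_simple_sextic[OF F] this] show "A = 0" "B = 0" by auto
qed

lemma generic_poly_zeroD: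
  fixes F :: "'a::{alg_closed_field, field_gcd} poly"
  assumes "simple_sextic F" and "eventually (\<lambda>p. poly A (fst p) = 0) (generic F)"
  shows "A = 0"
  using generic_zeroD[of F A 0] assms by simp

lemma generic_neq_bot: "generic (F :: 'a::alg_closed_field poly) \<noteq> bot"
  using infinite_affine_curve[of F] by (auto simp: trivial_limit_def eventually_generic)

section \<open>Birational maps respect the hyperelliptic map\<close>

text \<open>Views a polynomial in U as an element of K[X][U] whose coefficients are constant in X; U
  is the outer variable.\<close>

definition lift_poly :: "'a::comm_ring_1 poly \<Rightarrow> 'a poly poly" where
  "lift_poly p = map_poly (\<lambda>c. [:c:]) p"

lemma poly_lift_poly: "poly (lift_poly p) [:u:] = [:poly p u:]"
  by (induction p) (auto simp: lift_poly_def map_poly_pCons mult.commute)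

text \<open>A polynomial \<open>m\<close> in \<open>K[X][U]\<close> is evaluated at \<open>(x, u)\<close> as \<^term>\<open>poly (poly m [:u:]) x\<close>.
  Over the field of fractions of \<open>K[X]\<close>, the next lemma divides by the minimal polynomial; Gauss's
  lemma gives the division over \<open>K[X]\<close> itself.\<close>

lemma primitive_minimal_dvd:
  fixes F :: "'a::{alg_closed_field, field_gcd} poly" and n m :: "'a poly poly"
  assumes F: "simple_sextic F"
    and n: "n \<noteq> 0" "content n = 1"
      "eventually (\<lambda>p. poly (poly n [:u p:]) (fst p) = 0) (generic F)"
    and min: "\<And>l. Polynomial.degree l < Polynomial.degree n \<Longrightarrow>
      eventually (\<lambda>p. poly (poly l [:u p:]) (fst p) = 0) (generic F) \<Longrightarrow> l = 0"
    and m: "eventually (\<lambda>p. poly (poly m [:u p:]) (fst p) = 0) (generic F)"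
  shows "n dvd m"
proof -
  \<comment> \<open>Pseudo-division keeps the coefficients in K[X]. The remainder vanishes at u as
    well, so minimality makes it 0.\<close>
  define r where "r = pseudo_mod m n"
  obtain a q where a: "a \<noteq> 0" "Polynomial.smult a m = n * q + r"
    using pseudo_mod(1)[OF n(1), of m] unfolding r_def by blast
  have "eventually (\<lambda>p. poly (poly r [:u p:]) (fst p) = 0) (generic F)"
    using n(3) m
  proof eventually_elim
    case (elim p)
    have "r = Polynomial.smult a m - n * q" using a(2) by simp
    then show ?case using elim by simp
  qed
  then have "r = 0" using min pseudo_mod(2)[OF n(1), of m] unfolding r_def by blast
  then have eq: "Polynomial.smult a m = n * q" using a by simp
  have "normalize a * content m = content q"
    using arg_cong[OF eq, of content] by (simp add: content_mult n(2))
  then have "a dvd content q" by (metis dvd_triv_left normalize_dvd_iff)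
  then have "[:a:] dvd q" by (simp add: const_poly_dvd_iff_dvd_content)
  then obtain k where "q = [:a:] * k" by (elim dvdE)
  then have "Polynomial.smult a m = Polynomial.smult a (n * k)" using eq by simp
  then have "m = n * k" using a(1) by (metis smult_cancel)
  then show ?thesis by simp
qed

lemma is_unit_content:
  fixes n :: "'a::field_gcd poly poly"
  assumes "is_unit (content n)"
  shows "content n = 1"
  using assms is_unit_normalize[of "content n"] by simp

text \<open>If \<open>Q \<noteq> 0\<close>, then \<open>n\<close> below is the minimal polynomial of \<open>u\<close> over \<open>K(x)\<close>, made primitive. As
  \<open>x\<close> is quadratic over \<open>K(u)\<close>, the coefficients of \<open>n\<close> have degree at most 2 in \<open>x\<close>, so its
  discriminant has degree at most 4; but that discriminant is \<open>F\<close> times a rational square.\<close>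

lemma no_quadratic_pullback:
  fixes F G :: "'a::{alg_closed_field, field_gcd} poly" and u v :: "'a \<times> 'a \<Rightarrow> 'a"
  assumes two: "(2 :: 'a) \<noteq> 0"
    and F: "simple_sextic F"
    and R: "R \<noteq> 0"
    and u: "eventually (\<lambda>p. poly R (fst p) * u p = poly P (fst p) + poly Q (fst p) * snd p) (generic F)"
    and v: "eventually (\<lambda>p. (v p)\<^sup>2 = poly G (u p)) (generic F)"
    and R': "R' \<noteq> 0"
    and x: "eventually (\<lambda>p. fst p * poly R' (u p) = poly P' (u p) + poly Q' (u p) * v p) (generic F)"
  shows "Q = 0"
proof (rule ccontr)
  assume Q: "Q \<noteq> 0"
  \<comment> \<open>From R u = P + Q y, the function u is a root of R^2 U^2 - 2 P R U + (P^2 - Q^2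
    F). Dividing by the common factor \<open>g\<close> leaves the primitive polynomial r U^2 - 2 s U
    + t.\<close>
  define g where "g = gcd (R\<^sup>2) (gcd (P * R) (P\<^sup>2 - Q\<^sup>2 * F))"
  have g0: "g \<noteq> 0" using R by (simp add: g_def)
  have "g dvd R\<^sup>2" "g dvd P * R" "g dvd P\<^sup>2 - Q\<^sup>2 * F" unfolding g_def
    by (rule gcd_dvd1, (rule dvd_trans[OF gcd_dvd2], rule gcd_dvd1 gcd_dvd2)+)
  then obtain r s t where rst: "R\<^sup>2 = g * r" "P * R = g * s" "P\<^sup>2 - Q\<^sup>2 * F = g * t"
    unfolding dvd_def by blast
  have r0: "r \<noteq> 0" using rst(1) R by auto
  define d where "d = gcd r (gcd s t)"
  have "d dvd r" "d dvd s" "d dvd t"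
    unfolding d_def by (rule gcd_dvd1, (rule dvd_trans[OF gcd_dvd2], rule gcd_dvd1 gcd_dvd2)+)
  then have "g * d dvd gcd (R\<^sup>2) (gcd (P * R) (P\<^sup>2 - Q\<^sup>2 * F))"
    unfolding rst by (intro gcd_greatest mult_dvd_mono dvd_refl)
  then have "g * d dvd g * 1" by (simp add: g_def)
  then have cop: "is_unit d" using g0 by simp
  define n where "n = [:t, Polynomial.smult (-2) s, r:]"
  have n0: "n \<noteq> 0" and degn: "Polynomial.degree n = 2" using r0 by (auto simp: n_def)
  have n_eval: "poly (poly n [:a:]) b = poly t b - 2 * a * poly s b + a\<^sup>2 * poly r b" for a b
    by (simp add: n_def algebra_simps power2_eq_square)
  have contn: "content n = 1"
  proof -
    have "content n dvd Polynomial.coeff n 2" "content n dvd Polynomial.coeff n 1"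
      "content n dvd Polynomial.coeff n 0" by simp_all
    then have "content n dvd r" "content n dvd Polynomial.smult (-2) s" "content n dvd t"
      by (simp_all add: n_def numeral_2_eq_2)
    moreover have "(-2 :: 'a) \<noteq> 0" using two by simp
    ultimately have "content n dvd r" "content n dvd s" "content n dvd t"
      by (auto intro: dvd_smult_cancel)
    then have "content n dvd d" by (simp add: d_def)
    then show ?thesis using cop is_unit_content dvd_unit_imp_unit by blast
  qed
  \<comment> \<open>The relation x R'(u) - P'(u) = Q'(u) v, squared and with v^2 = G(u) inserted: a
    polynomial that vanishes at u and has degree at most 2 in X.\<close>
  define m where "m = (Polynomial.smult [:0, 1:] (lift_poly R') - lift_poly P')\<^sup>2
                      - (lift_poly Q')\<^sup>2 * lift_poly G"
  have m_eval: "poly m [:a:] = ([:- poly P' a, poly R' a:])\<^sup>2 - [:(poly Q' a)\<^sup>2 * poly G a:]" for a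
    by (simp add: m_def poly_lift_poly power2_eq_square)
  have "n dvd m"
  proof (rule primitive_minimal_dvd[OF F n0 contn, where u = u])
    show "eventually (\<lambda>p. poly (poly n [:u p:]) (fst p) = 0) (generic F)"
      using u generic_on_curve generic_poly_neq_0[OF g0]
    proof eventually_elim
      case (elim p)
      let ?e = "\<lambda>q. poly q (fst p)"
      have e: "?e R ^ 2 = ?e g * ?e r" "?e P * ?e R = ?e g * ?e s"
        "?e P ^ 2 - ?e Q ^ 2 * ?e F = ?e g * ?e t"
        using arg_cong[OF rst(1), of ?e] arg_cong[OF rst(2), of ?e] arg_cong[OF rst(3), of ?e]
        by simp_all
      have "?e g * poly (poly n [:u p:]) (fst p)
          = (?e g * ?e t) - 2 * u p * (?e g * ?e s) + (u p)^2 * (?e g * ?e r)"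
        by (simp add: n_eval algebra_simps)
      also have "\<dots> = (?e R * u p - ?e P)^2 - ?e Q ^ 2 * ?e F"
        unfolding e[symmetric] by (simp add: algebra_simps power2_eq_square)
      also have "\<dots> = 0" using elim(1,2) by (simp add: power_mult_distrib)
      finally show ?case using elim(3) by simp
    qed
  next
    fix l :: "'a poly poly"
    assume deg: "Polynomial.degree l < Polynomial.degree n"
      and l: "eventually (\<lambda>p. poly (poly l [:u p:]) (fst p) = 0) (generic F)"
    define a b where "a = Polynomial.coeff l 0" and "b = Polynomial.coeff l 1"
    have lab: "l = [:a, b:]"
      using deg unfolding degn a_def b_def
      by (intro poly_eqI) (auto simp: coeff_pCons coeff_eq_0 split: nat.splits)
    \<comment> \<open>Multiplying a + b u = 0 by R gives a relation whose y-coefficient is Q b;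
      hence b = 0 and then a = 0.\<close>
    have "eventually (\<lambda>p. poly (R * a + P * b) (fst p) + poly (Q * b) (fst p) * snd p = 0) (generic F)"
      using u l
    proof eventually_elim
      case (elim p)
      let ?e = "\<lambda>q. poly q (fst p)"
      have "?e a + u p * ?e b = 0" using elim(2) by (simp add: lab)
      then have "?e R * ?e a + (?e R * u p) * ?e b = 0"
        by (simp add: algebra_simps) (metis distrib_left mult.assoc mult.left_commute mult_zero_right)
      then show ?case unfolding elim(1) by (simp add: algebra_simps)
    qed
    note generic_zeroD[OF F this]
    then show "l = 0" using Q R by (auto simp: lab)
  next
    show "eventually (\<lambda>p. poly (poly m [:u p:]) (fst p) = 0) (generic F)"
      using x v
    proof eventually_elim
      case (elim p)
      have "poly (poly m [:u p:]) (fst p)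
          = (fst p * poly R' (u p) - poly P' (u p))\<^sup>2 - (poly Q' (u p))\<^sup>2 * poly G (u p)"
        by (simp add: m_eval power2_eq_square algebra_simps)
      also have "\<dots> = 0" using elim by (simp add: power_mult_distrib)
      finally show ?case .
    qed
  qed
  then obtain k where k: "m = n * k" by (elim dvdE)
  \<comment> \<open>Specialising U to a with R'(a) nonzero makes m a nonzero polynomial of degree 2
    in X, which bounds the degree of its divisor n. As infinitely many a qualify, the bound passes
    to the coefficients r, s, t.\<close>
  have degn_eval: "Polynomial.degree (poly n [:a:]) \<le> 2" if "poly R' a \<noteq> 0" for a
  proof -
    have "Polynomial.coeff (poly m [:a:]) 2 \<noteq> 0"
      using that by (simp add: m_eval power2_eq_square numeral_2_eq_2)
    then have m0: "poly m [:a:] \<noteq> 0" by auto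
    have "Polynomial.degree (poly m [:a:]) \<le> 2"
      unfolding m_eval by (intro degree_diff_le order_trans[OF degree_power_le]) auto
    moreover have "poly n [:a:] dvd poly m [:a:]" by (simp add: k)
    ultimately show ?thesis using dvd_imp_degree_le[OF _ m0] by fastforce
  qed
  have deg_rst: "Polynomial.coeff r i = 0 \<and> Polynomial.coeff s i = 0 \<and> Polynomial.coeff t i = 0"
    if "i > 2" for i
  proof -
    define q where "q = [:Polynomial.coeff t i, -2 * Polynomial.coeff s i, Polynomial.coeff r i:]"
    have "{a. poly R' a \<noteq> 0} \<subseteq> {a. poly q a = 0}"
    proof safe
      fix a assume "poly R' a \<noteq> 0"
      then have "Polynomial.coeff (poly n [:a:]) i = 0"
        using degn_eval[of a] that by (intro coeff_eq_0) auto
      moreover have "poly n [:a:] = t + Polynomial.smult (-2 * a) s + Polynomial.smult (a\<^sup>2) r"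
        by (simp add: n_def algebra_simps power2_eq_square)
      ultimately show "poly q a = 0" by (simp add: q_def algebra_simps power2_eq_square)
    qed
    moreover have "infinite {a. poly R' a \<noteq> 0}" by (rule infinite_nonroots[OF R'])
    ultimately have "q = 0" using finite_subset poly_roots_finite by blast
    then show ?thesis using two by (simp add: q_def)
  qed
  have "Polynomial.degree r \<le> 2" "Polynomial.degree s \<le> 2" "Polynomial.degree t \<le> 2"
    using deg_rst by (auto intro!: degree_le)
  then have "Polynomial.degree (s\<^sup>2 - r * t) \<le> 4"
    by (intro degree_diff_le order_trans[OF degree_power_le] order_trans[OF degree_mult_le]) auto
  \<comment> \<open>\<open>s^2 - r * t\<close> is a quarter of the discriminant of n. Its degree is
    at most 4, while it is nonzero and a multiple of F.\<close>
  moreover have eq: "g\<^sup>2 * (s\<^sup>2 - r * t) = (R * Q)\<^sup>2 * F"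
  proof -
    have "g\<^sup>2 * (s\<^sup>2 - r * t) = (g * s)\<^sup>2 - (g * r) * (g * t)"
      by (simp add: algebra_simps power2_eq_square)
    also have "\<dots> = (R * Q)\<^sup>2 * F"
      unfolding rst[symmetric] by (simp add: algebra_simps power2_eq_square)
    finally show ?thesis .
  qed
  moreover have F5: "rsquarefree F" "Polynomial.degree F \<ge> 5" "F \<noteq> 0"
    using F by (auto simp: simple_sextic_def rsquarefree_def)
  moreover have "F dvd s\<^sup>2 - r * t" by (rule rsquarefree_dvd_of_square_eq[OF F5(1) g0 eq])
  moreover have "s\<^sup>2 - r * t \<noteq> 0" using eq Q R F5(3) by auto
  ultimately show False using dvd_imp_degree_le[of F "s\<^sup>2 - r * t"] by linarith
qed

section \<open>The subfield K(x), up to generic equality\<close>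

definition rational :: "'a::field poly \<Rightarrow> ('a \<times> 'a \<Rightarrow> 'a) \<Rightarrow> bool" where
  "rational F w \<longleftrightarrow> (\<exists>T D. D \<noteq> 0 \<and>
     eventually (\<lambda>p. poly D (fst p) * w p = poly T (fst p)) (generic F))"

lemma rational_poly_fst: "rational F (\<lambda>p. poly T (fst p))"
  unfolding rational_def by (rule exI[of _ T], rule exI[of _ 1]) simp

lemma rational_add:
  assumes "rational F w1" "rational F w2"
  shows "rational F (\<lambda>p. w1 p + w2 p)"
proof -
  obtain T1 D1 T2 D2 where D: "D1 \<noteq> 0" "D2 \<noteq> 0"
    and ev: "eventually (\<lambda>p. poly D1 (fst p) * w1 p = poly T1 (fst p)) (generic F)"
      "eventually (\<lambda>p. poly D2 (fst p) * w2 p = poly T2 (fst p)) (generic F)"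
    using assms unfolding rational_def by blast
  have "eventually (\<lambda>p. poly (D1 * D2) (fst p) * (w1 p + w2 p)
      = poly (D2 * T1 + D1 * T2) (fst p)) (generic F)"
    using ev
  proof eventually_elim
    case (elim p)
    have "poly (D1 * D2) (fst p) * (w1 p + w2 p)
        = poly D2 (fst p) * (poly D1 (fst p) * w1 p) + poly D1 (fst p) * (poly D2 (fst p) * w2 p)"
      by (simp add: algebra_simps)
    then show ?case unfolding elim by simp
  qed
  moreover have "D1 * D2 \<noteq> 0" using D by simp
  ultimately show ?thesis unfolding rational_def by (intro exI conjI)
qed

lemma rational_mult:
  assumes "rational F w1" "rational F w2"
  shows "rational F (\<lambda>p. w1 p * w2 p)"
proof -
  obtain T1 D1 T2 D2 where D: "D1 \<noteq> 0" "D2 \<noteq> 0"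
    and ev: "eventually (\<lambda>p. poly D1 (fst p) * w1 p = poly T1 (fst p)) (generic F)"
      "eventually (\<lambda>p. poly D2 (fst p) * w2 p = poly T2 (fst p)) (generic F)"
    using assms unfolding rational_def by blast
  have "eventually (\<lambda>p. poly (D1 * D2) (fst p) * (w1 p * w2 p) = poly (T1 * T2) (fst p)) (generic F)"
    using ev
  proof eventually_elim
    case (elim p)
    have "poly (D1 * D2) (fst p) * (w1 p * w2 p)
        = (poly D1 (fst p) * w1 p) * (poly D2 (fst p) * w2 p)" by (simp add: mult_ac)
    then show ?case unfolding elim by simp
  qed
  moreover have "D1 * D2 \<noteq> 0" using D by simp
  ultimately show ?thesis unfolding rational_def by (intro exI conjI)
qed

lemma rational_poly:
  assumes "rational F w"
  shows "rational F (\<lambda>p. poly q (w p))"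
proof (induction q)
  case 0
  show ?case using rational_poly_fst[of F 0] by simp
next
  case (pCons a q)
  have "rational F (\<lambda>p. poly [:a:] (fst p) + w p * poly q (w p))"
    by (intro rational_add rational_poly_fst rational_mult assms pCons.IH)
  then show ?case by simp
qed

text \<open>y does not lie in K(x): otherwise it would be the quotient of w2 by w1.\<close>

lemma rational_snd_coefficient:
  fixes F :: "'a::{alg_closed_field, field_gcd} poly"
  assumes F: "simple_sextic F" and "rational F w1" "rational F w2"
    and y: "eventually (\<lambda>p. w1 p * snd p = w2 p) (generic F)"
  shows "eventually (\<lambda>p. w1 p = 0) (generic F)"
proof -
  obtain T1 D1 T2 D2 where D: "D1 \<noteq> 0" "D2 \<noteq> 0"
    and ev: "eventually (\<lambda>p. poly D1 (fst p) * w1 p = poly T1 (fst p)) (generic F)"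
      "eventually (\<lambda>p. poly D2 (fst p) * w2 p = poly T2 (fst p)) (generic F)"
    using assms unfolding rational_def by blast
  have "eventually (\<lambda>p. poly (- (D1 * T2)) (fst p) + poly (D2 * T1) (fst p) * snd p = 0) (generic F)"
    using ev y
  proof eventually_elim
    case (elim p)
    have "poly (D2 * T1) (fst p) * snd p = poly D2 (fst p) * poly D1 (fst p) * (w1 p * snd p)"
      unfolding poly_mult elim(1)[symmetric] by (simp add: mult_ac)
    also have "\<dots> = poly (D1 * T2) (fst p)"
      unfolding elim(3) poly_mult elim(2)[symmetric] by (simp add: mult_ac)
    finally show ?case by simp
  qed
  then have "D2 * T1 = 0" by (rule generic_zeroD[OF F])
  then have "T1 = 0" using D by simp
  with ev(1) have "eventually (\<lambda>p. poly D1 (fst p) * w1 p = 0) (generic F)" by simp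
  with generic_poly_neq_0[OF D(1), of F] show ?thesis by eventually_elim simp
qed

text \<open>G as a binary form of degree 6, evaluated at two polynomials. The degree is 6 even if G
  has degree 5; the form then has the second variable as a factor.\<close>

definition hom_poly :: "'a::comm_ring_1 poly \<Rightarrow> 'a poly \<Rightarrow> 'a poly \<Rightarrow> 'a poly" where
  "hom_poly G P R = (\<Sum>i\<le>6. Polynomial.smult (Polynomial.coeff G i) (P ^ i * R ^ (6 - i)))"

definition hom_eval :: "'a::comm_ring_1 poly \<Rightarrow> 'a \<Rightarrow> 'a \<Rightarrow> 'a" where
  "hom_eval G x z = (\<Sum>i\<le>6. Polynomial.coeff G i * x ^ i * z ^ (6 - i))"

lemma poly_hom_poly: "poly (hom_poly G P R) a = hom_eval G (poly P a) (poly R a)"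
  by (simp add: hom_poly_def hom_eval_def poly_sum mult.assoc)

lemma hom_eval_scale: "hom_eval G (t * x) (t * z) = t ^ 6 * hom_eval G x z"
proof -
  have "Polynomial.coeff G i * (t * x) ^ i * (t * z) ^ (6 - i)
      = t ^ 6 * (Polynomial.coeff G i * x ^ i * z ^ (6 - i))" if "i \<le> 6" for i
  proof -
    have "t ^ 6 = t ^ i * t ^ (6 - i)" using that by (simp flip: power_add)
    then show ?thesis by (simp add: power_mult_distrib mult_ac)
  qed
  then show ?thesis by (simp add: hom_eval_def sum_distrib_left)
qed

lemma hom_eval_1:
  assumes "Polynomial.degree G \<le> 6"
  shows "hom_eval G x 1 = poly G x"
proof -
  have "poly G x = (\<Sum>i\<le>6. Polynomial.coeff G i * x ^ i)"
    unfolding poly_altdef using assms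
    by (intro sum.mono_neutral_left) (auto simp: coeff_eq_0 not_le)
  then show ?thesis by (simp add: hom_eval_def)
qed

lemma degree_hom_poly_le:
  assumes "Polynomial.degree P \<le> 1" "Polynomial.degree R \<le> 1"
  shows "Polynomial.degree (hom_poly G P R) \<le> 6"
  unfolding hom_poly_def
proof (rule degree_sum_le)
  fix i :: nat assume i: "i \<in> {..6}"
  have "Polynomial.degree (P ^ i * R ^ (6 - i)) \<le> Polynomial.degree P * i + Polynomial.degree R * (6 - i)"
    by (intro order_trans[OF degree_mult_le] add_mono degree_power_le)
  also have "\<dots> \<le> 1 * i + 1 * (6 - i)" by (intro add_mono mult_right_mono assms) auto
  finally show "Polynomial.degree (Polynomial.smult (Polynomial.coeff G i) (P ^ i * R ^ (6 - i))) \<le> 6"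
    using i by (intro order_trans[OF degree_smult_le]) auto
qed simp

text \<open>For a reduced fraction u = P0 / R0 the minimal polynomial R0 U - P0 is primitive, so it
  divides the relation x R'(u) - P'(u), which is linear in X. Specialising U as before shows that P0
  and R0 have degree at most 1.\<close>

lemma birational_is_Moebius:
  fixes F :: "'a::{alg_closed_field, field_gcd} poly" and u :: "'a \<times> 'a \<Rightarrow> 'a"
  assumes F: "simple_sextic F"
    and R: "R \<noteq> 0"
    and u: "eventually (\<lambda>p. poly R (fst p) * u p = poly P (fst p)) (generic F)"
    and R': "R' \<noteq> 0"
    and x: "eventually (\<lambda>p. fst p * poly R' (u p) = poly P' (u p)) (generic F)"
    and nonconst: "\<And>q. q \<noteq> 0 \<Longrightarrow> eventually (\<lambda>p. poly q (u p) \<noteq> 0) (generic F)"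
  obtains a b c d where "a * d - b * c \<noteq> 0"
    "eventually (\<lambda>p. (c * fst p + d) * u p = a * fst p + b) (generic F)"
proof -
  define g where "g = gcd P R"
  have g0: "g \<noteq> 0" using R by (simp add: g_def)
  define P0 R0 where "P0 = P div g" and "R0 = R div g"
  have PR: "P = g * P0" "R = g * R0" by (simp_all add: P0_def R0_def g_def)
  have cop: "coprime P0 R0" unfolding P0_def R0_def g_def using R by (intro div_gcd_coprime) auto
  have R00: "R0 \<noteq> 0" using PR R by auto
  have u0: "eventually (\<lambda>p. poly R0 (fst p) * u p = poly P0 (fst p)) (generic F)"
    using u generic_poly_neq_0[OF g0]
    by eventually_elim (simp add: PR)
  define n where "n = [:- P0, R0:]"
  have n0: "n \<noteq> 0" and degn: "Polynomial.degree n = 1" using R00 by (auto simp: n_def)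
  have contn: "content n = 1"
  proof -
    have "content n dvd Polynomial.coeff n 1" "content n dvd Polynomial.coeff n 0" by simp_all
    then have "content n dvd R0" "content n dvd P0" by (simp_all add: n_def)
    then have "is_unit (content n)" using cop coprime_common_divisor by blast
    then show ?thesis by (rule is_unit_content)
  qed
  define m where "m = Polynomial.smult [:0, 1:] (lift_poly R') - lift_poly P'"
  have m_eval: "poly m [:a:] = [:- poly P' a, poly R' a:]" for a
    by (simp add: m_def poly_lift_poly)
  have "n dvd m"
  proof (rule primitive_minimal_dvd[OF F n0 contn, where u = u])
    show "eventually (\<lambda>p. poly (poly n [:u p:]) (fst p) = 0) (generic F)"
      using u0 by eventually_elim (simp add: n_def mult.commute)
  next
    fix l :: "'a poly poly"
    assume deg: "Polynomial.degree l < Polynomial.degree n"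
      and l: "eventually (\<lambda>p. poly (poly l [:u p:]) (fst p) = 0) (generic F)"
    then obtain a where "l = [:a:]" unfolding degn by (auto elim!: degree_eq_zeroE)
    then show "l = 0" using l generic_poly_zeroD[OF F, of a] by simp
  next
    show "eventually (\<lambda>p. poly (poly m [:u p:]) (fst p) = 0) (generic F)"
      using x by eventually_elim (simp add: m_eval)
  qed
  then obtain k where k: "m = n * k" by (elim dvdE)
  have degn_eval: "Polynomial.degree (poly n [:a:]) \<le> 1" if "poly R' a \<noteq> 0" for a
  proof -
    have m0: "poly m [:a:] \<noteq> 0" using that by (simp add: m_eval)
    have "Polynomial.degree (poly m [:a:]) \<le> 1" unfolding m_eval by simp
    moreover have "poly n [:a:] dvd poly m [:a:]" by (simp add: k)
    ultimately show ?thesis using dvd_imp_degree_le[OF _ m0] by fastforce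
  qed
  have coeff0: "Polynomial.coeff R0 i = 0 \<and> Polynomial.coeff P0 i = 0" if "i > 1" for i
  proof -
    define q where "q = [:- Polynomial.coeff P0 i, Polynomial.coeff R0 i:]"
    have "{a. poly R' a \<noteq> 0} \<subseteq> {a. poly q a = 0}"
    proof safe
      fix a assume "poly R' a \<noteq> 0"
      then have "Polynomial.coeff (poly n [:a:]) i = 0"
        using degn_eval[of a] that by (intro coeff_eq_0) auto
      moreover have "poly n [:a:] = Polynomial.smult a R0 - P0"
        by (simp add: n_def)
      ultimately show "poly q a = 0" by (simp add: q_def)
    qed
    moreover have "infinite {a. poly R' a \<noteq> 0}" by (rule infinite_nonroots[OF R'])
    ultimately have "q = 0" using finite_subset poly_roots_finite by blast
    then show ?thesis by (simp add: q_def)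
  qed
  define a b c d where "a = Polynomial.coeff P0 1" and "b = Polynomial.coeff P0 0"
    and "c = Polynomial.coeff R0 1" and "d = Polynomial.coeff R0 0"
  have P0: "P0 = [:b, a:]" and R0: "R0 = [:d, c:]"
    using coeff0 unfolding a_def b_def c_def d_def
    by (auto intro!: poly_eqI simp: coeff_pCons split: nat.splits)
  have eq: "eventually (\<lambda>p. (c * fst p + d) * u p = a * fst p + b) (generic F)"
    using u0 by eventually_elim (simp add: P0 R0 algebra_simps)
  \<comment> \<open>With determinant 0 the function u would be generically constant, a root of a
    nonzero polynomial of degree at most 1.\<close>
  have "a * d - b * c \<noteq> 0"
  proof
    assume det: "a * d - b * c = 0"
    have *: False if "q \<noteq> 0" "eventually (\<lambda>p. poly q (u p) = 0) (generic F)" for q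
    proof -
      have "eventually (\<lambda>p. False) (generic F)" using nonconst[OF that(1)] that(2)
        by eventually_elim simp
      then show False using generic_neq_bot[of F] by simp
    qed
    show False
    proof (cases "a = 0 \<and> c = 0")
      case True
      have "eventually (\<lambda>p. poly [:- b, d:] (u p) = 0) (generic F)"
        using eq by eventually_elim (simp add: True mult.commute)
      then show False using *[of "[:- b, d:]"] True R00 R0 by auto
    next
      case False
      have "eventually (\<lambda>p. poly [:- a, c:] (u p) = 0) (generic F)"
        using eq generic_poly_neq_0[OF R00]
      proof eventually_elim
        case (elim p)
        have "poly R0 (fst p) * poly [:- a, c:] (u p)
            = c * ((c * fst p + d) * u p) - a * (c * fst p + d)"
          by (simp add: R0 algebra_simps)
        also have "\<dots> = 0" unfolding elim(1) using det by (simp add: algebra_simps)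
        finally show ?case using elim(2) by simp
      qed
      then show False using *[of "[:- a, c:]"] False by auto
    qed
  qed
  then show ?thesis using eq that by blast
qed

text \<open>The functions u, v are the affine coordinates of the image point, and the primed data
  express x and y through u and v, so the hypotheses describe a birational map together with its
  inverse. The y-parts are eliminated one by one; the form of v then follows from comparing the two
  sextics.\<close>

theorem birational_is_linear:
  fixes F G :: "'a::{alg_closed_field, field_gcd} poly" and u v :: "'a \<times> 'a \<Rightarrow> 'a"
  assumes two: "(2 :: 'a) \<noteq> 0"
    and F: "simple_sextic F" and G: "Polynomial.degree G \<le> 6"
    and R: "R \<noteq> 0"
    and u: "eventually (\<lambda>p. poly R (fst p) * u p = poly P (fst p) + poly Q (fst p) * snd p) (generic F)"
    and S: "S \<noteq> 0"
    and v: "eventually (\<lambda>p. poly S (fst p) * v p = poly A (fst p) + poly B (fst p) * snd p) (generic F)"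
    and uv: "eventually (\<lambda>p. (v p)\<^sup>2 = poly G (u p)) (generic F)"
    and R': "R' \<noteq> 0"
    and x: "eventually (\<lambda>p. fst p * poly R' (u p) = poly P' (u p) + poly Q' (u p) * v p) (generic F)"
    and S': "S' \<noteq> 0"
    and y: "eventually (\<lambda>p. snd p * poly S' (u p) = poly A' (u p) + poly B' (u p) * v p) (generic F)"
    and nonconst: "\<And>q. q \<noteq> 0 \<Longrightarrow> eventually (\<lambda>p. poly q (u p) \<noteq> 0) (generic F)"
  shows "\<exists>a b c d e. a * d - b * c \<noteq> 0 \<and> e \<noteq> 0 \<and>
    eventually (\<lambda>p. (c * fst p + d) * u p = a * fst p + b) (generic F) \<and>
    eventually (\<lambda>p. (c * fst p + d) ^ 3 * v p = e * snd p) (generic F) \<and>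
    hom_poly G [:b, a:] [:d, c:] = Polynomial.smult (e\<^sup>2) F"
proof -
  have nonconst': "q = 0" if "eventually (\<lambda>p. poly q (u p) = 0) (generic F)" for q
  proof (rule ccontr)
    assume "q \<noteq> 0"
    from nonconst[OF this] that have "eventually (\<lambda>p. False) (generic F)"
      by eventually_elim simp
    then show False using generic_neq_bot[of F] by simp
  qed
  have Q: "Q = 0" by (rule no_quadratic_pullback[OF two F R u uv R' x])
  have u_rat: "rational F u" unfolding rational_def using R u Q by auto
  \<comment> \<open>If v were in K(x), then so would be y, which is rational in u and v.\<close>
  have B: "B \<noteq> 0"
  proof
    assume "B = 0"
    then have "rational F v" unfolding rational_def using S v by auto
    then have "rational F (\<lambda>p. poly A' (u p) + poly B' (u p) * v p)"
      by (intro rational_add rational_mult rational_poly u_rat)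
    moreover have "eventually (\<lambda>p. poly S' (u p) * snd p = poly A' (u p) + poly B' (u p) * v p) (generic F)"
      using y by eventually_elim (simp add: mult.commute)
    ultimately have "eventually (\<lambda>p. poly S' (u p) = 0) (generic F)"
      using rational_snd_coefficient[OF F rational_poly[OF u_rat]] by blast
    then show False using nonconst' S' by blast
  qed
  \<comment> \<open>Eliminating v from the relation for x by means of S v = A + B y puts Q'(u) B y
    into K(x), which forces Q'(u) = 0.\<close>
  have "rational F (\<lambda>p. poly S (fst p) * (poly [:0, 1:] (fst p) * poly R' (u p)
      + poly (- P') (u p)) + poly A (fst p) * poly (- Q') (u p))"
    by (intro rational_add rational_mult rational_poly u_rat rational_poly_fst)
  moreover have "rational F (\<lambda>p. poly Q' (u p) * poly B (fst p))"
    by (intro rational_mult rational_poly u_rat rational_poly_fst)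
  moreover have "eventually (\<lambda>p. poly Q' (u p) * poly B (fst p) * snd p =
    poly S (fst p) * (poly [:0, 1:] (fst p) * poly R' (u p)
      + poly (- P') (u p)) + poly A (fst p) * poly (- Q') (u p)) (generic F)"
    using x v
  proof eventually_elim
    case (elim p)
    have "poly S (fst p) * (fst p * poly R' (u p) - poly P' (u p))
        = (poly S (fst p) * v p) * poly Q' (u p)"
      unfolding elim(1) by (simp add: mult_ac)
    then show ?case unfolding elim(2) by (simp add: algebra_simps)
  qed
  ultimately have "eventually (\<lambda>p. poly Q' (u p) * poly B (fst p) = 0) (generic F)"
    using rational_snd_coefficient[OF F] by blast
  with generic_poly_neq_0[OF B, of F] have "eventually (\<lambda>p. poly Q' (u p) = 0) (generic F)"
    by eventually_elim simp
  then have Q': "Q' = 0" by (rule nonconst')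
  obtain a b c d where det: "a * d - b * c \<noteq> 0"
    and M: "eventually (\<lambda>p. (c * fst p + d) * u p = a * fst p + b) (generic F)"
    by (rule birational_is_Moebius[OF F R _ R' _ nonconst, where P = P and P' = P'])
       (use u x Q Q' in auto)
  define L N H where "L = [:d, c:]" and "N = [:b, a:]" and "H = hom_poly G N L"
  have L0: "L \<noteq> 0" using det by (auto simp: L_def)
  \<comment> \<open>Now u = N / L, and v^2 = G(u) is multiplied by L^6 to clear
    denominators.\<close>
  have LG: "eventually (\<lambda>p. (poly (L ^ 3) (fst p) * v p)\<^sup>2 = poly H (fst p)) (generic F)"
    using M uv
  proof eventually_elim
    case (elim p)
    have "poly L (fst p) * u p = poly N (fst p)"
      using elim(1) by (simp add: L_def N_def algebra_simps)
    then have "poly H (fst p) = hom_eval G (poly L (fst p) * u p) (poly L (fst p) * 1)"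
      by (simp add: H_def poly_hom_poly)
    also have "\<dots> = poly L (fst p) ^ 6 * (v p)\<^sup>2"
      unfolding hom_eval_scale hom_eval_1[OF G] elim(2) ..
    finally show ?case by (simp add: power_mult_distrib flip: power_mult)
  qed
  \<comment> \<open>S^2 H is compared with L^6 (A + B y)^2. The y-coefficient is 2 L^6 A B, so A = 0
    in characteristic other than 2.\<close>
  have "eventually (\<lambda>p. poly (L ^ 6 * (A\<^sup>2 + B\<^sup>2 * F) - S\<^sup>2 * H) (fst p)
      + poly (Polynomial.smult 2 (L ^ 6 * A * B)) (fst p) * snd p = 0) (generic F)"
    using LG v generic_on_curve
  proof eventually_elim
    case (elim p)
    let ?e = "\<lambda>q. poly q (fst p)"
    have "?e S ^ 2 * ?e H = (?e L ^ 3)\<^sup>2 * (?e S * v p)\<^sup>2"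
      unfolding elim(1)[symmetric] by (simp add: power_mult_distrib mult_ac)
    also have "\<dots> = ?e L ^ 6 * (?e A ^ 2 + ?e B ^ 2 * (snd p)\<^sup>2 + 2 * (?e A * ?e B * snd p))"
      unfolding elim(2) by (simp add: algebra_simps power2_eq_square flip: power_mult)
    finally have "?e S ^ 2 * ?e H = \<dots>" .
    then show ?case unfolding elim(3) by (simp add: algebra_simps)
  qed
  note zero = generic_zeroD[OF F this]
  have A: "A = 0" using zero(2) two L0 B by simp
  have SH: "S\<^sup>2 * H = (L ^ 3 * B)\<^sup>2 * F"
    using zero(1) A by (simp add: power_mult_distrib mult.assoc flip: power_mult)
  have F5: "rsquarefree F" "F \<noteq> 0" "Polynomial.degree F \<ge> 5"
    using F by (auto simp: simple_sextic_def rsquarefree_def)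
  obtain K where K: "H = F * K" using rsquarefree_dvd_of_square_eq[OF F5(1) S SH] by (elim dvdE)
  have SK: "S\<^sup>2 * K = (L ^ 3 * B)\<^sup>2" using SH F5(2) unfolding K by simp
  have K0: "K \<noteq> 0" using SK L0 B by auto
  \<comment> \<open>H has degree at most 6 and F at least 5, which leaves degree 0 or 1 for K; as
    S^2 K is a square, the degree of K is even.\<close>
  have "Polynomial.degree H \<le> 6" unfolding H_def by (rule degree_hom_poly_le) (simp_all add: L_def N_def)
  then have "Polynomial.degree K \<le> 1" using F5 K0 unfolding K by (simp add: degree_mult_eq)
  moreover have "2 * Polynomial.degree S + Polynomial.degree K = 2 * Polynomial.degree (L ^ 3 * B)"
    using arg_cong[OF SK, of Polynomial.degree] S K0 L0 B
    by (simp add: degree_mult_eq degree_power_eq)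
  ultimately have "Polynomial.degree K = 0" by presburger
  then obtain \<kappa> where \<kappa>: "K = [:\<kappa>:]" by (elim degree_eq_zeroE)
  obtain e where e: "e\<^sup>2 = \<kappa>" using nth_root_exists[of 2 \<kappa>] by auto
  \<comment> \<open>Both factors come from a difference of squares; the sign is absorbed into
    e'.\<close>
  have "(Polynomial.smult e S - L ^ 3 * B) * (Polynomial.smult e S + L ^ 3 * B) = 0"
  proof -
    have "(Polynomial.smult e S)\<^sup>2 = (L ^ 3 * B)\<^sup>2"
      using SK unfolding \<kappa> by (simp add: e smult_power mult.commute)
    then show ?thesis by (simp add: algebra_simps power2_eq_square)
  qed
  then have "L ^ 3 * B = Polynomial.smult e S \<or> L ^ 3 * B = Polynomial.smult (- e) S"
    by (auto simp: eq_neg_iff_add_eq_0 add.commute)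
  moreover have "(- e)\<^sup>2 = \<kappa>" using e by simp
  ultimately obtain e' where e': "L ^ 3 * B = Polynomial.smult e' S" "e'\<^sup>2 = \<kappa>"
    using e by (elim disjE) (rule that; assumption)+
  have "e' \<noteq> 0" using K0 e' \<kappa> by auto
  moreover have "eventually (\<lambda>p. (c * fst p + d) ^ 3 * v p = e' * snd p) (generic F)"
    using v generic_poly_neq_0[OF S]
  proof eventually_elim
    case (elim p)
    have "poly S (fst p) * (poly L (fst p) ^ 3 * v p) = poly L (fst p) ^ 3 * (poly S (fst p) * v p)"
      by (simp add: mult_ac)
    also have "\<dots> = poly (L ^ 3 * B) (fst p) * snd p" unfolding elim(1) by (simp add: A)
    also have "\<dots> = poly S (fst p) * (e' * snd p)" unfolding e' by simp
    finally show ?case using elim(2) by (simp add: L_def algebra_simps)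
  qed
  moreover have "hom_poly G [:b, a:] [:d, c:] = Polynomial.smult (e'\<^sup>2) F"
    using K unfolding \<kappa> H_def L_def N_def e'(2) by simp
  ultimately show ?thesis using det M by blast
qed

section \<open>Points and forms\<close>

text \<open>The coordinate ring K[x] + K[x] y of the affine curve, as functions on its
  points.\<close>

definition regular :: "'a::field poly \<Rightarrow> ('a \<times> 'a \<Rightarrow> 'a) \<Rightarrow> bool" where
  "regular F w \<longleftrightarrow>
     (\<exists>A B. \<forall>p\<in>affine_curve F. w p = poly A (fst p) + poly B (fst p) * snd p)"

lemma regular_const: "regular F (\<lambda>p. c)"
  unfolding regular_def by (rule exI[of _ "[:c:]"], rule exI[of _ 0]) simp

lemma regular_fst: "regular F fst"
  unfolding regular_def by (rule exI[of _ "[:0, 1:]"], rule exI[of _ 0]) simp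

lemma regular_snd: "regular F snd"
  unfolding regular_def by (rule exI[of _ 0], rule exI[of _ 1]) simp

lemma regular_add:
  assumes "regular F w1" "regular F w2"
  shows "regular F (\<lambda>p. w1 p + w2 p)"
proof -
  obtain A1 B1 A2 B2 where
    "\<forall>p\<in>affine_curve F. w1 p = poly A1 (fst p) + poly B1 (fst p) * snd p"
    "\<forall>p\<in>affine_curve F. w2 p = poly A2 (fst p) + poly B2 (fst p) * snd p"
    using assms unfolding regular_def by blast
  then show ?thesis unfolding regular_def
    by (intro exI[of _ "A1 + A2"] exI[of _ "B1 + B2"]) (simp add: algebra_simps)
qed

lemma regular_mult:
  assumes "regular F w1" "regular F w2"
  shows "regular F (\<lambda>p. w1 p * w2 p)"
proof -
  obtain A1 B1 A2 B2 where w: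
    "\<forall>p\<in>affine_curve F. w1 p = poly A1 (fst p) + poly B1 (fst p) * snd p"
    "\<forall>p\<in>affine_curve F. w2 p = poly A2 (fst p) + poly B2 (fst p) * snd p"
    using assms unfolding regular_def by blast
  have "w1 p * w2 p = poly (A1 * A2 + B1 * B2 * F) (fst p) + poly (A1 * B2 + B1 * A2) (fst p) * snd p"
    if "p \<in> affine_curve F" for p
  proof -
    have "poly F (fst p) = snd p * snd p"
      using that by (simp add: affine_curve_def power2_eq_square)
    then show ?thesis using w that by (simp add: algebra_simps)
  qed
  then show ?thesis unfolding regular_def by blast
qed

lemma regular_power: "regular F w \<Longrightarrow> regular F (\<lambda>p. w p ^ n)"
  by (induction n) (simp_all add: regular_const regular_mult)

lemma regular_minus: "regular F w1 \<Longrightarrow> regular F w2 \<Longrightarrow> regular F (\<lambda>p. w1 p - w2 p)"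
  using regular_add[OF _ regular_mult[OF regular_const[of F "-1"]], of w1 w2] by simp

lemma regular_sum: "(\<And>i. i \<in> I \<Longrightarrow> regular F (w i)) \<Longrightarrow> regular F (\<lambda>p. \<Sum>i\<in>I. w i p)"
  by (induction I rule: infinite_finite_induct) (simp_all add: regular_const regular_add)

lemmas regular_intros = regular_const regular_fst regular_snd regular_add regular_mult
  regular_power regular_minus regular_sum

text \<open>This is how the irreducibility of the affine curve enters: a regular function with
  infinitely many zeros is identically zero.\<close>

lemma regular_zero_dichotomy:
  fixes F :: "'a::field poly"
  assumes F: "non_square F" and w: "regular F w"
  shows "(\<forall>p\<in>affine_curve F. w p = 0) \<or> finite {p \<in> affine_curve F. w p = 0}"
proof -
  obtain A B where w: "\<forall>p\<in>affine_curve F. w p = poly A (fst p) + poly B (fst p) * snd p"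
    using w unfolding regular_def by blast
  then have "{p \<in> affine_curve F. w p = 0}
      = {p \<in> affine_curve F. poly A (fst p) + poly B (fst p) * snd p = 0}" by auto
  then show ?thesis using zero_on_infinite_subset[OF F, of A B] w by auto
qed

lemma regular_eventually_neq_0:
  fixes F :: "'a::field poly"
  assumes "non_square F" "regular F w" "p0 \<in> affine_curve F" "w p0 \<noteq> 0"
  shows "eventually (\<lambda>p. w p \<noteq> 0) (generic F)"
  using regular_zero_dichotomy[OF assms(1,2)] assms(3,4) by (auto simp: eventually_generic)

text \<open>Multiplying numerator and denominator by the conjugate A - B y turns the denominator
  into its norm, a nonzero polynomial in x.\<close>

lemma regular_quotient:
  fixes F :: "'a::{alg_closed_field, field_gcd} poly"
  assumes F: "simple_sextic F" and f: "regular F f" and h: "regular F h"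
    and nz: "eventually (\<lambda>p. h p \<noteq> 0) (generic F)"
  shows "\<exists>R P Q. R \<noteq> 0 \<and> eventually (\<lambda>p. poly R (fst p) * (f p / h p)
    = poly P (fst p) + poly Q (fst p) * snd p) (generic F)"
proof -
  obtain A B where h: "\<forall>p\<in>affine_curve F. h p = poly A (fst p) + poly B (fst p) * snd p"
    using h unfolding regular_def by blast
  define R where "R = A\<^sup>2 - B\<^sup>2 * F"
  have "R \<noteq> 0"
  proof
    assume "R = 0"
    then have "A = 0" "B = 0" using norm_eq_0D[OF F, of A B] by (auto simp: R_def)
    then have "\<forall>p\<in>affine_curve F. h p = 0" using h by simp
    then have "{p \<in> affine_curve F. \<not> h p \<noteq> 0} = affine_curve F" by auto
    then show False using nz infinite_affine_curve[of F] by (simp add: eventually_generic)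
  qed
  have "regular F (\<lambda>p. f p * (poly A (fst p) - poly B (fst p) * snd p))"
  proof -
    have "regular F (\<lambda>p. poly q (fst p))" for q
      unfolding regular_def by (rule exI[of _ q], rule exI[of _ 0]) simp
    then show ?thesis by (intro regular_intros f)
  qed
  then obtain P Q where PQ: "\<forall>p\<in>affine_curve F. f p * (poly A (fst p) - poly B (fst p) * snd p)
      = poly P (fst p) + poly Q (fst p) * snd p" unfolding regular_def by blast
  have "eventually (\<lambda>p. poly R (fst p) * (f p / h p)
    = poly P (fst p) + poly Q (fst p) * snd p) (generic F)"
    using nz generic_on_curve
  proof eventually_elim
    case (elim p)
    then have p: "p \<in> affine_curve F" by (simp add: affine_curve_def)
    have "poly R (fst p) = h p * (poly A (fst p) - poly B (fst p) * snd p)"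
      using h p elim(2) by (simp add: R_def algebra_simps power2_eq_square)
    then have "poly R (fst p) * (f p / h p) = f p * (poly A (fst p) - poly B (fst p) * snd p)"
      using elim(1) by simp
    then show ?case using PQ p by simp
  qed
  then show ?thesis using \<open>R \<noteq> 0\<close> by blast
qed

text \<open>The curve for an equation with coefficients already in the closed field. All geometry
  takes place here; the base field returns only with the Galois action.\<close>

definition proj_curve :: "'a::field poly \<Rightarrow> 'a wpoint set" where
  "proj_curve F = {wpoint (x, y, z) | x y z. (x, y, z) \<noteq> (0, 0, 0) \<and> y\<^sup>2 = hom_eval F x z}"

lemma curve_eq_proj_curve: "curve F = proj_curve (map_poly to_ac F)"
  by (simp add: curve_def proj_curve_def hom_eval_def coeff_map_poly)

section \<open>Weighted projective points in coordinates\<close>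

lemma wpoint_self: "q \<in> wpoint q"
  unfolding wpoint_def by (cases q) (auto intro!: exI[of _ 1])

lemma wpoint_scale_subset:
  fixes x y z t :: "'a::field"
  assumes "t \<noteq> 0"
  shows "wpoint (t * x, t ^ 3 * y, t * z) \<subseteq> wpoint (x, y, z)"
proof
  fix q assume "q \<in> wpoint (t * x, t ^ 3 * y, t * z)"
  then obtain s where "s \<noteq> 0" "q = (s * (t * x), s ^ 3 * (t ^ 3 * y), s * (t * z))"
    unfolding wpoint_def by auto
  then have "s * t \<noteq> 0" "q = ((s * t) * x, (s * t) ^ 3 * y, (s * t) * z)"
    using assms by (simp_all add: power_mult_distrib mult_ac)
  then show "q \<in> wpoint (x, y, z)" unfolding wpoint_def by blast
qed

lemma wpoint_scale:
  fixes x y z t :: "'a::field"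
  assumes t: "t \<noteq> 0"
  shows "wpoint (t * x, t ^ 3 * y, t * z) = wpoint (x, y, z)"
proof
  have inv: "1 / t * (t * x) = x" "(1 / t) ^ 3 * (t ^ 3 * y) = y" "1 / t * (t * z) = z"
    using t by (simp_all add: power_divide)
  have "1 / t \<noteq> 0" using t by simp
  from wpoint_scale_subset[OF this, of "t * x" "t ^ 3 * y" "t * z"]
  show "wpoint (x, y, z) \<subseteq> wpoint (t * x, t ^ 3 * y, t * z)" unfolding inv .
qed (rule wpoint_scale_subset[OF t])

lemma wpoint_eq_iff:
  fixes x y z x' y' z' :: "'a::field"
  shows "wpoint (x, y, z) = wpoint (x', y', z') \<longleftrightarrow>
     (\<exists>t. t \<noteq> 0 \<and> x' = t * x \<and> y' = t ^ 3 * y \<and> z' = t * z)"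
proof
  assume "wpoint (x, y, z) = wpoint (x', y', z')"
  then have "(x', y', z') \<in> wpoint (x, y, z)" using wpoint_self by blast
  then show "\<exists>t. t \<noteq> 0 \<and> x' = t * x \<and> y' = t ^ 3 * y \<and> z' = t * z" by (auto simp: wpoint_def)
qed (auto simp: wpoint_scale)

lemma wpoint_in_proj_curve:
  "wpoint (x, y, z) \<in> proj_curve F \<longleftrightarrow> (x, y, z) \<noteq> (0, 0, 0) \<and> y\<^sup>2 = hom_eval F x z"
proof
  assume "wpoint (x, y, z) \<in> proj_curve F"
  then obtain x' y' z' where *: "wpoint (x', y', z') = wpoint (x, y, z)"
    "(x', y', z') \<noteq> (0, 0, 0)" "y'\<^sup>2 = hom_eval F x' z'" unfolding proj_curve_def by force
  then obtain t where t: "t \<noteq> 0" "x = t * x'" "y = t ^ 3 * y'" "z = t * z'"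
    unfolding wpoint_eq_iff by blast
  have "y\<^sup>2 = t ^ 6 * y'\<^sup>2" unfolding t by (simp add: power_mult_distrib flip: power_mult)
  then show "(x, y, z) \<noteq> (0, 0, 0) \<and> y\<^sup>2 = hom_eval F x z"
    using * t by (auto simp: hom_eval_scale)
qed (unfold proj_curve_def, blast)

definition affine_point :: "'a::field \<times> 'a \<Rightarrow> 'a wpoint" where
  "affine_point p = wpoint (fst p, snd p, 1)"

lemma inj_affine_point: "inj affine_point"
  by (rule injI) (auto simp: affine_point_def wpoint_eq_iff prod_eq_iff)

lemma affine_point_in_proj_curve:
  "Polynomial.degree F \<le> 6 \<Longrightarrow> affine_point p \<in> proj_curve F \<longleftrightarrow> p \<in> affine_curve F"
  by (simp add: affine_point_def wpoint_in_proj_curve hom_eval_1 affine_curve_def)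

lemma wpoint_affine: "z \<noteq> 0 \<Longrightarrow> wpoint (x, y, z) = affine_point (x / z, y / z ^ 3)"
  unfolding affine_point_def wpoint_eq_iff by (rule exI[of _ "1 / z"]) (simp add: power_divide)

text \<open>For z = 0 the equation forces x to be nonzero; after scaling x to 1, y is a square root
  of the coefficient of X^6.\<close>

lemma finite_points_at_infinity: "finite {P \<in> proj_curve F. \<exists>x y. P = wpoint (x, y, 0)}"
proof -
  have "P \<in> (\<lambda>y. wpoint (1, y, 0)) ` {y. y\<^sup>2 = hom_eval F 1 0}"
    if P: "P \<in> proj_curve F" "P = wpoint (x, y, 0)" for P x y
  proof -
    have y: "y\<^sup>2 = hom_eval F x 0" "(x, y) \<noteq> (0, 0)"
      using P by (auto simp: wpoint_in_proj_curve)
    have "hom_eval F (x * 1) (x * 0) = x ^ 6 * hom_eval F 1 0" by (rule hom_eval_scale)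
    then have "x \<noteq> 0" "y\<^sup>2 = x ^ 6 * hom_eval F 1 0" using y by auto
    then have "(y / x ^ 3)\<^sup>2 = hom_eval F 1 0" "P = wpoint (1, y / x ^ 3, 0)"
      unfolding P wpoint_eq_iff
      by (auto simp: power_divide simp flip: power_mult intro!: exI[of _ "1 / x"])
    then show ?thesis by blast
  qed
  then have "{P \<in> proj_curve F. \<exists>x y. P = wpoint (x, y, 0)}
    \<subseteq> (\<lambda>y. wpoint (1, y, 0)) ` {y. y\<^sup>2 = hom_eval F 1 0}" by blast
  then show ?thesis by (rule finite_subset) (intro finite_imageI finite_square_roots)
qed

lemma wform_scale:
  assumes "wform L d f"
  shows "f (t * x, t ^ 3 * y, t * z) = t ^ d * f (x, y, z)"
proof -
  obtain c where f: "f = (\<lambda>(x, y, z). \<Sum>(i, j) | i + 3 * j \<le> d. c i j * x ^ i * y ^ j * z ^ (d - (i + 3 * j)))"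
    using assms unfolding wform_def by blast
  have "c i j * (t * x) ^ i * (t ^ 3 * y) ^ j * (t * z) ^ (d - (i + 3 * j))
      = t ^ d * (c i j * x ^ i * y ^ j * z ^ (d - (i + 3 * j)))" if "i + 3 * j \<le> d" for i j
  proof -
    have "t ^ d = t ^ i * (t ^ 3) ^ j * t ^ (d - (i + 3 * j))"
      using that by (simp flip: power_add power_mult)
    then show ?thesis by (simp add: power_mult_distrib mult_ac)
  qed
  then show ?thesis unfolding f by (auto simp: sum_distrib_left intro!: sum.cong)
qed

lemma regular_wform_affine:
  assumes "wform L d f"
  shows "regular F (\<lambda>p. f (fst p, snd p, 1))"
proof -
  obtain c where f: "f = (\<lambda>(x, y, z). \<Sum>(i, j) | i + 3 * j \<le> d. c i j * x ^ i * y ^ j * z ^ (d - (i + 3 * j)))"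
    using assms unfolding wform_def by blast
  show ?thesis unfolding f
    by (simp add: case_prod_unfold) (intro regular_intros)
qed

lemma regular_wform_infinity:
  assumes "wform L d f"
  shows "regular F (\<lambda>p. f (1, snd p, fst p))"
proof -
  obtain c where f: "f = (\<lambda>(x, y, z). \<Sum>(i, j) | i + 3 * j \<le> d. c i j * x ^ i * y ^ j * z ^ (d - (i + 3 * j)))"
    using assms unfolding wform_def by blast
  show ?thesis unfolding f
    by (simp add: case_prod_unfold) (intro regular_intros)
qed

section \<open>Isomorphisms of genus 2 curves\<close>

text \<open>The equation of the curve in the chart X = 1 with coordinates (z, y). Unlike
  \<open>reflect_poly\<close> it always reverses with respect to degree 6, so that F of degree 5
  yields a root at z = 0.\<close>

definition reversed :: "'a::comm_ring_1 poly \<Rightarrow> 'a poly" where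
  "reversed F = hom_poly F 1 [:0, 1:]"

lemma poly_reversed: "poly (reversed F) z = hom_eval F 1 z"
  by (simp add: reversed_def poly_hom_poly)

lemma non_square_reversed:
  fixes F :: "'a::{alg_closed_field, field_gcd} poly"
  assumes F: "simple_sextic F"
  shows "non_square (reversed F)"
  unfolding non_square_def
proof (intro allI impI)
  fix A B assume eq: "A\<^sup>2 = B\<^sup>2 * reversed F"
  \<comment> \<open>The substitution z = 1 / x with denominators cleared. The extra exponent 3
    accounts for F(x) = x^6 \<open>reversed F\<close>(1 / x), whose factor x^6 is the square of
    x^3.\<close>
  define A' B' where "A' = Polynomial.monom 1 (Polynomial.degree B + 3) * reflect_poly A"
    and "B' = Polynomial.monom 1 (Polynomial.degree A) * reflect_poly B"
  have "poly (A'\<^sup>2 - B'\<^sup>2 * F) x = 0" if "x \<noteq> 0" for x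
  proof -
    have refl: "poly (reflect_poly p) x = x ^ Polynomial.degree p * poly p (1 / x)" for p
      using poly_reflect_poly_nz[OF that, of p] by (simp add: inverse_eq_divide)
    have "Polynomial.degree F \<le> 6" using F by (auto simp: simple_sextic_def)
    then have "poly F x = hom_eval F (x * 1) (x * (1 / x))" using that by (simp add: hom_eval_1)
    also have "\<dots> = x ^ 6 * poly (reversed F) (1 / x)" by (simp only: hom_eval_scale poly_reversed)
    finally have "poly (B'\<^sup>2 * F) x = (x ^ Polynomial.degree A * x ^ Polynomial.degree B)\<^sup>2
        * x ^ 6 * poly (B\<^sup>2 * reversed F) (1 / x)"
      by (simp add: B'_def refl poly_monom power_mult_distrib mult_ac)
    moreover have "poly (A'\<^sup>2) x = (x ^ Polynomial.degree A * x ^ Polynomial.degree B)\<^sup>2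
        * x ^ 6 * poly (A\<^sup>2) (1 / x)"
      by (simp add: A'_def refl poly_monom power_mult_distrib power_add mult_ac flip: power_mult)
    ultimately show ?thesis by (simp add: eq)
  qed
  then have "- {0} \<subseteq> {x. poly (A'\<^sup>2 - B'\<^sup>2 * F) x = 0}" by auto
  moreover have "infinite (- {0 :: 'a})"
    using infinite_UNIV_alg_closed[where 'a = 'a] by (simp add: Compl_eq_Diff_UNIV Diff_infinite_finite)
  ultimately have "A'\<^sup>2 - B'\<^sup>2 * F = 0" using finite_subset poly_roots_finite by blast
  then have "A' = 0" "B' = 0" using norm_eq_0D[OF F, of A' B'] by auto
  then show "A = 0 \<and> B = 0" by (simp add: A'_def B'_def)
qed

text \<open>Regularity is asked for in the chart \<open>Z = 1\<close> and in the chart \<open>X = 1\<close>, which contains the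
  points at infinity.\<close>

definition form_like :: "'a::field poly \<Rightarrow> nat \<Rightarrow> ('a \<times> 'a \<times> 'a \<Rightarrow> 'a) \<Rightarrow> bool" where
  "form_like F n E \<longleftrightarrow> (\<forall>t x y z. E (t * x, t ^ 3 * y, t * z) = t ^ n * E (x, y, z)) \<and>
     regular F (\<lambda>p. E (fst p, snd p, 1)) \<and> regular (reversed F) (\<lambda>p. E (1, snd p, fst p))"

lemma form_like_wform: "wform L d f \<Longrightarrow> form_like F d f"
  using wform_scale regular_wform_affine regular_wform_infinity unfolding form_like_def by blast

lemma form_like_linear: "form_like F 1 (\<lambda>(x, y, z). a * x + b * z)"
  unfolding form_like_def by (auto simp: algebra_simps intro!: regular_intros)

lemma form_like_snd: "form_like F 3 (\<lambda>(x, y, z). e * y)"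
  unfolding form_like_def by (auto simp: algebra_simps intro!: regular_intros)

lemma form_like_mult:
  "form_like F n E1 \<Longrightarrow> form_like F m E2 \<Longrightarrow> form_like F (n + m) (\<lambda>q. E1 q * E2 q)"
  unfolding form_like_def by (auto simp: power_add mult_ac intro!: regular_intros)

lemma form_like_minus:
  "form_like F n E1 \<Longrightarrow> form_like F n E2 \<Longrightarrow> form_like F n (\<lambda>q. E1 q - E2 q)"
  unfolding form_like_def by (auto simp: algebra_simps intro!: regular_intros)

lemma form_like_power: "form_like F n E \<Longrightarrow> form_like F (m * n) (\<lambda>q. E q ^ m)"
  unfolding form_like_def
  by (auto simp: power_mult_distrib mult.commute simp flip: power_mult intro!: regular_intros)

text \<open>Vanishing spreads by the zero dichotomy from almost all affine points to all of them,
  then through the overlap with the chart X = 1 to the points at infinity.\<close>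

lemma form_like_vanishes:
  fixes F :: "'a::{alg_closed_field, field_gcd} poly"
  assumes F: "simple_sextic F" and E: "form_like F n E"
    and gen: "eventually (\<lambda>p. E (fst p, snd p, 1) = 0) (generic F)"
    and q: "wpoint (x, y, z) \<in> proj_curve F"
  shows "E (x, y, z) = 0"
proof -
  have scale: "E (t * x, t ^ 3 * y, t * z) = t ^ n * E (x, y, z)" for t x y z
    using E unfolding form_like_def by blast
  have deg: "Polynomial.degree F \<le> 6" using F by (auto simp: simple_sextic_def)
  let ?Z = "{p \<in> affine_curve F. E (fst p, snd p, 1) = 0}"
  let ?N = "{p \<in> affine_curve F. E (fst p, snd p, 1) \<noteq> 0}"
  have "finite ?N" using gen by (simp add: eventually_generic)
  moreover have "affine_curve F = ?Z \<union> ?N" by auto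
  ultimately have inf: "infinite ?Z" using infinite_affine_curve[of F] finite_UnI[of ?Z ?N] by auto
  have affine: "E (x, y, 1) = 0" if "(x, y) \<in> affine_curve F" for x y
    using regular_zero_dichotomy[OF non_square_simple_sextic[OF F], of "\<lambda>p. E (fst p, snd p, 1)"]
      E inf that unfolding form_like_def by fastforce
  show ?thesis
  proof (cases "z = 0")
    case False
    have "affine_point (x / z, y / z ^ 3) \<in> proj_curve F" using q wpoint_affine[OF False] by metis
    then have "E (x / z, y / z ^ 3, 1) = 0" using affine affine_point_in_proj_curve[OF deg] by blast
    moreover have "E (x, y, z) = z ^ n * E (x / z, y / z ^ 3, 1)"
      using scale[of z "x / z" "y / z ^ 3" 1] False by simp
    ultimately show ?thesis by simp
  next
    case True
    have "x \<noteq> 0"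
    proof
      assume "x = 0"
      then have "y\<^sup>2 = hom_eval F (0 * 1) (0 * 1)" "y \<noteq> 0" using q True by (auto simp: wpoint_in_proj_curve)
      then show False unfolding hom_eval_scale by simp
    qed
    define W where "W = {p \<in> affine_curve F. fst p \<notin> {0}}"
    \<comment> \<open>The change of charts: (x, y, 1) and (1, y / x^3, 1 / x) are the same weighted
      point.\<close>
    define \<theta> :: "'a \<times> 'a \<Rightarrow> 'a \<times> 'a" where "\<theta> p = (1 / fst p, snd p / fst p ^ 3)" for p
    have "infinite W"
    proof
      assume "finite W"
      then have fin: "finite (W \<union> {p \<in> affine_curve F. fst p \<in> {0}})"
        using finite_affine_curve_over[of "{0}" F] by blast
      have "W \<union> {p \<in> affine_curve F. fst p \<in> {0}} = affine_curve F" by (auto simp: W_def)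
      with fin show False using infinite_affine_curve[of F] by argo
    qed
    moreover have "inj_on \<theta> W" by (rule inj_onI) (auto simp: \<theta>_def W_def prod_eq_iff)
    ultimately have "infinite (\<theta> ` W)" using finite_imageD by blast
    moreover have "\<theta> ` W \<subseteq> {p \<in> affine_curve (reversed F). E (1, snd p, fst p) = 0}"
    proof (rule image_subsetI)
      fix p assume "p \<in> W"
      obtain x y where p: "p = (x, y)" by (cases p)
      with \<open>p \<in> W\<close> have x: "x \<noteq> 0" and c: "(x, y) \<in> affine_curve F" by (simp_all add: W_def)
      have "E (1 / x * x, (1 / x) ^ 3 * y, 1 / x * 1) = 0"
        unfolding scale using affine[OF c] by simp
      then have E0: "E (1, snd (\<theta> (x, y)), fst (\<theta> (x, y))) = 0"
        using x by (simp add: \<theta>_def power_divide)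
      have "y\<^sup>2 = hom_eval F (x * 1) (x * (1 / x))"
        using x c by (simp add: hom_eval_1[OF deg] affine_curve_def)
      also have "\<dots> = x ^ 6 * hom_eval F 1 (1 / x)" by (rule hom_eval_scale)
      finally have c': "y\<^sup>2 = x ^ 6 * hom_eval F 1 (1 / x)" .
      have "\<theta> (x, y) \<in> affine_curve (reversed F)"
        using x c' by (simp add: \<theta>_def affine_curve_def poly_reversed power_divide flip: power_mult)
      with E0 show "\<theta> p \<in> {p \<in> affine_curve (reversed F). E (1, snd p, fst p) = 0}"
        unfolding p by blast
    qed
    ultimately have "infinite {p \<in> affine_curve (reversed F). E (1, snd p, fst p) = 0}"
      using finite_subset by blast
    then have infinity: "E (1, y, z) = 0" if "(z, y) \<in> affine_curve (reversed F)" for y z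
      using regular_zero_dichotomy[OF non_square_reversed[OF F], of "\<lambda>p. E (1, snd p, fst p)"]
        E that unfolding form_like_def by fastforce
    have "hom_eval F (x * 1) (x * 0) = x ^ 6 * hom_eval F 1 0" by (rule hom_eval_scale)
    then have "y\<^sup>2 = x ^ 6 * hom_eval F 1 0" using q True by (simp add: wpoint_in_proj_curve)
    then have "(0, y / x ^ 3) \<in> affine_curve (reversed F)" using \<open>x \<noteq> 0\<close>
      by (simp add: affine_curve_def poly_reversed power_divide flip: power_mult)
    then have "E (1, y / x ^ 3, 0) = 0" by (rule infinity)
    moreover have "E (x, y, z) = x ^ n * E (1, y / x ^ 3, 0)"
      using scale[of x 1 "y / x ^ 3" 0] \<open>x \<noteq> 0\<close> True by simp
    ultimately show ?thesis by simp
  qed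
qed

text \<open>The forms chosen near one point describe \<phi> at almost all points: one of them is
  nonzero at the given point, so it cannot vanish on the whole affine curve, and its affine zeros
  are finite in number.\<close>

lemma morphism_generic_form:
  fixes F G :: "'a::{alg_closed_field, field_gcd} poly"
  assumes F: "simple_sextic F" and mor: "morphism_over L (proj_curve F) D \<phi>"
    and P: "wpoint (x, y, z) \<in> proj_curve F"
  obtains d f g h where "wform L d f" "wform L (3 * d) g" "wform L d h"
    "(f (x, y, z), g (x, y, z), h (x, y, z)) \<noteq> (0, 0, 0)"
    "\<And>q. wpoint q \<in> proj_curve F \<Longrightarrow> (f q, g q, h q) \<noteq> (0, 0, 0) \<Longrightarrow> \<phi> (wpoint q) = wpoint (f q, g q, h q)"
    "eventually (\<lambda>p. (f (fst p, snd p, 1), g (fst p, snd p, 1), h (fst p, snd p, 1)) \<noteq> (0, 0, 0)) (generic F)"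
proof -
  have deg: "Polynomial.degree F \<le> 6" using F by (auto simp: simple_sextic_def)
  obtain d f g h where w: "wform L d f" "wform L (3 * d) g" "wform L d h"
    and ex: "\<exists>p. wpoint p = wpoint (x, y, z) \<and> (f p, g p, h p) \<noteq> (0, 0, 0)"
    and eq: "\<And>q. wpoint q \<in> proj_curve F \<Longrightarrow> (f q, g q, h q) \<noteq> (0, 0, 0) \<Longrightarrow>
              \<phi> (wpoint q) = wpoint (f q, g q, h q)"
    using mor P unfolding morphism_over_def by metis
  obtain x' y' z' where p: "wpoint (x', y', z') = wpoint (x, y, z)"
    "(f (x', y', z'), g (x', y', z'), h (x', y', z')) \<noteq> (0, 0, 0)"
    using ex by (metis prod_cases3)
  \<comment> \<open>The definition of a morphism supplies some representative of the point; by
    homogeneity the forms are not all zero at the given one either.\<close>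
  then obtain t where t: "t \<noteq> 0" "x' = t * x" "y' = t ^ 3 * y" "z' = t * z"
    by (metis wpoint_eq_iff)
  have nz: "(f (x, y, z), g (x, y, z), h (x, y, z)) \<noteq> (0, 0, 0)"
    using p(2) unfolding t wform_scale[OF w(1)] wform_scale[OF w(2)] wform_scale[OF w(3)] by auto
  have ns: "non_square F" using F by (rule non_square_simple_sextic)
  have "\<exists>e w. wform L e w \<and> w (x, y, z) \<noteq> 0 \<and> w \<in> {f, g, h}" using nz w by blast
  then obtain e k where k: "wform L e k" "k (x, y, z) \<noteq> 0" "k \<in> {f, g, h}" by blast
  have "\<not> (\<forall>p\<in>affine_curve F. k (fst p, snd p, 1) = 0)"
  proof
    assume "\<forall>p\<in>affine_curve F. k (fst p, snd p, 1) = 0"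
    then have "{p \<in> affine_curve F. \<not> k (fst p, snd p, 1) = 0} = {}" by auto
    then have "eventually (\<lambda>p. k (fst p, snd p, 1) = 0) (generic F)"
      by (simp only: eventually_generic finite.emptyI)
    then show False using form_like_vanishes[OF F form_like_wform[OF k(1)] _ P] k(2) by blast
  qed
  then have "eventually (\<lambda>p. k (fst p, snd p, 1) \<noteq> 0) (generic F)"
    using regular_eventually_neq_0[OF ns regular_wform_affine[OF k(1)]] by blast
  then have "eventually (\<lambda>p. (f (fst p, snd p, 1), g (fst p, snd p, 1), h (fst p, snd p, 1)) \<noteq> (0, 0, 0)) (generic F)"
    by eventually_elim (use k(3) in auto)
  then show ?thesis using that w nz eq by blast
qed

text \<open>The coordinates are u = f / h and v = g / h^3. If h vanished identically, injectivity
  would send infinitely many points into the finite set at infinity.\<close>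

lemma morphism_affine:
  fixes F G :: "'a::{alg_closed_field, field_gcd} poly"
  assumes F: "simple_sextic F" and G: "Polynomial.degree G \<le> 6"
    and mor: "morphism_over L (proj_curve F) (proj_curve G) \<phi>" and inj: "inj_on \<phi> (proj_curve F)"
  obtains R P Q S A B u v where "R \<noteq> 0" "S \<noteq> 0"
    "eventually (\<lambda>p. poly R (fst p) * u p = poly P (fst p) + poly Q (fst p) * snd p) (generic F)"
    "eventually (\<lambda>p. poly S (fst p) * v p = poly A (fst p) + poly B (fst p) * snd p) (generic F)"
    "eventually (\<lambda>p. \<phi> (affine_point p) = affine_point (u p, v p)) (generic F)"
proof -
  have deg: "Polynomial.degree F \<le> 6" using F by (auto simp: simple_sextic_def)
  have ns: "non_square F" using F by (rule non_square_simple_sextic)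
  obtain x y where "(x, y) \<in> affine_curve F"
    using infinite_affine_curve[of F] by (metis finite.emptyI ex_in_conv surj_pair)
  then have P0: "wpoint (x, y, 1) \<in> proj_curve F"
    using affine_point_in_proj_curve[OF deg, of "(x, y)"] by (simp add: affine_point_def)
  obtain d f g h where w: "wform L d f" "wform L (3 * d) g" "wform L d h"
    and "(f (x, y, 1), g (x, y, 1), h (x, y, 1)) \<noteq> (0, 0, 0)"
    and eq: "\<And>q. wpoint q \<in> proj_curve F \<Longrightarrow> (f q, g q, h q) \<noteq> (0, 0, 0) \<Longrightarrow>
              \<phi> (wpoint q) = wpoint (f q, g q, h q)"
    and nz: "eventually (\<lambda>p. (f (fst p, snd p, 1), g (fst p, snd p, 1), h (fst p, snd p, 1)) \<noteq> (0, 0, 0)) (generic F)"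
    by (rule morphism_generic_form[OF F mor P0]) (erule that, assumption+)
  define f' g' h' where "f' p = f (fst p, snd p, 1)" and "g' p = g (fst p, snd p, 1)"
    and "h' p = h (fst p, snd p, 1)" for p
  have reg: "regular F f'" "regular F g'" "regular F h'"
    unfolding f'_def g'_def h'_def by (rule regular_wform_affine[OF w(1)] regular_wform_affine[OF w(2)]
      regular_wform_affine[OF w(3)])+
  have val: "eventually (\<lambda>p. \<phi> (affine_point p) = wpoint (f' p, g' p, h' p)) (generic F)"
    using nz generic_on_curve
  proof eventually_elim
    case (elim p)
    then have "p \<in> affine_curve F" by (simp add: affine_curve_def)
    then have "affine_point p \<in> proj_curve F" using affine_point_in_proj_curve[OF deg] by blast
    then show ?case using eq elim(1) unfolding affine_point_def f'_def g'_def h'_def by blast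
  qed
  have "\<not> (\<forall>p\<in>affine_curve F. h' p = 0)"
  proof
    assume h0: "\<forall>p\<in>affine_curve F. h' p = 0"
    define W where "W = {p \<in> affine_curve F. \<phi> (affine_point p) = wpoint (f' p, g' p, h' p)}"
    define N where "N = {p \<in> affine_curve F. \<not> \<phi> (affine_point p) = wpoint (f' p, g' p, h' p)}"
    have "finite N" using val unfolding eventually_generic N_def .
    moreover have "affine_curve F = W \<union> N" by (auto simp: W_def N_def)
    ultimately have "infinite W" using infinite_affine_curve[of F] finite_UnI[of W N] by argo
    moreover have "inj_on (\<lambda>p. \<phi> (affine_point p)) W"
    proof (rule inj_onI)
      fix p q assume "p \<in> W" "q \<in> W" "\<phi> (affine_point p) = \<phi> (affine_point q)"
      moreover from this have "affine_point p \<in> proj_curve F" "affine_point q \<in> proj_curve F"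
        using affine_point_in_proj_curve[OF deg] by (auto simp: W_def)
      ultimately show "p = q" using inj inj_affine_point by (meson inj_onD injD)
    qed
    moreover have "(\<lambda>p. \<phi> (affine_point p)) ` W \<subseteq> {P \<in> proj_curve G. \<exists>x y. P = wpoint (x, y, 0)}"
    proof (rule image_subsetI)
      fix p assume p: "p \<in> W"
      then have "affine_point p \<in> proj_curve F" using affine_point_in_proj_curve[OF deg] by (auto simp: W_def)
      then have "\<phi> (affine_point p) \<in> proj_curve G" using mor by (auto simp: morphism_over_def)
      moreover have "\<phi> (affine_point p) = wpoint (f' p, g' p, 0)" using p h0 by (auto simp: W_def)
      ultimately show "\<phi> (affine_point p) \<in> {P \<in> proj_curve G. \<exists>x y. P = wpoint (x, y, 0)}" by blast
    qed
    ultimately show False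
      using finite_points_at_infinity[of G] finite_imageD finite_subset by blast
  qed
  then have h: "eventually (\<lambda>p. h' p \<noteq> 0) (generic F)"
    using regular_eventually_neq_0[OF ns reg(3)] by blast
  then have h3: "eventually (\<lambda>p. h' p ^ 3 \<noteq> 0) (generic F)" by eventually_elim simp
  have "eventually (\<lambda>p. \<phi> (affine_point p) = affine_point (f' p / h' p, g' p / h' p ^ 3)) (generic F)"
    using val h by eventually_elim (simp add: wpoint_affine)
  moreover obtain R P Q where "R \<noteq> 0" "eventually (\<lambda>p. poly R (fst p) * (f' p / h' p)
    = poly P (fst p) + poly Q (fst p) * snd p) (generic F)"
    using regular_quotient[OF F reg(1,3) h] by blast
  moreover obtain S A B where "S \<noteq> 0" "eventually (\<lambda>p. poly S (fst p) * (g' p / h' p ^ 3)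
    = poly A (fst p) + poly B (fst p) * snd p) (generic F)"
    using regular_quotient[OF F reg(2) regular_power[OF reg(3)] h3] by blast
  ultimately show ?thesis
    using that[where u = "\<lambda>p. f' p / h' p" and v = "\<lambda>p. g' p / h' p ^ 3"] by blast
qed

section \<open>Linear maps of the weighted projective plane\<close>

type_synonym 'a lin = "'a \<times> 'a \<times> 'a \<times> 'a \<times> 'a"

fun lin_triple :: "'a::field lin \<Rightarrow> 'a \<times> 'a \<times> 'a \<Rightarrow> 'a \<times> 'a \<times> 'a" where
  "lin_triple (a, b, c, d, e) (x, y, z) = (a * x + b * z, e * y, c * x + d * z)"

definition lin_map :: "'a::field lin \<Rightarrow> 'a wpoint \<Rightarrow> 'a wpoint" where
  "lin_map m P = lin_triple m ` P"

text \<open>An identity of binary sextics, expressed by values; the factor e^2 matches the scaling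
  of Y by e, so that points of F go to points of G.\<close>

fun lin_iso :: "'a::field poly \<Rightarrow> 'a poly \<Rightarrow> 'a lin \<Rightarrow> bool" where
  "lin_iso F G (a, b, c, d, e) \<longleftrightarrow> a * d - b * c \<noteq> 0 \<and> e \<noteq> 0 \<and>
     (\<forall>x z. hom_eval G (a * x + b * z) (c * x + d * z) = e\<^sup>2 * hom_eval F x z)"

lemma lin_map_wpoint: "lin_map m (wpoint q) = wpoint (lin_triple m q)"
proof -
  obtain a b c d e where m: "m = (a, b, c, d, e)" by (metis prod_cases5)
  obtain x y z where q: "q = (x, y, z)" by (metis prod_cases3)
  have eq: "lin_triple m (t * x, t ^ 3 * y, t * z)
      = (t * (a * x + b * z), t ^ 3 * (e * y), t * (c * x + d * z))" for t
    by (simp add: m algebra_simps)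
  have "lin_map m (wpoint q) = {lin_triple m (t * x, t ^ 3 * y, t * z) | t. t \<noteq> 0}"
    unfolding lin_map_def wpoint_def q by auto
  also have "\<dots> = wpoint (lin_triple m q)" unfolding eq by (simp add: wpoint_def m q)
  finally show ?thesis .
qed

lemma wpointE:
  assumes "P \<in> proj_curve F"
  obtains x y z where "P = wpoint (x, y, z)" "(x, y, z) \<noteq> (0, 0, 0)" "y\<^sup>2 = hom_eval F x z"
  using assms unfolding proj_curve_def by blast

lemma det_nonzero_kernel:
  fixes a b c d x z :: "'a::field"
  assumes "a * d - b * c \<noteq> 0" "a * x + b * z = 0" "c * x + d * z = 0"
  shows "x = 0 \<and> z = 0"
proof -
  have "(a * d - b * c) * x = d * (a * x + b * z) - b * (c * x + d * z)"
    "(a * d - b * c) * z = a * (c * x + d * z) - c * (a * x + b * z)"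
    by (simp_all add: algebra_simps)
  then show ?thesis using assms by simp
qed

text \<open>The hypothesis is the case z = 1. Homogeneity extends it to nonzero z, and for fixed x
  both sides are polynomials in z, which covers z = 0.\<close>

lemma hom_eval_identity:
  fixes F G :: "'a::alg_closed_field poly"
  assumes F: "Polynomial.degree F \<le> 6"
    and eq: "hom_poly G [:b, a:] [:d, c:] = Polynomial.smult k F"
  shows "hom_eval G (a * x + b * z) (c * x + d * z) = k * hom_eval F x z"
proof -
  define p where "p = hom_poly G [:a * x, b:] [:c * x, d:] - Polynomial.smult k (hom_poly F [:x:] [:0, 1:])"
  have p: "poly p z = hom_eval G (a * x + b * z) (c * x + d * z) - k * hom_eval F x z" for z
    by (simp add: p_def poly_hom_poly mult.commute)
  have "poly p z = 0" if "z \<noteq> 0" for z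
  proof -
    have "hom_eval G (a * (x / z) + b) (c * (x / z) + d) = k * poly F (x / z)"
      using arg_cong[OF eq, of "\<lambda>q. poly q (x / z)"]
      by (simp add: poly_hom_poly mult.commute add.commute)
    moreover have "hom_eval G (a * x + b * z) (c * x + d * z)
        = z ^ 6 * hom_eval G (a * (x / z) + b) (c * (x / z) + d)"
      unfolding hom_eval_scale[symmetric] using that by (simp add: algebra_simps)
    moreover have "hom_eval F x z = z ^ 6 * hom_eval F (x / z) 1"
      unfolding hom_eval_scale[symmetric] using that by simp
    ultimately show ?thesis by (simp add: p hom_eval_1[OF F])
  qed
  then have "- {0} \<subseteq> {z. poly p z = 0}" by auto
  moreover have "infinite (- {0 :: 'a})"
    using infinite_UNIV_alg_closed[where 'a = 'a] by (simp add: Compl_eq_Diff_UNIV Diff_infinite_finite)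
  ultimately have "p = 0" using finite_subset poly_roots_finite by blast
  then show ?thesis using p[of z] by simp
qed

text \<open>Weighted proportionality of (f, g, h) to (X1, Y1, Z1) is tested by three cross products,
  with cubes because Y has weight 3. They are form-like and vanish generically, hence
  everywhere.\<close>

lemma morphism_eq_linear:
  fixes F G :: "'a::{alg_closed_field, field_gcd} poly"
  assumes F: "simple_sextic F" and mor: "morphism_over L (proj_curve F) D \<phi>"
    and det: "a * d - b * c \<noteq> 0" and e: "e \<noteq> 0"
    and gen: "eventually (\<lambda>p. \<phi> (affine_point p) = lin_map (a, b, c, d, e) (affine_point p)) (generic F)"
    and P: "P \<in> proj_curve F"
  shows "\<phi> P = lin_map (a, b, c, d, e) P"
proof -
  have deg: "Polynomial.degree F \<le> 6" using F by (auto simp: simple_sextic_def)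
  obtain x y z where P_eq: "P = wpoint (x, y, z)" and xyz: "(x, y, z) \<noteq> (0, 0, 0)"
    and on: "y\<^sup>2 = hom_eval F x z" using P by (rule wpointE)
  have P': "wpoint (x, y, z) \<in> proj_curve F" using P P_eq by simp
  obtain n f g h where w: "wform L n f" "wform L (3 * n) g" "wform L n h"
    and nz: "(f (x, y, z), g (x, y, z), h (x, y, z)) \<noteq> (0, 0, 0)"
    and val: "\<And>q. wpoint q \<in> proj_curve F \<Longrightarrow> (f q, g q, h q) \<noteq> (0, 0, 0) \<Longrightarrow> \<phi> (wpoint q) = wpoint (f q, g q, h q)"
    and gnz: "eventually (\<lambda>p. (f (fst p, snd p, 1), g (fst p, snd p, 1), h (fst p, snd p, 1)) \<noteq> (0, 0, 0)) (generic F)"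
    by (rule morphism_generic_form[OF F mor P']) (erule that, assumption+)
  define X1 Z1 Y1 where "X1 = (\<lambda>(x, y::'a, z). a * x + b * z)" and "Z1 = (\<lambda>(x, y::'a, z). c * x + d * z)"
    and "Y1 = (\<lambda>(x::'a, y, z::'a). e * y)"
  have fl: "form_like F n f" "form_like F (3 * n) g" "form_like F n h"
    using w by (simp_all add: form_like_wform)
  have lin: "form_like F 1 X1" "form_like F 1 Z1" "form_like F 3 Y1"
    unfolding X1_def Z1_def Y1_def by (rule form_like_linear form_like_snd)+
  have E1: "form_like F (n + 1) (\<lambda>q. f q * Z1 q - h q * X1 q)"
    by (intro form_like_minus form_like_mult fl lin)
  have g3: "form_like F (3 * n + 3 * 1) (\<lambda>q. g q * X1 q ^ 3)" "form_like F (3 * n + 3 * 1) (\<lambda>q. g q * Z1 q ^ 3)"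
    by (intro form_like_mult form_like_power fl lin)+
  have "form_like F (3 * n + 3) (\<lambda>q. f q ^ 3 * Y1 q)" "form_like F (3 * n + 3) (\<lambda>q. h q ^ 3 * Y1 q)"
    by (intro form_like_mult form_like_power fl lin)+
  then have E2: "form_like F (3 * n + 3) (\<lambda>q. g q * X1 q ^ 3 - f q ^ 3 * Y1 q)"
    and E3: "form_like F (3 * n + 3) (\<lambda>q. g q * Z1 q ^ 3 - h q ^ 3 * Y1 q)"
    using g3 by (simp_all add: form_like_minus)
  have all: "eventually (\<lambda>p. f (fst p, snd p, 1) * Z1 (fst p, snd p, 1) - h (fst p, snd p, 1) * X1 (fst p, snd p, 1) = 0
      \<and> g (fst p, snd p, 1) * X1 (fst p, snd p, 1) ^ 3 - f (fst p, snd p, 1) ^ 3 * Y1 (fst p, snd p, 1) = 0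
      \<and> g (fst p, snd p, 1) * Z1 (fst p, snd p, 1) ^ 3 - h (fst p, snd p, 1) ^ 3 * Y1 (fst p, snd p, 1) = 0) (generic F)"
    using gen gnz generic_on_curve
  proof eventually_elim
    case (elim p)
    define q where "q = (fst p, snd p, 1 :: 'a)"
    have "p \<in> affine_curve F" using elim(3) by (simp add: affine_curve_def)
    then have "wpoint q \<in> proj_curve F"
      using affine_point_in_proj_curve[OF deg, of p] by (simp add: affine_point_def q_def)
    moreover have "(f q, g q, h q) \<noteq> (0, 0, 0)" using elim(2) by (simp add: q_def)
    ultimately have "\<phi> (wpoint q) = wpoint (f q, g q, h q)" by (rule val)
    moreover have "\<phi> (wpoint q) = wpoint (X1 q, Y1 q, Z1 q)"
      using elim(1) by (simp add: affine_point_def lin_map_wpoint q_def X1_def Y1_def Z1_def)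
    ultimately obtain t where "X1 q = t * f q" "Y1 q = t ^ 3 * g q" "Z1 q = t * h q"
      by (metis wpoint_eq_iff)
    then show ?case unfolding q_def[symmetric] by (simp add: power_mult_distrib)
  qed
  have z1: "f (x, y, z) * Z1 (x, y, z) - h (x, y, z) * X1 (x, y, z) = 0"
    by (rule form_like_vanishes[OF F E1 _ P']) (use all in eventually_elim, simp)
  have z2: "g (x, y, z) * X1 (x, y, z) ^ 3 - f (x, y, z) ^ 3 * Y1 (x, y, z) = 0"
    by (rule form_like_vanishes[OF F E2 _ P']) (use all in eventually_elim, simp)
  have z3: "g (x, y, z) * Z1 (x, y, z) ^ 3 - h (x, y, z) ^ 3 * Y1 (x, y, z) = 0"
    by (rule form_like_vanishes[OF F E3 _ P']) (use all in eventually_elim, simp)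
  define q where "q = (x, y, z)"
  \<comment> \<open>On the curve x = z = 0 would force y = 0, and an invertible matrix keeps (x, z)
    away from 0. The factor of proportionality is read off from whichever of X1, Z1 is
    nonzero.\<close>
  have XZ: "\<not> (X1 q = 0 \<and> Z1 q = 0)"
  proof
    assume "X1 q = 0 \<and> Z1 q = 0"
    then have xz: "x = 0 \<and> z = 0" using det_nonzero_kernel[OF det, of x z] by (simp add: X1_def Z1_def q_def)
    then have "y\<^sup>2 = hom_eval F (0 * 1) (0 * 1)" using on by simp
    then show False unfolding hom_eval_scale using xz xyz by simp
  qed
  have "\<exists>t. f q = t * X1 q \<and> h q = t * Z1 q"
  proof (cases "X1 q = 0")
    case True
    then show ?thesis using XZ z1 by (intro exI[of _ "h q / Z1 q"]) (simp add: q_def)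
  next
    case False
    then show ?thesis using z1 by (intro exI[of _ "f q / X1 q"]) (simp add: q_def field_simps)
  qed
  then obtain t where t: "f q = t * X1 q" "h q = t * Z1 q" by blast
  have "(g q - t ^ 3 * Y1 q) * X1 q ^ 3 = 0" "(g q - t ^ 3 * Y1 q) * Z1 q ^ 3 = 0"
    using z2 z3 t unfolding q_def[symmetric] by (simp_all add: algebra_simps power_mult_distrib)
  then have g: "g q = t ^ 3 * Y1 q" using XZ by auto
  have "t \<noteq> 0" using nz t g unfolding q_def[symmetric] by auto
  then have "wpoint (f q, g q, h q) = wpoint (X1 q, Y1 q, Z1 q)"
    unfolding t g by (rule wpoint_scale)
  moreover have "\<phi> (wpoint q) = wpoint (f q, g q, h q)"
    using val P' nz unfolding q_def by blast
  ultimately show ?thesis unfolding P_eq lin_map_wpoint by (simp add: q_def X1_def Y1_def Z1_def)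
qed

theorem isomorphism_is_linear:
  fixes F G :: "'a::{alg_closed_field, field_gcd} poly"
  assumes two: "(2 :: 'a) \<noteq> 0" and F: "simple_sextic F" and G: "simple_sextic G"
    and iso: "isomorphism_over L (proj_curve F) (proj_curve G) \<phi>"
  shows "\<exists>m. lin_iso F G m \<and> (\<forall>P\<in>proj_curve F. \<phi> P = lin_map m P)"
proof -
  have degF: "Polynomial.degree F \<le> 6" and degG: "Polynomial.degree G \<le> 6"
    using F G by (auto simp: simple_sextic_def)
  define \<psi> where "\<psi> = inv_into (proj_curve F) \<phi>"
  have bij: "bij_betw \<phi> (proj_curve F) (proj_curve G)" and mor: "morphism_over L (proj_curve F) (proj_curve G) \<phi>"
    and mor': "morphism_over L (proj_curve G) (proj_curve F) \<psi>"
    using iso by (auto simp: isomorphism_over_def \<psi>_def)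
  have inj: "inj_on \<phi> (proj_curve F)" using bij by (simp add: bij_betw_def)
  have inj': "inj_on \<psi> (proj_curve G)"
    using bij_betw_inv_into[OF bij] by (simp add: bij_betw_def \<psi>_def)
  have inverse_at: "\<psi> (\<phi> P) = P" if "P \<in> proj_curve F" for P
    using that inj by (simp add: \<psi>_def)
  obtain R P Q S A B u v where RS: "R \<noteq> 0" "S \<noteq> 0"
    and u: "eventually (\<lambda>p. poly R (fst p) * u p = poly P (fst p) + poly Q (fst p) * snd p) (generic F)"
    and v: "eventually (\<lambda>p. poly S (fst p) * v p = poly A (fst p) + poly B (fst p) * snd p) (generic F)"
    and uv: "eventually (\<lambda>p. \<phi> (affine_point p) = affine_point (u p, v p)) (generic F)"
    by (rule morphism_affine[OF F degG mor inj]) (erule that, assumption+)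
  obtain R' P' Q' S' A' B' u' v' where RS': "R' \<noteq> 0" "S' \<noteq> 0"
    and u': "eventually (\<lambda>p. poly R' (fst p) * u' p = poly P' (fst p) + poly Q' (fst p) * snd p) (generic G)"
    and v': "eventually (\<lambda>p. poly S' (fst p) * v' p = poly A' (fst p) + poly B' (fst p) * snd p) (generic G)"
    and uv': "eventually (\<lambda>p. \<psi> (affine_point p) = affine_point (u' p, v' p)) (generic G)"
    by (rule morphism_affine[OF G degF mor' inj']) (erule that, assumption+)
  have on: "eventually (\<lambda>p. p \<in> affine_curve F) (generic F)"
    using generic_on_curve by eventually_elim (simp add: affine_curve_def)
  \<comment> \<open>Generic statements about the target may be evaluated at (u, v): away from
    finitely many points this pair represents the image under the injective \<phi>, so preimages of
    finite sets are finite.\<close>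
  have pull: "eventually (\<lambda>p. C (u p, v p)) (generic F)" if "eventually C (generic G)" for C
  proof -
    define W where "W = {p \<in> affine_curve F. \<phi> (affine_point p) = affine_point (u p, v p)}"
    define N where "N = {p \<in> affine_curve F. \<not> \<phi> (affine_point p) = affine_point (u p, v p)}"
    have W: "(u p, v p) \<in> affine_curve G" if "p \<in> W" for p
    proof -
      have "affine_point p \<in> proj_curve F" using that affine_point_in_proj_curve[OF degF] by (auto simp: W_def)
      then have "\<phi> (affine_point p) \<in> proj_curve G" using mor by (auto simp: morphism_over_def)
      then show ?thesis using that affine_point_in_proj_curve[OF degG] by (auto simp: W_def)
    qed
    have "inj_on (\<lambda>p. (u p, v p)) W"
    proof (rule inj_onI)
      fix p q assume pq: "p \<in> W" "q \<in> W" "(u p, v p) = (u q, v q)"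
      then have "\<phi> (affine_point p) = \<phi> (affine_point q)" by (simp add: W_def)
      moreover have "affine_point p \<in> proj_curve F" "affine_point q \<in> proj_curve F"
        using pq affine_point_in_proj_curve[OF degF] by (auto simp: W_def)
      ultimately show "p = q" using inj inj_affine_point by (meson inj_onD injD)
    qed
    moreover have "finite {p \<in> affine_curve G. \<not> C p}" using that unfolding eventually_generic .
    ultimately have "finite ((\<lambda>p. (u p, v p)) -` {p \<in> affine_curve G. \<not> C p} \<inter> W)"
      by (rule finite_vimage_IntI[rotated])
    moreover have "finite N" using uv unfolding eventually_generic N_def .
    moreover have "{p \<in> affine_curve F. \<not> C (u p, v p)}
        \<subseteq> ((\<lambda>p. (u p, v p)) -` {p \<in> affine_curve G. \<not> C p} \<inter> W) \<union> N"
    proof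
      fix p assume p: "p \<in> {p \<in> affine_curve F. \<not> C (u p, v p)}"
      show "p \<in> ((\<lambda>p. (u p, v p)) -` {p \<in> affine_curve G. \<not> C p} \<inter> W) \<union> N"
        using p W[of p] by (cases "p \<in> W") (auto simp: W_def N_def)
    qed
    ultimately show ?thesis unfolding eventually_generic by (meson finite_UnI finite_subset)
  qed
  have coords: "eventually (\<lambda>p. u' (u p, v p) = fst p \<and> v' (u p, v p) = snd p) (generic F)"
    using uv pull[OF uv'] on
  proof eventually_elim
    case (elim p)
    have "affine_point p \<in> proj_curve F" using affine_point_in_proj_curve[OF degF] elim(3) by blast
    then have "affine_point p = affine_point (u' (u p, v p), v' (u p, v p))"
      using elim(1,2) inverse_at by metis
    then show ?case using inj_affine_point by (metis fst_conv injD snd_conv)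
  qed
  have x: "eventually (\<lambda>p. fst p * poly R' (u p) = poly P' (u p) + poly Q' (u p) * v p) (generic F)"
    using pull[OF u'] coords by eventually_elim (simp add: mult.commute)
  have y: "eventually (\<lambda>p. snd p * poly S' (u p) = poly A' (u p) + poly B' (u p) * v p) (generic F)"
    using pull[OF v'] coords by eventually_elim (simp add: mult.commute)
  have vu: "eventually (\<lambda>p. (v p)\<^sup>2 = poly G (u p)) (generic F)"
    using pull[OF generic_on_curve] by simp
  have nonconst: "eventually (\<lambda>p. poly q (u p) \<noteq> 0) (generic F)" if "q \<noteq> 0" for q
    using pull[OF generic_poly_neq_0[OF that]] by simp
  obtain a b c d e where det: "a * d - b * c \<noteq> 0" and e: "e \<noteq> 0"
    and M: "eventually (\<lambda>p. (c * fst p + d) * u p = a * fst p + b) (generic F)"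
      "eventually (\<lambda>p. (c * fst p + d) ^ 3 * v p = e * snd p) (generic F)"
    and hom: "hom_poly G [:b, a:] [:d, c:] = Polynomial.smult (e\<^sup>2) F"
    using birational_is_linear[OF two F degG RS(1) u RS(2) v vu RS'(1) x RS'(2) y nonconst] by blast
  have "[:d, c:] \<noteq> 0" using det by auto
  from generic_poly_neq_0[OF this, of F] M uv
  have "eventually (\<lambda>p. \<phi> (affine_point p) = lin_map (a, b, c, d, e) (affine_point p)) (generic F)"
  proof eventually_elim
    case (elim p)
    define k where "k = c * fst p + d"
    have k: "k \<noteq> 0" using elim(1) by (simp add: k_def algebra_simps)
    have "wpoint (k * u p, k ^ 3 * v p, k * 1) = wpoint (u p, v p, 1)" by (rule wpoint_scale[OF k])
    then show ?case
      using elim(2-4) unfolding k_def by (simp add: affine_point_def lin_map_wpoint)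
  qed
  then have "\<forall>P\<in>proj_curve F. \<phi> P = lin_map (a, b, c, d, e) P"
    using morphism_eq_linear[OF F mor det e] by blast
  moreover have "lin_iso F G (a, b, c, d, e)"
    using det e hom_eval_identity[OF degF hom] by simp
  ultimately show ?thesis by blast
qed

section \<open>Linear isomorphisms\<close>

fun lin_comp :: "'a::field lin \<Rightarrow> 'a lin \<Rightarrow> 'a lin" where
  "lin_comp (a, b, c, d, e) (a', b', c', d', e') =
     (a * a' + b * c', a * b' + b * d', c * a' + d * c', c * b' + d * d', e * e')"

fun lin_inv :: "'a::field lin \<Rightarrow> 'a lin" where
  "lin_inv (a, b, c, d, e) = (d / (a * d - b * c), - b / (a * d - b * c),
     - c / (a * d - b * c), a / (a * d - b * c), 1 / e)"

fun lin_nonsingular :: "'a::field lin \<Rightarrow> bool" where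
  "lin_nonsingular (a, b, c, d, e) \<longleftrightarrow> a * d - b * c \<noteq> 0 \<and> e \<noteq> 0"

definition lin_id :: "'a::field lin" where
  "lin_id = (1, 0, 0, 1, 1)"

definition lin_hyp :: "'a::field lin" where
  "lin_hyp = (1, 0, 0, 1, - 1)"

lemma lin_iso_nonsingular: "lin_iso F G m \<Longrightarrow> lin_nonsingular m"
  by (cases m rule: lin_nonsingular.cases) simp

lemma lin_comp_assoc: "lin_comp (lin_comp m n) k = lin_comp m (lin_comp n k)"
  by (cases m rule: lin_nonsingular.cases, cases n rule: lin_nonsingular.cases,
      cases k rule: lin_nonsingular.cases) (simp add: algebra_simps)

lemma lin_comp_inv:
  assumes "lin_nonsingular m"
  shows "lin_comp m (lin_inv m) = lin_id" "lin_comp (lin_inv m) m = lin_id"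
  using assms
  by (cases m rule: lin_nonsingular.cases; simp add: lin_id_def divide_simps; simp add: algebra_simps)+

lemma lin_comp_id: "lin_comp lin_id m = m" "lin_comp m lin_id = m"
  by (cases m rule: lin_nonsingular.cases; simp add: lin_id_def)+

lemma lin_triple_comp: "lin_triple (lin_comp m n) q = lin_triple m (lin_triple n q)"
  by (cases m rule: lin_nonsingular.cases, cases n rule: lin_nonsingular.cases, cases q)
     (simp add: algebra_simps)

lemma lin_map_comp: "lin_map (lin_comp m n) P = lin_map m (lin_map n P)"
  by (simp add: lin_map_def image_image lin_triple_comp)

lemma lin_map_id:
  fixes P :: "'a::field wpoint"
  shows "lin_map lin_id P = P"
proof -
  have "lin_triple (lin_id :: 'a lin) = (\<lambda>q. q)" by (auto simp: lin_id_def fun_eq_iff)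
  then show ?thesis by (simp add: lin_map_def)
qed

lemma lin_map_inv:
  assumes "lin_nonsingular m"
  shows "lin_map m (lin_map (lin_inv m) P) = P" "lin_map (lin_inv m) (lin_map m P) = P"
  using assms by (simp_all add: lin_map_comp[symmetric] lin_comp_inv lin_map_id)

lemma lin_iso_id: "lin_iso F F lin_id"
  by (simp add: lin_id_def)

lemma lin_iso_hyp: "lin_iso F F lin_hyp"
  by (simp add: lin_hyp_def)

lemma lin_iso_comp:
  assumes "lin_iso G H m" "lin_iso F G n"
  shows "lin_iso F H (lin_comp m n)"
proof -
  obtain a b c d e where m: "m = (a, b, c, d, e)" by (metis prod_cases5)
  obtain a' b' c' d' e' where n: "n = (a', b', c', d', e')" by (metis prod_cases5)
  have det: "a * d - b * c \<noteq> 0" "a' * d' - b' * c' \<noteq> 0" "e \<noteq> 0" "e' \<noteq> 0"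
    using assms by (auto simp: m n)
  have "(a * a' + b * c') * (c * b' + d * d') - (a * b' + b * d') * (c * a' + d * c')
      = (a * d - b * c) * (a' * d' - b' * c')"
    by (simp add: algebra_simps)
  then have "(a * a' + b * c') * (c * b' + d * d') - (a * b' + b * d') * (c * a' + d * c') \<noteq> 0"
    using det by simp
  moreover have "hom_eval H ((a * a' + b * c') * x + (a * b' + b * d') * z)
      ((c * a' + d * c') * x + (c * b' + d * d') * z) = (e * e')\<^sup>2 * hom_eval F x z" for x z
  proof -
    have "hom_eval H (a * (a' * x + b' * z) + b * (c' * x + d' * z))
        (c * (a' * x + b' * z) + d * (c' * x + d' * z)) = e\<^sup>2 * (e'\<^sup>2 * hom_eval F x z)"
      using assms by (simp add: m n)
    then show ?thesis by (simp add: algebra_simps power_mult_distrib)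
  qed
  ultimately show ?thesis using det by (simp add: m n)
qed

lemma lin_iso_inv:
  assumes "lin_iso F G m"
  shows "lin_iso G F (lin_inv m)"
proof -
  obtain a b c d e where m: "m = (a, b, c, d, e)" by (metis prod_cases5)
  define D where "D = a * d - b * c"
  have det: "D \<noteq> 0" "e \<noteq> 0" and ev: "hom_eval G (a * x + b * z) (c * x + d * z) = e\<^sup>2 * hom_eval F x z" for x z
    using assms by (auto simp: m D_def)
  have "d / D * (a / D) - - b / D * (- c / D) = 1 / D"
    using det by (simp add: divide_simps) (simp add: D_def algebra_simps)
  moreover have "hom_eval F (d / D * x + - b / D * z) (- c / D * x + a / D * z) = (1 / e)\<^sup>2 * hom_eval G x z" for x z
  proof -
    have "a * (d / D * x + - b / D * z) + b * (- c / D * x + a / D * z) = x"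
      "c * (d / D * x + - b / D * z) + d * (- c / D * x + a / D * z) = z"
      using det by (simp add: divide_simps, simp add: D_def algebra_simps)+
    with ev[of "d / D * x + - b / D * z" "- c / D * x + a / D * z"]
    show ?thesis using det by (simp add: power_divide)
  qed
  ultimately show ?thesis using det unfolding m lin_inv.simps D_def[symmetric] lin_iso.simps by simp
qed

lemma lin_map_in_proj_curve:
  assumes m: "lin_iso F G m" and P: "P \<in> proj_curve F"
  shows "lin_map m P \<in> proj_curve G"
proof -
  obtain a b c d e where m_eq: "m = (a, b, c, d, e)" by (metis prod_cases5)
  obtain x y z where P_eq: "P = wpoint (x, y, z)" "(x, y, z) \<noteq> (0, 0, 0)" "y\<^sup>2 = hom_eval F x z"
    using P by (rule wpointE)
  have "a * d - b * c \<noteq> 0" "e \<noteq> 0" using m by (auto simp: m_eq)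
  then have "(a * x + b * z, e * y, c * x + d * z) \<noteq> (0, 0, 0)"
    using det_nonzero_kernel[of a d b c x z] P_eq(2) by auto
  then show ?thesis using m P_eq(3)
    by (simp add: P_eq(1) lin_map_wpoint m_eq wpoint_in_proj_curve power_mult_distrib)
qed

lemma bij_betw_lin_map:
  assumes m: "lin_iso F G m"
  shows "bij_betw (lin_map m) (proj_curve F) (proj_curve G)"
  by (rule bij_betw_byWitness[where f' = "lin_map (lin_inv m)"])
     (use m lin_iso_inv[OF m] in \<open>auto simp: lin_map_inv[OF lin_iso_nonsingular[OF m]] intro: lin_map_in_proj_curve\<close>)

section \<open>Linear maps as morphisms over the field of their entries\<close>

lemma wform_linear:
  fixes a b :: "'a::field"
  assumes "0 \<in> L" "a \<in> L" "b \<in> L"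
  shows "wform L 1 (\<lambda>(x, y, z). a * x + b * z)"
  unfolding wform_def
\<comment> \<open>The exponent of Z is implicit, so index (1, 0) stands for X and (0, 0) for Z. All
  other coefficients are 0, which must lie in L.\<close>
proof (intro exI[of _ "\<lambda>i j. if (i, j) = (1, 0) then a else if (i, j) = (0, 0) then b else 0"] conjI)
  have "{(i, j). i + 3 * j \<le> (1::nat)} = {(0, 0), (1, 0)}" by auto
  then show "(\<lambda>(x, y, z). a * x + b * z) = (\<lambda>(x, y, z). \<Sum>(i, j) | i + 3 * j \<le> 1.
      (if (i, j) = (1, 0) then a else if (i, j) = (0, 0) then b else 0) * x ^ i * y ^ j * z ^ (1 - (i + 3 * j)))"
    by (auto simp: fun_eq_iff)
qed (use assms in auto)

lemma wform_snd:
  fixes e :: "'a::field"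
  assumes "0 \<in> L" "e \<in> L"
  shows "wform L 3 (\<lambda>(x, y, z). e * y)"
  unfolding wform_def
proof (intro exI[of _ "\<lambda>i j. if (i, j) = (0, 1) then e else 0"] conjI)
  have "{(i, j). i + 3 * j \<le> (3::nat)} = {(0, 0), (1, 0), (2, 0), (3, 0), (0, 1)}"
    by auto
  then show "(\<lambda>(x, y, z). e * y) = (\<lambda>(x, y, z). \<Sum>(i, j) | i + 3 * j \<le> 3.
      (if (i, j) = (0, 1) then e else 0) * x ^ i * y ^ j * z ^ (3 - (i + 3 * j)))"
    by (auto simp: fun_eq_iff)
qed (use assms in auto)

fun lin_over :: "'a set \<Rightarrow> 'a::field lin \<Rightarrow> bool" where
  "lin_over L (a, b, c, d, e) \<longleftrightarrow> a \<in> L \<and> b \<in> L \<and> c \<in> L \<and> d \<in> L \<and> e \<in> L"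

lemma morphism_over_lin_map:
  assumes m: "lin_iso F G m" and L: "0 \<in> L" "lin_over L m"
  shows "morphism_over L (proj_curve F) (proj_curve G) (lin_map m)"
  unfolding morphism_over_def
proof (intro conjI ballI)
  show "lin_map m ` proj_curve F \<subseteq> proj_curve G" using lin_map_in_proj_curve[OF m] by blast
  fix P assume P: "P \<in> proj_curve F"
  obtain a b c d e where m_eq: "m = (a, b, c, d, e)" by (metis prod_cases5)
  obtain x y z where xyz: "P = wpoint (x, y, z)" using P by (rule wpointE)
  let ?f = "\<lambda>(x, y, z). a * x + b * z" and ?g = "\<lambda>(x, y, z). e * y" and ?h = "\<lambda>(x, y, z). c * x + d * z"
  have w: "wform L 1 ?f" "wform L (3 * 1) ?g" "wform L 1 ?h"
    using L by (simp_all only: m_eq lin_over.simps wform_linear mult_1_right wform_snd)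
  have "lin_map m P \<in> proj_curve G" using lin_map_in_proj_curve[OF m P] .
  then have "(?f (x, y, z), ?g (x, y, z), ?h (x, y, z)) \<noteq> (0, 0, 0)"
    by (simp add: xyz m_eq lin_map_wpoint wpoint_in_proj_curve)
  then have "\<exists>p. wpoint p = P \<and> (?f p, ?g p, ?h p) \<noteq> (0, 0, 0)" using xyz by blast
  moreover have "lin_map m (wpoint q) = wpoint (?f q, ?g q, ?h q)" for q
    by (cases q) (simp add: lin_map_wpoint m_eq)
  ultimately show "\<exists>n f g h. wform L n f \<and> wform L (3 * n) g \<and> wform L n h \<and>
        (\<exists>p. wpoint p = P \<and> (f p, g p, h p) \<noteq> (0, 0, 0)) \<and>
        (\<forall>q. wpoint q \<in> proj_curve F \<and> (f q, g q, h q) \<noteq> (0, 0, 0) \<longrightarrow>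
              lin_map m (wpoint q) = wpoint (f q, g q, h q))"
    by (intro exI[of _ 1] exI[of _ ?f] exI[of _ ?g] exI[of _ ?h] conjI w allI impI)
qed

lemma morphism_over_cong:
  assumes "\<And>P. P \<in> C \<Longrightarrow> \<phi> P = \<phi>' P"
  shows "morphism_over L C D \<phi> \<longleftrightarrow> morphism_over L C D \<phi>'"
proof -
  have "\<phi> ` C = \<phi>' ` C" using assms by (rule image_cong[OF refl])
  then show ?thesis unfolding morphism_over_def using assms by (auto; metis)
qed

lemma isomorphism_over_lin_map:
  assumes m: "lin_iso F G m" and L: "0 \<in> L" "lin_over L m" "lin_over L (lin_inv m)"
    and eq: "\<And>P. P \<in> proj_curve F \<Longrightarrow> \<phi> P = lin_map m P"
  shows "isomorphism_over L (proj_curve F) (proj_curve G) \<phi>"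
proof -
  have bij: "bij_betw \<phi> (proj_curve F) (proj_curve G)"
    using bij_betw_lin_map[OF m] eq by (simp cong: bij_betw_cong)
  have "inv_into (proj_curve F) \<phi> Q = lin_map (lin_inv m) Q" if Q: "Q \<in> proj_curve G" for Q
  proof (rule inv_into_f_eq)
    show "inj_on \<phi> (proj_curve F)" using bij by (simp add: bij_betw_def)
    show "lin_map (lin_inv m) Q \<in> proj_curve F" by (rule lin_map_in_proj_curve[OF lin_iso_inv[OF m] Q])
    then show "\<phi> (lin_map (lin_inv m) Q) = Q"
      using eq lin_map_inv[OF lin_iso_nonsingular[OF m]] by simp
  qed
  then have "morphism_over L (proj_curve G) (proj_curve F) (inv_into (proj_curve F) \<phi>)"
    using morphism_over_lin_map[OF lin_iso_inv[OF m] L(1,3)] by (simp cong: morphism_over_cong)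
  moreover have "morphism_over L (proj_curve F) (proj_curve G) \<phi>"
    using morphism_over_lin_map[OF m L(1,2)] eq by (simp cong: morphism_over_cong)
  ultimately show ?thesis using bij by (simp add: isomorphism_over_def)
qed

text \<open>Points over (1 : 0), (0 : 1) and (1 : 1) on the projective line force the matrix to be
  scalar; a point with y and z nonzero then fixes e.\<close>

lemma lin_map_eq_id:
  fixes F :: "'a::{alg_closed_field, field_gcd} poly"
  assumes F: "simple_sextic F" and n: "\<And>P. P \<in> proj_curve F \<Longrightarrow> lin_map n P = P"
  shows "\<exists>t. t \<noteq> 0 \<and> n = (t, 0, 0, t, t ^ 3)"
proof -
  obtain a b c d e where n_eq: "n = (a, b, c, d, e)" by (metis prod_cases5)
  have pt: "\<exists>t y. t \<noteq> 0 \<and> a * x + b * z = t * x \<and> c * x + d * z = t * z" if "(x, z) \<noteq> (0, 0)" for x z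
  proof -
    obtain y where "y\<^sup>2 = hom_eval F x z" using nth_root_exists[of 2 "hom_eval F x z"] by auto
    then have "wpoint (x, y, z) \<in> proj_curve F" using that by (simp add: wpoint_in_proj_curve)
    then have "wpoint (x, y, z) = wpoint (lin_triple n (x, y, z))" using n lin_map_wpoint by metis
    then show ?thesis by (auto simp: n_eq wpoint_eq_iff)
  qed
  have b: "b = 0" using pt[of 0 1] by auto
  have c: "c = 0" using pt[of 1 0] by auto
  have ad: "a = d" "a \<noteq> 0" using pt[of 1 1] b c by auto
  have "F \<noteq> 0" and deg: "Polynomial.degree F \<le> 6" using F by (auto simp: simple_sextic_def)
  then have "infinite {x. poly F x \<noteq> 0}" by (intro infinite_nonroots)
  then obtain x where x: "poly F x \<noteq> 0" by (metis (mono_tags, lifting) empty_Collect_eq finite.emptyI)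
  obtain y where y: "y\<^sup>2 = poly F x" using nth_root_exists[of 2 "poly F x"] by auto
  have "wpoint (x, y, 1) \<in> proj_curve F"
    using y hom_eval_1[OF deg] by (simp add: wpoint_in_proj_curve)
  then have "wpoint (x, y, 1) = wpoint (lin_triple n (x, y, 1))" using n lin_map_wpoint by metis
  then obtain t where "e * y = t ^ 3 * y" "d = t" using b c by (auto simp: n_eq wpoint_eq_iff)
  moreover have "y \<noteq> 0" using x y by auto
  ultimately show ?thesis using b c ad by (simp add: n_eq)
qed

text \<open>\<open>lin_prop {1}\<close> is equality as maps on a curve; \<open>lin_prop {1, - 1}\<close> is equality up to the
  hyperelliptic involution.\<close>

fun lin_prop :: "'a::field set \<Rightarrow> 'a lin \<Rightarrow> 'a lin \<Rightarrow> bool" where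
  "lin_prop S (a, b, c, d, e) n \<longleftrightarrow>
     (\<exists>t s. t \<noteq> 0 \<and> s \<in> S \<and> n = (t * a, t * b, t * c, t * d, s * t ^ 3 * e))"

lemma lin_prop_altdef:
  "lin_prop S m n \<longleftrightarrow> (\<exists>t s. t \<noteq> 0 \<and> s \<in> S \<and> n = lin_comp m (t, 0, 0, t, s * t ^ 3))"
  by (cases m rule: lin_nonsingular.cases) (simp add: mult_ac)

lemma lin_prop_refl: "1 \<in> S \<Longrightarrow> lin_prop S m m"
  by (cases m rule: lin_nonsingular.cases) (auto intro!: exI[of _ 1])

text \<open>Scalar tuples are central. This makes \<open>lin_prop\<close> compatible with
  composition on both sides and also makes the hyperelliptic involution central.\<close>

lemma scalar_comm: "lin_comp (t, 0, 0, t, s) m = lin_comp m (t, 0, 0, t, s)"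
  by (cases m rule: lin_nonsingular.cases) (simp add: mult_ac)

lemma lin_prop_comp_left: "lin_prop S m n \<Longrightarrow> lin_prop S (lin_comp k m) (lin_comp k n)"
  unfolding lin_prop_altdef by (auto simp: lin_comp_assoc)

lemma lin_prop_comp_right: "lin_prop S m n \<Longrightarrow> lin_prop S (lin_comp m k) (lin_comp n k)"
  unfolding lin_prop_altdef by (auto simp only: lin_comp_assoc scalar_comm) blast

lemma lin_prop_sym: "lin_prop {1, - 1} m n \<Longrightarrow> lin_prop {1, - 1} n m"
proof -
  assume "lin_prop {1, - 1} m n"
  then obtain t s where ts: "t \<noteq> 0" "s \<in> {1, - 1}" "n = lin_comp m (t, 0, 0, t, s * t ^ 3)"
    unfolding lin_prop_altdef by blast
  have "lin_comp n (1 / t, 0, 0, 1 / t, s * (1 / t) ^ 3) = m"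
    unfolding ts(3) using ts(1,2) by (cases m rule: lin_nonsingular.cases) (auto simp: power_divide)
  then show ?thesis unfolding lin_prop_altdef using ts(1,2)
    by (intro exI[of _ "1 / t"] exI[of _ s]) auto
qed

lemma lin_prop_trans: "lin_prop {1, - 1} m n \<Longrightarrow> lin_prop {1, - 1} n k \<Longrightarrow> lin_prop {1, - 1} m k"
proof -
  assume "lin_prop {1, - 1} m n" "lin_prop {1, - 1} n k"
  then obtain t s t' s' where ts: "t \<noteq> 0" "s \<in> {1, - 1}" "n = lin_comp m (t, 0, 0, t, s * t ^ 3)"
    "t' \<noteq> 0" "s' \<in> {1, - 1}" "k = lin_comp n (t', 0, 0, t', s' * t' ^ 3)"
    unfolding lin_prop_altdef by blast
  have "k = lin_comp m (t * t', 0, 0, t * t', (s * s') * (t * t') ^ 3)"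
    unfolding ts(3,6) by (cases m rule: lin_nonsingular.cases) (simp add: mult_ac power_mult_distrib)
  moreover have "t * t' \<noteq> 0" "s * s' \<in> {1, - 1}" using ts(1,2,4,5) by auto
  ultimately show ?thesis unfolding lin_prop_altdef by blast
qed

lemma lin_prop_mono: "lin_prop S m n \<Longrightarrow> S \<subseteq> T \<Longrightarrow> lin_prop T m n"
  unfolding lin_prop_altdef by blast

lemma lin_prop_hyp: "lin_prop {1, - 1} m (lin_comp m lin_hyp)"
  unfolding lin_prop_altdef lin_hyp_def by (intro exI[of _ 1] exI[of _ "- 1"]) simp

lemma lin_hyp_central: "lin_comp lin_hyp m = lin_comp m lin_hyp"
  unfolding lin_hyp_def by (rule scalar_comm)

lemma lin_map_scalar:
  assumes "t \<noteq> 0" "P \<in> proj_curve F"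
  shows "lin_map (t, 0, 0, t, t ^ 3) P = P"
proof -
  obtain x y z where "P = wpoint (x, y, z)" using assms(2) by (rule wpointE)
  then show ?thesis using wpoint_scale[OF assms(1)] by (simp add: lin_map_wpoint)
qed

text \<open>The tuple of the composite of n with the inverse of m acts as the identity, so it is a
  scalar.\<close>

lemma lin_map_eq_imp_prop:
  fixes F :: "'a::{alg_closed_field, field_gcd} poly"
  assumes F: "simple_sextic F" and m: "lin_nonsingular m"
    and eq: "\<And>P. P \<in> proj_curve F \<Longrightarrow> lin_map m P = lin_map n P"
  shows "lin_prop {1} m n"
proof -
  have "lin_map (lin_comp (lin_inv m) n) P = P" if "P \<in> proj_curve F" for P
    using eq[OF that] lin_map_inv(2)[OF m] by (metis lin_map_comp)
  then obtain t where t: "t \<noteq> 0" "lin_comp (lin_inv m) n = (t, 0, 0, t, t ^ 3)"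
    using lin_map_eq_id[OF F] by blast
  have "n = lin_comp m (t, 0, 0, t, t ^ 3)"
    by (metis t(2) lin_comp_assoc lin_comp_inv(1)[OF m] lin_comp_id(1))
  then show ?thesis unfolding lin_prop_altdef using t(1) by auto
qed

lemma lin_prop_imp_map_eq:
  assumes "lin_prop {1} m n" "P \<in> proj_curve F"
  shows "lin_map m P = lin_map n P"
proof -
  obtain t where "t \<noteq> 0" "n = lin_comp m (t, 0, 0, t, t ^ 3)"
    using assms(1) unfolding lin_prop_altdef by auto
  then show ?thesis using lin_map_scalar[OF _ assms(2)] by (simp add: lin_map_comp)
qed

section \<open>The fixed field of the Galois group\<close>

abbreviation ac_eval :: "'k::field poly \<Rightarrow> 'k alg_closure \<Rightarrow> 'k alg_closure" where
  "ac_eval p x \<equiv> poly (map_poly to_ac p) x"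

lemma map_poly_to_ac_add: "map_poly to_ac (p + q) = map_poly to_ac p + map_poly to_ac q"
  by (rule poly_eqI) (simp add: coeff_map_poly)

lemma map_poly_to_ac_mult: "map_poly to_ac (p * q) = map_poly to_ac p * map_poly to_ac q"
  by (rule poly_eqI) (simp add: coeff_map_poly coeff_mult to_ac_sum)

lemma minimal_polynomial:
  fixes x :: "'k::field alg_closure"
  obtains p where "Factorial_Ring.irreducible p" "ac_eval p x = 0" "\<And>q. ac_eval q x = 0 \<Longrightarrow> p dvd q"
proof -
  obtain r :: "'k poly" where r: "r \<noteq> 0" "ac_eval r x = 0" by (rule alg_closure_algebraic)
  define P where "P p \<longleftrightarrow> p \<noteq> 0 \<and> ac_eval p x = 0" for p :: "'k poly"
  define p where "p = arg_min Polynomial.degree P"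
  have "P r" using r by (simp add: P_def)
  then have p: "P p" and min: "\<And>q. P q \<Longrightarrow> Polynomial.degree p \<le> Polynomial.degree q"
    using arg_min_nat_lemma[of P r Polynomial.degree] unfolding p_def by auto
  have p0: "p \<noteq> 0" "ac_eval p x = 0" using p by (auto simp: P_def)
  have dvd: "p dvd q" if "ac_eval q x = 0" for q
  proof (rule ccontr)
    assume nd: "\<not> p dvd q"
    have "ac_eval (p * (q div p) + q mod p) x = 0" using that by simp
    then have "ac_eval (q mod p) x = 0"
      unfolding map_poly_to_ac_add map_poly_to_ac_mult using p0 by simp
    moreover have "q mod p \<noteq> 0" using nd by (simp add: dvd_eq_mod_eq_0)
    ultimately have "Polynomial.degree p \<le> Polynomial.degree (q mod p)" using min by (simp add: P_def)
    then show False using degree_mod_less_degree[OF p0(1) nd] by simp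
  qed
  have unit: "is_unit b" if "p = a * b" "ac_eval a x = 0" for a b
  proof -
    have nz: "a \<noteq> 0" "b \<noteq> 0" using p0 that by auto
    then have "Polynomial.degree p \<le> Polynomial.degree a" using min that by (simp add: P_def)
    then have "Polynomial.degree b = 0" using that nz by (simp add: degree_mult_eq)
    then show ?thesis using nz is_unit_iff_degree by blast
  qed
  have "Factorial_Ring.irreducible p"
  proof (rule irreducibleI)
    show "\<not> is_unit p"
    proof
      assume "is_unit p"
      then obtain c where "p = [:c:]" by (auto simp: is_unit_poly_iff)
      then show False using p0 by (simp add: map_poly_pCons)
    qed
    fix a b assume ab: "p = a * b"
    then have "ac_eval a x * ac_eval b x = 0" using p0 by (simp add: map_poly_to_ac_mult)
    then show "is_unit a \<or> is_unit b" using unit[of a b] unit[of b a] ab by (auto simp: mult.commute)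
  qed (rule p0)
  then show ?thesis using that p0 dvd by blast
qed

text \<open>Graphs of partial homomorphisms over \<open>k\<close>, defined on subrings: the last condition says that a
  subring of the product is the graph of a function.\<close>

definition hom_graph :: "('k::field alg_closure \<times> 'k alg_closure) set \<Rightarrow> bool" where
  "hom_graph S \<longleftrightarrow> (\<forall>a. (to_ac a, to_ac a) \<in> S) \<and>
     (\<forall>x y x' y'. (x, y) \<in> S \<longrightarrow> (x', y') \<in> S \<longrightarrow> (x + x', y + y') \<in> S \<and> (x * x', y * y') \<in> S) \<and>
     (\<forall>y. (0, y) \<in> S \<longrightarrow> y = 0)"

lemma hom_graphD:
  assumes "hom_graph S"
  shows "(to_ac a, to_ac a) \<in> S"
    "(x, y) \<in> S \<Longrightarrow> (x', y') \<in> S \<Longrightarrow> (x + x', y + y') \<in> S"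
    "(x, y) \<in> S \<Longrightarrow> (x', y') \<in> S \<Longrightarrow> (x * x', y * y') \<in> S"
    "(0, y) \<in> S \<Longrightarrow> y = 0"
  using assms unfolding hom_graph_def by blast+

lemma hom_graph_0: "hom_graph S \<Longrightarrow> (0, 0) \<in> S"
  and hom_graph_1: "hom_graph S \<Longrightarrow> (1, 1) \<in> S"
  using hom_graphD(1)[of S 0] hom_graphD(1)[of S 1] by simp_all

lemma hom_graph_diff:
  assumes S: "hom_graph S" and "(x, y) \<in> S" "(x', y') \<in> S"
  shows "(x - x', y - y') \<in> S"
proof -
  have "(to_ac (- 1) * x', to_ac (- 1) * y') \<in> S"
    by (rule hom_graphD(3)[OF S hom_graphD(1)[OF S]]) fact
  from hom_graphD(2)[OF S assms(2) this] show ?thesis by simp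
qed

lemma hom_graph_sum:
  assumes S: "hom_graph S" and "\<And>i. i \<in> I \<Longrightarrow> (f i, g i) \<in> S"
  shows "(\<Sum>i\<in>I. f i, \<Sum>i\<in>I. g i) \<in> S"
  using assms(2)
  by (induction I rule: infinite_finite_induct) (auto intro: hom_graph_0[OF S] hom_graphD(2)[OF S])

lemma hom_graph_eval:
  assumes S: "hom_graph S" and "(x, y) \<in> S"
  shows "(ac_eval p x, ac_eval p y) \<in> S"
proof (induction p)
  case 0
  show ?case using hom_graph_0[OF S] by simp
next
  case (pCons a p)
  have "(to_ac a + x * ac_eval p x, to_ac a + y * ac_eval p y) \<in> S"
    by (intro hom_graphD[OF S] assms pCons.IH)
  then show ?case using pCons.hyps by (simp add: map_poly_pCons)
qed

text \<open>The domain is only a subring, so algebraicity replaces division: if a nonzero x went to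
  0, its minimal polynomial would have constant term 0, and dividing by X would give an annihilator
  of smaller degree.\<close>

lemma hom_graph_inj:
  fixes x :: "'k::field alg_closure"
  assumes S: "hom_graph S" and x0: "(x, 0) \<in> S"
  shows "x = 0"
proof (rule ccontr)
  assume x: "x \<noteq> 0"
  obtain p where p: "Factorial_Ring.irreducible p" "ac_eval p x = 0" "\<And>q. ac_eval q x = 0 \<Longrightarrow> p dvd q"
    by (rule minimal_polynomial[of x]) (erule that, assumption+)
  obtain a q where pq: "p = pCons a q" by (cases p)
  have "(ac_eval p x, ac_eval p 0) \<in> S" by (rule hom_graph_eval[OF S x0])
  then have "ac_eval p 0 = 0" using p(2) hom_graphD(4)[OF S] by simp
  then have "a = 0" by (simp add: poly_0_coeff_0 coeff_map_poly pq)
  then have "q \<noteq> 0" using p(1) pq by auto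
  then have "x * ac_eval q x = 0" using p(2) pq \<open>a = 0\<close> by (simp add: map_poly_pCons)
  then have "p dvd q" using x p(3) by simp
  then have "Polynomial.degree p \<le> Polynomial.degree q" using \<open>q \<noteq> 0\<close> by (rule dvd_imp_degree_le)
  then show False using pq \<open>q \<noteq> 0\<close> by simp
qed

text \<open>\<open>PP\<close> pairs polynomials over the domain with their images. For (p, q) with p
  of least degree killing \<gamma>, \<gamma> is sent to a root \<delta> of q; this is well defined
  because every pair whose first member kills \<gamma> has a second member killing \<delta>.\<close>

lemma hom_graph_extend:
  fixes \<gamma> :: "'k::field alg_closure"
  assumes S: "hom_graph S"
  shows "\<exists>S'. hom_graph S' \<and> S \<subseteq> S' \<and> \<gamma> \<in> Domain S'"
proof -
  define PP where "PP = {(p, q). \<forall>i. (poly.coeff p i, poly.coeff q i) \<in> S}"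
  note S0 = hom_graph_0[OF S]
  have PP_add: "(p + p', q + q') \<in> PP" if "(p, q) \<in> PP" "(p', q') \<in> PP" for p q p' q'
    using that by (auto simp: PP_def intro: hom_graphD[OF S])
  have PP_diff: "(p - p', q - q') \<in> PP" if "(p, q) \<in> PP" "(p', q') \<in> PP" for p q p' q'
    using that by (auto simp: PP_def intro: hom_graph_diff[OF S])
  have PP_mult: "(p * p', q * q') \<in> PP" if "(p, q) \<in> PP" "(p', q') \<in> PP" for p q p' q'
    using that by (auto simp: PP_def coeff_mult intro!: hom_graph_sum[OF S] hom_graphD(3)[OF S])
  have PP_monom: "(Polynomial.monom x n, Polynomial.monom y n) \<in> PP" if "(x, y) \<in> S" for x y n
    using that S0 by (auto simp: PP_def)
  define I where "I = {(p, q) \<in> PP. poly p \<gamma> = 0}"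
  define Q where "Q n \<longleftrightarrow> (\<exists>p q. (p, q) \<in> I \<and> p \<noteq> 0 \<and> Polynomial.degree p = n)" for n
  obtain r :: "'k poly" where r: "r \<noteq> 0" "ac_eval r \<gamma> = 0" by (rule alg_closure_algebraic)
  have "(map_poly to_ac r, map_poly to_ac r) \<in> I"
    using r hom_graphD(1)[OF S] by (simp add: I_def PP_def coeff_map_poly)
  moreover have "map_poly to_ac r \<noteq> 0" using r by (subst map_poly_eq_0_iff) auto
  ultimately have "\<exists>n. Q n" unfolding Q_def by blast
  define d where "d = (LEAST n. Q n)"
  have "Q d" unfolding d_def using \<open>\<exists>n. Q n\<close> by (rule LeastI_ex)
  then obtain p q where pq: "(p, q) \<in> I" "p \<noteq> 0" "Polynomial.degree p = d" unfolding Q_def by blast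
  have least: "d \<le> Polynomial.degree p'" if "(p', q') \<in> I" "p' \<noteq> 0" for p' q'
    unfolding d_def by (rule Least_le) (use that in \<open>auto simp: Q_def\<close>)
  define a b where "a = poly.coeff p d" and "b = poly.coeff q d"
  have pqS: "(poly.coeff p i, poly.coeff q i) \<in> S" for i using pq(1) by (auto simp: I_def PP_def)
  have ab: "(a, b) \<in> S" unfolding a_def b_def by (rule pqS)
  have a0: "a \<noteq> 0" using pq by (auto simp: a_def)
  \<comment> \<open>Injectivity keeps the degree of q from dropping below that of p, so q is
    non-constant and has a root.\<close>
  then have b0: "b \<noteq> 0" using ab hom_graph_inj[OF S] by auto
  have d0: "d > 0"
  proof (rule ccontr)
    assume "\<not> d > 0"
    then obtain c where "p = [:c:]" using pq(3) by (auto elim: degree_eq_zeroE)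
    then show False using pq by (auto simp: I_def)
  qed
  have "Polynomial.degree q \<ge> d" using b0 unfolding b_def by (rule le_degree)
  then obtain \<delta> where \<delta>: "poly q \<delta> = 0" using d0 alg_closed_imp_poly_has_root[of q] by auto
  have vanish: "poly q' \<delta> = 0" if "(p', q') \<in> I" for p' q'
    using that
  proof (induction "Polynomial.degree p'" arbitrary: p' q' rule: less_induct)
    case less
    have S': "(poly.coeff p' i, poly.coeff q' i) \<in> S" for i using less.prems by (auto simp: I_def PP_def)
    show ?case
    proof (cases "p' = 0")
      case True
      have "q' = 0"
      proof (rule poly_eqI)
        show "poly.coeff q' i = poly.coeff 0 i" for i
          using S'[of i] hom_graphD(4)[OF S] by (simp add: True)
      qed
      then show ?thesis by simp
    next
      case False
      define n a' b' where "n = Polynomial.degree p'" and "a' = poly.coeff p' n" and "b' = poly.coeff q' n"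
      have n: "d \<le> n" using least[OF less.prems False] by (simp add: n_def)
      \<comment> \<open>One step of pseudo-division by p, in parallel on both members: the leading
        term cancels without dividing in the domain.\<close>
      define p2 where "p2 = Polynomial.monom a 0 * p' - Polynomial.monom a' (n - d) * p"
      define q2 where "q2 = Polynomial.monom b 0 * q' - Polynomial.monom b' (n - d) * q"
      have "(a', b') \<in> S" unfolding a'_def b'_def by (rule S')
      then have "(p2, q2) \<in> PP" unfolding p2_def q2_def
        using less.prems pq(1) ab by (intro PP_diff PP_mult PP_monom) (auto simp: I_def)
      then have I2: "(p2, q2) \<in> I" using less.prems pq(1) by (simp add: I_def p2_def)
      have "Polynomial.degree p2 \<le> n" unfolding p2_def
      proof (rule degree_diff_le)
        show "Polynomial.degree (Polynomial.monom a 0 * p') \<le> n"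
          by (simp add: monom_0 n_def)
        have "Polynomial.degree (Polynomial.monom a' (n - d) * p) \<le> (n - d) + d"
          using pq(3) by (intro order_trans[OF degree_mult_le] add_mono degree_monom_le) simp
        then show "Polynomial.degree (Polynomial.monom a' (n - d) * p) \<le> n" using n by simp
      qed
      moreover have "poly.coeff p2 n = 0"
        using n by (simp add: p2_def monom_0 coeff_monom_mult a'_def a_def)
      ultimately have "Polynomial.degree p2 < n"
        using d0 n eq_zero_or_degree_less[of p2 n] by (cases "p2 = 0") auto
      then have "poly q2 \<delta> = 0" using less.hyps I2 by (simp add: n_def)
      then show ?thesis using \<delta> b0 by (simp add: q2_def monom_0)
    qed
  qed
  define S' where "S' = (\<lambda>(p, q). (poly p \<gamma>, poly q \<delta>)) ` PP"
  have S'I: "(poly p \<gamma>, poly q \<delta>) \<in> S'" if "(p, q) \<in> PP" for p q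
    unfolding S'_def using that by (rule rev_image_eqI) simp
  have sub: "S \<subseteq> S'"
  proof safe
    fix x y assume "(x, y) \<in> S"
    from S'I[OF PP_monom[OF this, of 0]] show "(x, y) \<in> S'" by (simp add: monom_0)
  qed
  have "hom_graph S'" unfolding hom_graph_def
  proof (intro conjI allI impI)
    show "(to_ac c, to_ac c) \<in> S'" for c using sub hom_graphD(1)[OF S] by blast
    show "y = 0" if "(0, y) \<in> S'" for y
      using that vanish by (auto simp: S'_def I_def)
    fix x y x' y' assume "(x, y) \<in> S'" "(x', y') \<in> S'"
    then obtain p q p' q' where e: "(p, q) \<in> PP" "x = poly p \<gamma>" "y = poly q \<delta>"
      "(p', q') \<in> PP" "x' = poly p' \<gamma>" "y' = poly q' \<delta>" by (auto simp: S'_def)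
    show "(x + x', y + y') \<in> S'" using S'I[OF PP_add[OF e(1,4)]] e by simp
    show "(x * x', y * y') \<in> S'" using S'I[OF PP_mult[OF e(1,4)]] e by simp
  qed
  moreover have "(\<gamma>, \<delta>) \<in> S'"
    using S'I[OF PP_monom[OF hom_graph_1[OF S], of 1]] by (simp add: poly_monom)
  ultimately show ?thesis using sub by blast
qed

text \<open>A maximal graph from Zorn's lemma is total, as it could otherwise be extended. The
  resulting injective map permutes the finite root set of each nonzero polynomial over k, hence it
  is surjective.\<close>

lemma extend_to_galois_group:
  fixes S0 :: "('k::field alg_closure \<times> 'k alg_closure) set"
  assumes S0: "hom_graph S0"
  obtains \<sigma> where "\<sigma> \<in> galois_group" "\<And>x y. (x, y) \<in> S0 \<Longrightarrow> \<sigma> x = y"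
proof -
  define \<A> where "\<A> = {S. hom_graph S \<and> S0 \<subseteq> S}"
  have "\<exists>M\<in>\<A>. \<forall>S\<in>\<A>. M \<subseteq> S \<longrightarrow> S = M"
  proof (rule subset_Zorn_nonempty)
    show "\<A> \<noteq> {}" using S0 by (auto simp: \<A>_def)
    fix C assume C: "C \<noteq> {}" "subset.chain \<A> C"
    have mem: "hom_graph S" "S0 \<subseteq> S" if "S \<in> C" for S
      using C that by (auto simp: subset.chain_def \<A>_def)
    have "hom_graph (\<Union>C)" unfolding hom_graph_def
    proof (intro conjI allI impI)
      show "(to_ac c, to_ac c) \<in> \<Union>C" for c using C(1) mem hom_graphD(1) by blast
      show "y = 0" if "(0, y) \<in> \<Union>C" for y using that mem hom_graphD(4) by blast
      fix x y x' y' assume "(x, y) \<in> \<Union>C" "(x', y') \<in> \<Union>C"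
      then obtain A B where AB: "A \<in> C" "(x, y) \<in> A" "B \<in> C" "(x', y') \<in> B" by blast
      moreover have "A \<subseteq> B \<or> B \<subseteq> A" using C(2) AB by (auto simp: subset.chain_def)
      ultimately obtain D where D: "D \<in> C" "(x, y) \<in> D" "(x', y') \<in> D" by blast
      show "(x + x', y + y') \<in> \<Union>C" using hom_graphD(2)[OF mem(1)[OF D(1)] D(2,3)] D(1) by blast
      show "(x * x', y * y') \<in> \<Union>C" using hom_graphD(3)[OF mem(1)[OF D(1)] D(2,3)] D(1) by blast
    qed
    moreover have "S0 \<subseteq> \<Union>C" using C(1) mem(2) by blast
    ultimately show "\<Union>C \<in> \<A>" by (simp add: \<A>_def)
  qed
  then obtain M where M: "hom_graph M" "S0 \<subseteq> M" and max: "\<And>S. S \<in> \<A> \<Longrightarrow> M \<subseteq> S \<Longrightarrow> S = M"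
    by (auto simp: \<A>_def)
  have total: "\<exists>y. (x, y) \<in> M" for x
  proof -
    obtain S' where S': "hom_graph S'" "M \<subseteq> S'" "x \<in> Domain S'" using hom_graph_extend[OF M(1)] by blast
    then have "S' = M" using max M(2) by (auto simp: \<A>_def)
    then show ?thesis using S'(3) by blast
  qed
  define \<sigma> where "\<sigma> x = (SOME y. (x, y) \<in> M)" for x
  have \<sigma>: "(x, \<sigma> x) \<in> M" for x unfolding \<sigma>_def using total[of x] by (rule someI_ex)
  have \<sigma>_eq: "\<sigma> x = y" if "(x, y) \<in> M" for x y
    using hom_graph_diff[OF M(1) \<sigma>[of x] that] hom_graphD(4)[OF M(1), of "\<sigma> x - y"] by simp
  have inj: "inj \<sigma>"
  proof (rule injI)
    fix x y assume "\<sigma> x = \<sigma> y"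
    then show "x = y" using hom_graph_diff[OF M(1) \<sigma>[of x] \<sigma>[of y]] hom_graph_inj[OF M(1), of "x - y"] by simp
  qed
  have "surj \<sigma>" unfolding surj_def
  proof
    fix y
    obtain r :: "'k poly" where r: "r \<noteq> 0" "ac_eval r y = 0" by (rule alg_closure_algebraic)
    define R where "R = {x. ac_eval r x = 0}"
    have "map_poly to_ac r \<noteq> 0" using r by (subst map_poly_eq_0_iff) auto
    then have "finite R" unfolding R_def by (rule poly_roots_finite)
    moreover have "\<sigma> ` R \<subseteq> R"
    proof (rule image_subsetI)
      fix x assume "x \<in> R"
      then have "(0, ac_eval r (\<sigma> x)) \<in> M" using hom_graph_eval[OF M(1) \<sigma>[of x], of r] by (simp add: R_def)
      then show "\<sigma> x \<in> R" using hom_graphD(4)[OF M(1)] by (simp add: R_def)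
    qed
    ultimately have "\<sigma> ` R = R" using inj by (meson endo_inj_surj inj_on_subset subset_UNIV)
    moreover have "y \<in> R" using r by (simp add: R_def)
    ultimately show "\<exists>x. y = \<sigma> x" by blast
  qed
  then have "\<sigma> \<in> galois_group" unfolding galois_group_def
    using inj \<sigma>_eq hom_graphD(1-3)[OF M(1)] \<sigma> by (simp add: bij_def)
  then show ?thesis using that \<sigma>_eq M(2) by blast
qed

text \<open>Every root of the minimal polynomial of x is a Galois image of x, hence x itself;
  perfectness makes this root simple, so the polynomial is linear over k.\<close>

theorem fixed_field_galois_group:
  fixes x :: "'k::field alg_closure"
  assumes perf: "perfect_field TYPE('k)" and fixed: "\<And>\<sigma>. \<sigma> \<in> galois_group \<Longrightarrow> \<sigma> x = x"
  shows "x \<in> range to_ac"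
proof -
  obtain p where p: "Factorial_Ring.irreducible p" "ac_eval p x = 0" "\<And>q. ac_eval q x = 0 \<Longrightarrow> p dvd q"
    by (rule minimal_polynomial[of x]) (erule that, assumption+)
  define P where "P = map_poly to_ac p"
  have sf: "rsquarefree P" using perf p(1) by (simp add: perfect_field_def P_def)
  have P0: "P \<noteq> 0" using sf by (simp add: rsquarefree_def)
  have other: "y = x" if y: "poly P y = 0" for y
  proof -
    \<comment> \<open>The homomorphism q(x) to q(y) on k[x]. It is well defined because the minimal
      polynomial of x also kills y.\<close>
    define S where "S = range (\<lambda>q. (ac_eval q x, ac_eval q y))"
    have SI: "(ac_eval q x, ac_eval q y) \<in> S" for q unfolding S_def by blast
    have "hom_graph S" unfolding hom_graph_def
    proof (intro conjI allI impI)
      show "(to_ac c, to_ac c) \<in> S" for c using SI[of "[:c:]"] by (simp add: map_poly_pCons)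
      show "z = 0" if "(0, z) \<in> S" for z
      proof -
        obtain q where q: "ac_eval q x = 0" "z = ac_eval q y" using \<open>(0, z) \<in> S\<close> by (auto simp: S_def)
        then obtain q' where "q = p * q'" using p(3) by (auto elim: dvdE)
        then show ?thesis using q y by (simp add: map_poly_to_ac_mult P_def)
      qed
      fix z w z' w' assume "(z, w) \<in> S" "(z', w') \<in> S"
      then obtain q q' where e: "z = ac_eval q x" "w = ac_eval q y" "z' = ac_eval q' x" "w' = ac_eval q' y"
        by (auto simp: S_def)
      show "(z + z', w + w') \<in> S" using SI[of "q + q'"] by (simp add: e map_poly_to_ac_add)
      show "(z * z', w * w') \<in> S" using SI[of "q * q'"] by (simp add: e map_poly_to_ac_mult)
    qed
    then obtain \<sigma> where "\<sigma> \<in> galois_group" "\<And>z w. (z, w) \<in> S \<Longrightarrow> \<sigma> z = w"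
      by (rule extend_to_galois_group) blast
    moreover have "(x, y) \<in> S" using SI[of "[:0, 1:]"] by (simp add: map_poly_pCons)
    ultimately show ?thesis using fixed by force
  qed
  obtain Q where Q: "P = [:- x, 1:] * Q" using p(2) by (auto simp: P_def poly_eq_0_iff_dvd elim: dvdE)
  have Q0: "Q \<noteq> 0" using P0 Q by auto
  have "Polynomial.degree Q = 0"
  proof (rule ccontr)
    assume "Polynomial.degree Q \<noteq> 0"
    then obtain y where y: "poly Q y = 0" using alg_closed_imp_poly_has_root by blast
    then have "y = x" using other Q by simp
    then have "[:- x, 1:] dvd Q" using y by (simp add: poly_eq_0_iff_dvd)
    then have "[:- x, 1:] ^ 2 dvd P" unfolding Q power2_eq_square by (rule mult_dvd_mono[OF dvd_refl])
    then have "2 \<le> Polynomial.order x P" using P0 order_divides by blast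
    then show False using sf by (auto simp: rsquarefree_def dest!: spec[of _ x])
  qed
  then obtain c where c: "Q = [:c:]" by (elim degree_eq_zeroE)
  have "to_ac (poly.coeff p 1) = c" "to_ac (poly.coeff p 0) = - (x * c)"
    using arg_cong[OF Q[unfolded P_def], of "\<lambda>q. poly.coeff q 1"]
      arg_cong[OF Q[unfolded P_def], of "\<lambda>q. poly.coeff q 0"] c
    by (simp_all add: coeff_map_poly)
  then have "x = to_ac (- poly.coeff p 0 / poly.coeff p 1)" using Q0 c by simp
  then show ?thesis by blast
qed

text \<open>At a root x the minimal polynomial p of x divides F exactly once, since F is squarefree,
  and p itself has simple roots by perfectness.\<close>

lemma rsquarefree_map_poly_to_ac:
  fixes F :: "'k::field poly"
  assumes perf: "perfect_field TYPE('k)" and F: "squarefree F" "F \<noteq> 0"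
  shows "rsquarefree (map_poly to_ac F)"
  unfolding rsquarefree_def
proof (intro conjI allI)
  show F0: "map_poly to_ac F \<noteq> 0" using F by (subst map_poly_eq_0_iff) auto
  fix x
  show "Polynomial.order x (map_poly to_ac F) = 0 \<or> Polynomial.order x (map_poly to_ac F) = 1"
  proof (cases "ac_eval F x = 0")
    case True
    obtain p where p: "Factorial_Ring.irreducible p" "ac_eval p x = 0" "\<And>q. ac_eval q x = 0 \<Longrightarrow> p dvd q"
      by (rule minimal_polynomial[of x]) (erule that, assumption+)
    obtain q where q: "F = p * q" using p(3)[OF True] by (elim dvdE)
    have "rsquarefree (map_poly to_ac p)" using perf p(1) by (simp add: perfect_field_def)
    then have "Polynomial.order x (map_poly to_ac p) \<le> 1" by (auto simp: rsquarefree_def dest!: spec[of _ x])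
    moreover have "ac_eval q x \<noteq> 0"
    proof
      assume "ac_eval q x = 0"
      then have "p ^ 2 dvd F" unfolding q power2_eq_square using p(3) by (intro mult_dvd_mono) auto
      then have "is_unit p" using F(1) by (auto simp: squarefree_def)
      then show False using p(1) irreducible_not_unit by blast
    qed
    then have "Polynomial.order x (map_poly to_ac q) = 0" by (rule order_0I)
    ultimately show ?thesis using F0 unfolding q map_poly_to_ac_mult by (subst (1 2) order_mult) auto
  qed (use order_0I in blast)
qed

section \<open>The dihedral group of order 12\<close>

abbreviation dmul :: "int \<times> bool \<Rightarrow> int \<times> bool \<Rightarrow> int \<times> bool" where
  "dmul \<equiv> monoid.mult (dihedral_group 6)"

abbreviation dcarrier :: "(int \<times> bool) set" where
  "dcarrier \<equiv> carrier (dihedral_group 6)"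

lemma dmul_simp: "dmul (a, s) (b, t) = ((if s then a - b else a + b) mod 6, s \<noteq> t)"
  by (simp add: dihedral_group_def)

lemma dcarrier_iff: "(a, s) \<in> dcarrier \<longleftrightarrow> a \<in> {0, 1, 2, 3, 4, 5}"
  by (auto simp: dihedral_group_def)

text \<open>(3, False) is the half-turn, which generates the centre. The quotient is S3, and
  commuting there with the generating rotation and one reflection already forces triviality.\<close>

lemma dihedral_center_mod_center:
  assumes c: "c \<in> dcarrier"
    and comm: "\<And>x. x \<in> dcarrier \<Longrightarrow> \<exists>z\<in>{(0, False), (3, False)}. dmul c x = dmul z (dmul x c)"
  shows "c \<in> {(0, False), (3, False)}"
proof -
  obtain p q where pq: "c = (p, q)" by (cases c)
  have p: "p \<in> {0, 1, 2, 3, 4, 5}" using c by (simp add: pq dcarrier_iff)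
  have "\<exists>z\<in>{(0, False), (3, False)}. dmul c (1, False) = dmul z (dmul (1, False) c)"
    "\<exists>z\<in>{(0, False), (3, False)}. dmul c (0, True) = dmul z (dmul (0, True) c)"
    by (intro comm; simp add: dcarrier_iff)+
  then show ?thesis using p by (cases q) (auto simp: pq dmul_simp)
qed

text \<open>Conjugation by \<open>(j, b)\<close> sends the reflection \<open>(0, True)\<close> to \<open>(2 j, True)\<close> up to sign, so with
  \<open>j = 2 m\<close> it agrees with \<open>(m, True)\<close> modulo 3.\<close>

lemma dihedral_automorphism_inner_mod_center:
  assumes bij: "bij_betw \<theta> dcarrier dcarrier"
    and hom: "\<And>x y. x \<in> dcarrier \<Longrightarrow> y \<in> dcarrier \<Longrightarrow> \<theta> (dmul x y) = dmul (\<theta> x) (\<theta> y)"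
  obtains g where "g \<in> dcarrier"
    "\<And>x. x \<in> dcarrier \<Longrightarrow> \<exists>z\<in>{(0, False), (3, False)}. dmul (\<theta> x) g = dmul z (dmul g x)"
proof -
  have mem: "\<theta> x \<in> dcarrier" if "x \<in> dcarrier" for x using bij that by (rule bij_betwE[rule_format])
  have inj: "x = y" if "\<theta> x = \<theta> y" "x \<in> dcarrier" "y \<in> dcarrier" for x y
    using bij that by (auto simp: bij_betw_def dest: inj_onD)
  obtain u t where 0: "\<theta> (0, False) = (u, t)" by (cases "\<theta> (0, False)")
  have u: "u \<in> {0, 1, 2, 3, 4, 5}" using mem[of "(0, False)"] 0 by (simp add: dcarrier_iff)
  have "(u, t) = dmul (u, t) (u, t)"
    using hom[of "(0, False)" "(0, False)"] 0 by (simp add: dcarrier_iff dmul_simp[of 0 False 0 False])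
  then have one: "\<theta> (0, False) = (0, False)" using u 0 by (auto simp: dmul_simp)
  obtain a s where 1: "\<theta> (1, False) = (a, s)" by (cases "\<theta> (1, False)")
  have a: "a \<in> {0, 1, 2, 3, 4, 5}" using mem[of "(1, False)"] 1 by (simp add: dcarrier_iff)
  have 2: "\<theta> (2, False) = dmul (a, s) (a, s)"
    using hom[of "(1, False)" "(1, False)"] 1 by (simp add: dcarrier_iff dmul_simp)
  have 3: "\<theta> (3, False) = dmul (a, s) (dmul (a, s) (a, s))"
    using hom[of "(1, False)" "(2, False)"] 1 2 by (simp add: dcarrier_iff dmul_simp)
  have 4: "\<theta> (4, False) = dmul (a, s) (dmul (a, s) (dmul (a, s) (a, s)))"
    using hom[of "(1, False)" "(3, False)"] 1 3 by (simp add: dcarrier_iff dmul_simp)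
  have 5: "\<theta> (5, False) = dmul (a, s) (dmul (a, s) (dmul (a, s) (dmul (a, s) (a, s))))"
    using hom[of "(1, False)" "(4, False)"] 1 4 by (simp add: dcarrier_iff dmul_simp)
  \<comment> \<open>The image of the generating rotation has nontrivial square and cube. This
    excludes the reflections and every rotation of order less than 6.\<close>
  have "\<theta> (2, False) \<noteq> (0, False)" "\<theta> (3, False) \<noteq> (0, False)"
    using inj[of "(2, False)" "(0, False)"] inj[of "(3, False)" "(0, False)"] one
    by (auto simp: dcarrier_iff)
  then have as: "s = False" "a \<in> {1, 5}" using a 2 3 by (auto simp: dmul_simp split: if_splits)
  have rot: "\<theta> (k, False) = (k * a mod 6, False)" if "k \<in> {0, 1, 2, 3, 4, 5}" for k
    using that as one 1 2 3 4 5 by (auto simp: dmul_simp)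
  obtain m v where r: "\<theta> (0, True) = (m, v)" by (cases "\<theta> (0, True)")
  have m: "m \<in> {0, 1, 2, 3, 4, 5}" using mem[of "(0, True)"] r by (simp add: dcarrier_iff)
  have refl: "\<theta> (k, True) = dmul (k * a mod 6, False) (m, v)" if k: "k \<in> {0, 1, 2, 3, 4, 5}" for k
  proof -
    have "dmul (k, False) (0, True) = (k, True)" using k by (auto simp: dmul_simp)
    then show ?thesis using hom[of "(k, False)" "(0, True)"] rot[OF k] r k
      by (simp only: dcarrier_iff) simp
  qed
  \<comment> \<open>Otherwise all values of \<theta> would be rotations, against
    surjectivity.\<close>
  have v
  proof (rule ccontr)
    assume "\<not> v"
    have "(0, True) \<in> \<theta> ` dcarrier" using bij by (simp add: bij_betw_def dcarrier_iff)
    then obtain k w where k: "(k, w) \<in> dcarrier" "\<theta> (k, w) = (0, True)" by auto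
    then show False using rot[of k] refl[of k] \<open>\<not> v\<close>
      by (cases w) (auto simp: dcarrier_iff dmul_simp)
  qed
  \<comment> \<open>The flag \<open>a = 5\<close> makes conjugation by g invert the rotations
    exactly when \<theta> does.\<close>
  define g where "g = (2 * m mod 6, a = 5)"
  have "g \<in> dcarrier" using m by (auto simp: g_def dcarrier_iff)
  moreover have "\<exists>z\<in>{(0, False), (3, False)}. dmul (\<theta> x) g = dmul z (dmul g x)" if "x \<in> dcarrier" for x
  proof -
    obtain k w where x: "x = (k, w)" by (cases x)
    have k: "k \<in> {0, 1, 2, 3, 4, 5}" using that by (simp add: x dcarrier_iff)
    show ?thesis
    proof (cases w)
      case True
      show ?thesis unfolding x g_def using True refl[OF k] \<open>v\<close> k m as(2)
        by (simp add: dmul_simp) (elim disjE; simp)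
    next
      case False
      show ?thesis unfolding x g_def using False rot[OF k] k m as(2)
        by (simp add: dmul_simp) (elim disjE; simp)
    qed
  qed
  ultimately show ?thesis by (rule that)
qed

section \<open>The Galois action\<close>

abbreviation ac_poly :: "'k::field poly \<Rightarrow> 'k alg_closure poly" where
  "ac_poly F \<equiv> map_poly to_ac F"

lemma simple_sextic_ac_poly:
  fixes F :: "'k::field poly"
  assumes "perfect_field TYPE('k)" "genus2_model F"
  shows "simple_sextic (ac_poly F)"
proof -
  have F: "squarefree F" "Polynomial.degree F \<in> {5, 6}" using assms by (auto simp: genus2_model_def)
  then have "F \<noteq> 0" by auto
  moreover have "Polynomial.degree (ac_poly F) = Polynomial.degree F"
    by (rule degree_map_poly) simp
  ultimately show ?thesis
    using F rsquarefree_map_poly_to_ac[OF assms(1), of F] by (simp add: simple_sextic_def)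
qed

lemma galois_groupD:
  assumes "\<sigma> \<in> galois_group"
  shows "bij \<sigma>" "\<sigma> (x + y) = \<sigma> x + \<sigma> y" "\<sigma> (x * y) = \<sigma> x * \<sigma> y" "\<sigma> (to_ac a) = to_ac a"
    "\<sigma> 0 = 0" "\<sigma> 1 = 1" "\<sigma> (- x) = - \<sigma> x" "\<sigma> (x - y) = \<sigma> x - \<sigma> y"
    "\<sigma> x = 0 \<longleftrightarrow> x = 0" "\<sigma> x = \<sigma> y \<longleftrightarrow> x = y"
    "\<sigma> (x ^ n) = \<sigma> x ^ n" "\<sigma> (x / y) = \<sigma> x / \<sigma> y" "\<sigma> (sum f I) = (\<Sum>i\<in>I. \<sigma> (f i))"
proof -
  have bij: "bij \<sigma>" and add: "\<And>x y. \<sigma> (x + y) = \<sigma> x + \<sigma> y" and mult: "\<And>x y. \<sigma> (x * y) = \<sigma> x * \<sigma> y"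
    and const: "\<And>a. \<sigma> (to_ac a) = to_ac a"
    using assms by (auto simp: galois_group_def)
  have inj: "\<sigma> x = \<sigma> y \<longleftrightarrow> x = y" for x y using bij by (auto simp: bij_def dest: injD)
  have zero: "\<sigma> 0 = 0" and one: "\<sigma> 1 = 1" using const[of 0] const[of 1] by simp_all
  have iszero: "\<sigma> x = 0 \<longleftrightarrow> x = 0" for x using inj[of x 0] zero by simp
  have minus: "\<sigma> (- x) = - \<sigma> x" for x using add[of x "- x"] zero by (simp add: eq_neg_iff_add_eq_0 add.commute)
  show "bij \<sigma>" "\<sigma> (x + y) = \<sigma> x + \<sigma> y" "\<sigma> (x * y) = \<sigma> x * \<sigma> y" "\<sigma> (to_ac a) = to_ac a"
    "\<sigma> 0 = 0" "\<sigma> 1 = 1" "\<sigma> (- x) = - \<sigma> x" "\<sigma> x = 0 \<longleftrightarrow> x = 0" "\<sigma> x = \<sigma> y \<longleftrightarrow> x = y"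
    by (fact bij add mult const zero one minus iszero inj)+
  show "\<sigma> (x - y) = \<sigma> x - \<sigma> y" using add[of x "- y"] by (simp add: minus)
  show "\<sigma> (x ^ n) = \<sigma> x ^ n" by (induction n) (simp_all add: one mult)
  show "\<sigma> (x / y) = \<sigma> x / \<sigma> y"
  proof (cases "y = 0")
    case False
    then have "\<sigma> (x / y) * \<sigma> y = \<sigma> x" by (simp flip: mult)
    then show ?thesis using False iszero by (simp add: eq_divide_eq)
  qed (simp add: zero)
  show "\<sigma> (sum f I) = (\<Sum>i\<in>I. \<sigma> (f i))"
    by (induction I rule: infinite_finite_induct) (simp_all add: zero add)
qed

lemma galois_group_inv:
  assumes \<sigma>: "\<sigma> \<in> galois_group"
  shows "inv_into UNIV \<sigma> \<in> galois_group" "\<sigma> (inv_into UNIV \<sigma> x) = x" "inv_into UNIV \<sigma> (\<sigma> x) = x"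
proof -
  note bij = galois_groupD(1)[OF \<sigma>]
  have r: "\<sigma> (inv_into UNIV \<sigma> x) = x" for x using bij by (simp add: bij_is_surj surj_f_inv_f)
  have l: "inv_into UNIV \<sigma> (\<sigma> x) = x" for x using bij by (simp add: bij_is_inj)
  show "\<sigma> (inv_into UNIV \<sigma> x) = x" "inv_into UNIV \<sigma> (\<sigma> x) = x" by (fact r l)+
  have "inv_into UNIV \<sigma> (x + y) = inv_into UNIV \<sigma> x + inv_into UNIV \<sigma> y"
    "inv_into UNIV \<sigma> (x * y) = inv_into UNIV \<sigma> x * inv_into UNIV \<sigma> y"
    "inv_into UNIV \<sigma> (to_ac a) = to_ac a" for x y a
    by (subst galois_groupD(10)[OF \<sigma>, symmetric], simp only: r galois_groupD(2-4)[OF \<sigma>])+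
  then show "inv_into UNIV \<sigma> \<in> galois_group"
    using bij_imp_bij_inv[OF bij] by (simp add: galois_group_def)
qed

fun lin_conj :: "('a \<Rightarrow> 'a) \<Rightarrow> 'a::field lin \<Rightarrow> 'a lin" where
  "lin_conj \<sigma> (a, b, c, d, e) = (\<sigma> a, \<sigma> b, \<sigma> c, \<sigma> d, \<sigma> e)"

lemma lin_conj_comp:
  "\<sigma> \<in> galois_group \<Longrightarrow> lin_conj \<sigma> (lin_comp m n) = lin_comp (lin_conj \<sigma> m) (lin_conj \<sigma> n)"
  by (cases m rule: lin_nonsingular.cases, cases n rule: lin_nonsingular.cases)
     (simp add: galois_groupD)

lemma lin_conj_inv:
  assumes \<sigma>: "\<sigma> \<in> galois_group"
  shows "lin_conj \<sigma> (lin_conj (inv_into UNIV \<sigma>) m) = m"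
  by (cases m rule: lin_nonsingular.cases) (simp add: galois_group_inv[OF \<sigma>])

lemma lin_prop_conj:
  assumes \<sigma>: "\<sigma> \<in> galois_group" and "lin_prop {1, - 1} m n"
  shows "lin_prop {1, - 1} (lin_conj \<sigma> m) (lin_conj \<sigma> n)"
proof -
  obtain t s where ts: "t \<noteq> 0" "s \<in> {1, - 1}" "n = lin_comp m (t, 0, 0, t, s * t ^ 3)"
    using assms(2) unfolding lin_prop_altdef by blast
  have "lin_conj \<sigma> n = lin_comp (lin_conj \<sigma> m) (\<sigma> t, 0, 0, \<sigma> t, \<sigma> s * \<sigma> t ^ 3)"
    using ts(3) by (simp add: lin_conj_comp[OF \<sigma>] galois_groupD[OF \<sigma>])
  moreover have "\<sigma> s \<in> {1, - 1}" "\<sigma> t \<noteq> 0" using ts(1,2) by (auto simp: galois_groupD[OF \<sigma>])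
  ultimately show ?thesis unfolding lin_prop_altdef by blast
qed

lemma hom_eval_conj:
  "\<sigma> \<in> galois_group \<Longrightarrow> hom_eval (ac_poly F) (\<sigma> x) (\<sigma> z) = \<sigma> (hom_eval (ac_poly F) x z)"
  by (simp add: hom_eval_def galois_groupD coeff_map_poly)

text \<open>Both sextics have coefficients in k, so conjugating the identity affects only the tuple;
  arbitrary arguments are reached because \<sigma> is surjective.\<close>

lemma lin_iso_conj:
  assumes \<sigma>: "\<sigma> \<in> galois_group" and m: "lin_iso (ac_poly F) (ac_poly G) m"
  shows "lin_iso (ac_poly F) (ac_poly G) (lin_conj \<sigma> m)"
proof -
  obtain a b c d e where m_eq: "m = (a, b, c, d, e)" by (metis prod_cases5)
  have nz: "a * d - b * c \<noteq> 0" "e \<noteq> 0"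
    and hom: "hom_eval (ac_poly G) (a * x + b * z) (c * x + d * z) = e\<^sup>2 * hom_eval (ac_poly F) x z" for x z
    using m by (auto simp: m_eq)
  have "hom_eval (ac_poly G) (\<sigma> a * x + \<sigma> b * z) (\<sigma> c * x + \<sigma> d * z) = (\<sigma> e)\<^sup>2 * hom_eval (ac_poly F) x z" for x z
  proof -
    obtain x' z' where xz: "x = \<sigma> x'" "z = \<sigma> z'" using galois_group_inv(2)[OF \<sigma>] by metis
    have "hom_eval (ac_poly G) (\<sigma> (a * x' + b * z')) (\<sigma> (c * x' + d * z')) = \<sigma> (e\<^sup>2 * hom_eval (ac_poly F) x' z')"
      unfolding hom_eval_conj[OF \<sigma>] hom ..
    then show ?thesis unfolding xz hom_eval_conj[OF \<sigma>, of F] by (simp add: galois_groupD[OF \<sigma>])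
  qed
  moreover have "\<sigma> (a * d - b * c) \<noteq> 0" "\<sigma> e \<noteq> 0" using nz by (simp_all only: galois_groupD(9)[OF \<sigma>]) simp_all
  ultimately show ?thesis by (simp add: m_eq galois_groupD[OF \<sigma>])
qed

section \<open>Galois action on points and maps\<close>

lemma galois_point_wpoint:
  assumes \<sigma>: "\<sigma> \<in> galois_group"
  shows "galois_point \<sigma> (wpoint (x, y, z)) = wpoint (\<sigma> x, \<sigma> y, \<sigma> z)"
proof -
  have "galois_point \<sigma> (wpoint (x, y, z)) = {(\<sigma> (t * x), \<sigma> (t ^ 3 * y), \<sigma> (t * z)) | t. t \<noteq> 0}"
    by (simp add: galois_point_def wpoint_def setcompr_eq_image image_image)
  also have "\<dots> = {(\<sigma> t * \<sigma> x, \<sigma> t ^ 3 * \<sigma> y, \<sigma> t * \<sigma> z) | t. \<sigma> t \<noteq> 0}"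
    by (simp add: galois_groupD[OF \<sigma>])
  also have "\<dots> = {(t * \<sigma> x, t ^ 3 * \<sigma> y, t * \<sigma> z) | t. t \<noteq> 0}"
    using galois_group_inv(2)[OF \<sigma>] by (auto; metis)
  finally show ?thesis by (simp add: wpoint_def)
qed

lemma galois_point_in_curve:
  assumes \<sigma>: "\<sigma> \<in> galois_group" and P: "P \<in> curve F"
  shows "galois_point \<sigma> P \<in> curve F"
proof -
  obtain x y z where P_eq: "P = wpoint (x, y, z)" "(x, y, z) \<noteq> (0, 0, 0)" "y\<^sup>2 = hom_eval (ac_poly F) x z"
    using P[unfolded curve_eq_proj_curve] by (rule wpointE)
  have "(\<sigma> y)\<^sup>2 = hom_eval (ac_poly F) (\<sigma> x) (\<sigma> z)"
    unfolding hom_eval_conj[OF \<sigma>] P_eq(3)[symmetric] by (simp add: galois_groupD[OF \<sigma>])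
  then show ?thesis using P_eq(2)
    by (simp add: P_eq(1) curve_eq_proj_curve galois_point_wpoint[OF \<sigma>] wpoint_in_proj_curve galois_groupD(9)[OF \<sigma>])
qed

lemma galois_point_inv:
  assumes \<sigma>: "\<sigma> \<in> galois_group" and P: "P \<in> curve F"
  shows "galois_point \<sigma> (galois_point (inv_into UNIV \<sigma>) P) = P"
proof -
  obtain x y z where P_eq: "P = wpoint (x, y, z)"
    using P[unfolded curve_eq_proj_curve] by (rule wpointE)
  show ?thesis
    by (simp add: P_eq galois_point_wpoint galois_group_inv(1)[OF \<sigma>] \<sigma> galois_group_inv(2)[OF \<sigma>])
qed

lemma galois_point_lin_map:
  assumes \<sigma>: "\<sigma> \<in> galois_group" and P: "P \<in> curve F"
  shows "galois_point \<sigma> (lin_map m P) = lin_map (lin_conj \<sigma> m) (galois_point \<sigma> P)"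
proof -
  obtain x y z where P_eq: "P = wpoint (x, y, z)"
    using P[unfolded curve_eq_proj_curve] by (rule wpointE)
  show ?thesis
    by (cases m rule: lin_nonsingular.cases)
       (simp add: P_eq lin_map_wpoint galois_point_wpoint[OF \<sigma>] galois_groupD[OF \<sigma>])
qed

lemma rational_wform_conj:
  assumes \<sigma>: "\<sigma> \<in> galois_group" and f: "wform (range to_ac) d f"
  shows "f (\<sigma> x, \<sigma> y, \<sigma> z) = \<sigma> (f (x, y, z))"
proof -
  obtain c where c: "\<And>i j. c i j \<in> range to_ac" and f: "f = (\<lambda>(x, y, z). \<Sum>(i, j) | i + 3 * j \<le> d. c i j * x ^ i * y ^ j * z ^ (d - (i + 3 * j)))"
    using f unfolding wform_def by blast
  have "\<sigma> (c i j) = c i j" for i j using c[of i j] galois_groupD(4)[OF \<sigma>] by auto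
  then show ?thesis by (simp add: f galois_groupD[OF \<sigma>] case_prod_unfold)
qed

text \<open>Forms over k commute with \<sigma>, and their nonvanishing at P carries over to the
  conjugate point, so one local formula computes both sides.\<close>

lemma rational_morphism_conj:
  assumes \<sigma>: "\<sigma> \<in> galois_group" and mor: "morphism_over (range to_ac) (curve F) D \<phi>"
    and P: "P \<in> curve F"
  shows "\<phi> (galois_point \<sigma> P) = galois_point \<sigma> (\<phi> P)"
proof -
  obtain d f g h where w: "wform (range to_ac) d f" "wform (range to_ac) (3 * d) g" "wform (range to_ac) d h"
    and ex: "\<exists>p. wpoint p = P \<and> (f p, g p, h p) \<noteq> (0, 0, 0)"
    and eq: "\<And>q. wpoint q \<in> curve F \<Longrightarrow> (f q, g q, h q) \<noteq> (0, 0, 0) \<Longrightarrow> \<phi> (wpoint q) = wpoint (f q, g q, h q)"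
    using mor P unfolding morphism_over_def by metis
  obtain x y z where q: "wpoint (x, y, z) = P" "(f (x, y, z), g (x, y, z), h (x, y, z)) \<noteq> (0, 0, 0)"
    using ex by (metis prod_cases3)
  note conj = w[THEN rational_wform_conj[OF \<sigma>]]
  have \<sigma>P: "galois_point \<sigma> P = wpoint (\<sigma> x, \<sigma> y, \<sigma> z)"
    by (simp add: q(1)[symmetric] galois_point_wpoint[OF \<sigma>])
  have "\<phi> (wpoint (\<sigma> x, \<sigma> y, \<sigma> z)) = wpoint (f (\<sigma> x, \<sigma> y, \<sigma> z), g (\<sigma> x, \<sigma> y, \<sigma> z), h (\<sigma> x, \<sigma> y, \<sigma> z))"
  proof (rule eq)
    show "wpoint (\<sigma> x, \<sigma> y, \<sigma> z) \<in> curve F" using galois_point_in_curve[OF \<sigma> P] \<sigma>P by simp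
    show "(f (\<sigma> x, \<sigma> y, \<sigma> z), g (\<sigma> x, \<sigma> y, \<sigma> z), h (\<sigma> x, \<sigma> y, \<sigma> z)) \<noteq> (0, 0, 0)"
      using q(2) by (simp add: conj galois_groupD(9)[OF \<sigma>])
  qed
  also have "\<dots> = galois_point \<sigma> (\<phi> P)"
    using eq[of "(x, y, z)"] q P by (simp add: conj galois_point_wpoint[OF \<sigma>])
  finally show ?thesis by (simp only: \<sigma>P)
qed

section \<open>The automorphism group\<close>

definition aut_map :: "'k::field poly \<Rightarrow> 'k alg_closure lin \<Rightarrow> 'k alg_closure wpoint \<Rightarrow> 'k alg_closure wpoint" where
  "aut_map F n = restrict (lin_map n) (curve F)"

lemma aut_map_in_Bij: "lin_iso (ac_poly F) (ac_poly F) n \<Longrightarrow> aut_map F n \<in> Bij (curve F)"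
  using bij_betw_lin_map[of "ac_poly F" "ac_poly F" n]
  by (simp add: aut_map_def Bij_def curve_eq_proj_curve)

text \<open>Reduces computations in the automorphism group to tuples. Several tuples give one
  automorphism, which is why equality becomes \<open>lin_prop {1}\<close>.\<close>

lemma carrier_Aut:
  fixes F :: "'k::field poly"
  assumes two: "(2 :: 'k alg_closure) \<noteq> 0" and F: "simple_sextic (ac_poly F)"
  shows "\<phi> \<in> carrier (Aut F) \<longleftrightarrow> (\<exists>n. lin_iso (ac_poly F) (ac_poly F) n \<and> \<phi> = aut_map F n)"
proof
  assume "\<phi> \<in> carrier (Aut F)"
  then have ext: "\<phi> \<in> extensional (curve F)" and iso: "isomorphism_over UNIV (curve F) (curve F) \<phi>"
    by (auto simp: Aut_def Bij_def)
  obtain n where n: "lin_iso (ac_poly F) (ac_poly F) n" "\<forall>P\<in>curve F. \<phi> P = lin_map n P"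
    using isomorphism_is_linear[OF two F F] iso unfolding curve_eq_proj_curve by blast
  have "\<phi> = aut_map F n"
    by (rule extensionalityI[OF ext]) (use n(2) in \<open>auto simp: aut_map_def\<close>)
  then show "\<exists>n. lin_iso (ac_poly F) (ac_poly F) n \<and> \<phi> = aut_map F n" using n(1) by blast
next
  assume "\<exists>n. lin_iso (ac_poly F) (ac_poly F) n \<and> \<phi> = aut_map F n"
  then obtain n where n: "lin_iso (ac_poly F) (ac_poly F) n" "\<phi> = aut_map F n" by blast
  have "lin_over UNIV m" for m :: "'k alg_closure lin" by (cases m rule: lin_nonsingular.cases) simp
  then have "isomorphism_over UNIV (curve F) (curve F) \<phi>" unfolding curve_eq_proj_curve
    by (intro isomorphism_over_lin_map[OF n(1)]) (simp_all add: n(2) aut_map_def curve_eq_proj_curve)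
  then show "\<phi> \<in> carrier (Aut F)" using aut_map_in_Bij[OF n(1)] n(2) by (simp add: Aut_def)
qed

lemma aut_map_mult:
  assumes "lin_iso (ac_poly F) (ac_poly F) m" "lin_iso (ac_poly F) (ac_poly F) n"
  shows "monoid.mult (Aut F) (aut_map F m) (aut_map F n) = aut_map F (lin_comp m n)"
proof -
  have "monoid.mult (Aut F) (aut_map F m) (aut_map F n) = compose (curve F) (aut_map F m) (aut_map F n)"
    using assms by (simp add: Aut_def BijGroup_def aut_map_in_Bij)
  also have "\<dots> = aut_map F (lin_comp m n)"
    using lin_map_in_proj_curve[OF assms(2)]
    by (auto simp: compose_def aut_map_def lin_map_comp curve_eq_proj_curve fun_eq_iff)
  finally show ?thesis .
qed

lemma aut_map_eq_iff:
  fixes F :: "'k::field poly"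
  assumes F: "simple_sextic (ac_poly F)" and m: "lin_nonsingular m"
  shows "aut_map F m = aut_map F n \<longleftrightarrow> lin_prop {1} m n"
proof
  assume eq: "aut_map F m = aut_map F n"
  have "lin_map m P = lin_map n P" if "P \<in> curve F" for P
    using fun_cong[OF eq, of P] that by (simp add: aut_map_def)
  then show "lin_prop {1} m n" using lin_map_eq_imp_prop[OF F m] by (simp add: curve_eq_proj_curve)
next
  assume "lin_prop {1} m n"
  then show "aut_map F m = aut_map F n"
    unfolding aut_map_def curve_eq_proj_curve by (intro restrict_ext lin_prop_imp_map_eq)
qed

lemma galois_conj_aut_map:
  assumes \<sigma>: "\<sigma> \<in> galois_group"
  shows "galois_conj \<sigma> F (aut_map F n) = aut_map F (lin_conj \<sigma> n)"
proof
  fix P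
  show "galois_conj \<sigma> F (aut_map F n) P = aut_map F (lin_conj \<sigma> n) P"
  proof (cases "P \<in> curve F")
    case True
    note P' = galois_point_in_curve[OF galois_group_inv(1)[OF \<sigma>] True]
    show ?thesis using True P' galois_point_lin_map[OF \<sigma> P'] galois_point_inv[OF \<sigma> True]
      by (simp add: galois_conj_def aut_map_def)
  qed (simp add: galois_conj_def aut_map_def)
qed

lemma lin_prop_signE:
  assumes "lin_prop {1, - 1} m n"
  obtains \<zeta> where "\<zeta> \<in> {lin_id, lin_hyp}" "lin_prop {1} (lin_comp \<zeta> m) n"
proof -
  obtain t s where ts: "t \<noteq> 0" "s \<in> {1, - 1}" "n = lin_comp m (t, 0, 0, t, s * t ^ 3)"
    using assms unfolding lin_prop_altdef by blast
  define \<zeta> :: "'a lin" where "\<zeta> = (1, 0, 0, 1, s)"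
  have "n = lin_comp (lin_comp \<zeta> m) (t, 0, 0, t, 1 * t ^ 3)"
    unfolding ts(3) \<zeta>_def by (cases m rule: lin_nonsingular.cases) simp
  then have "lin_prop {1} (lin_comp \<zeta> m) n" unfolding lin_prop_altdef using ts(1) by blast
  moreover have "\<zeta> \<in> {lin_id, lin_hyp}" using ts(2) by (auto simp: \<zeta>_def lin_id_def lin_hyp_def)
  ultimately show ?thesis using that by blast
qed

lemma lin_prop_central:
  assumes "\<zeta> \<in> {lin_id, lin_hyp}"
  shows "lin_prop {1, - 1} m (lin_comp \<zeta> m)"
  using assms lin_prop_hyp[of m] lin_prop_refl[of "{1, - 1}" m] by (auto simp: lin_hyp_central lin_comp_id)

lemma lin_prop_hyp_id: "(2 :: 'a::field) \<noteq> 0 \<Longrightarrow> \<not> lin_prop {1} lin_id (lin_hyp :: 'a lin)"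
proof
  assume two: "(2 :: 'a) \<noteq> 0" and "lin_prop {1} lin_id (lin_hyp :: 'a lin)"
  then have "(- 1 :: 'a) = 1" by (auto simp: lin_id_def lin_hyp_def)
  then have "(1 :: 'a) + 1 = 0" by (metis add.right_inverse)
  then show False using two by simp
qed

text \<open>The automorphisms are \<open>D\<^sub>1\<^sub>2\<close>, whose automorphisms are inner modulo the centre
  \<open>{1, \<iota>}\<close>; so an isomorphism of the curves can be chosen that induces \<open>\<psi>\<close> modulo
  \<open>\<iota>\<close>.  Its Galois cocycle then commutes with all automorphisms modulo the centre, hence is central.\<close>

lemma isomorphism_with_central_cocycle:
  fixes F1 F2 :: "'k::field poly"
  assumes two: "(2 :: 'k alg_closure) \<noteq> 0"
    and F1: "simple_sextic (ac_poly F1)" and F2: "simple_sextic (ac_poly F2)"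
    and D12: "Aut F1 \<cong> dihedral_group 6"
    and \<psi>: "\<psi> \<in> iso (Aut F1) (Aut F2)"
    and equiv: "\<And>\<sigma> \<phi>. \<sigma> \<in> galois_group \<Longrightarrow> \<phi> \<in> carrier (Aut F1) \<Longrightarrow>
       \<psi> (galois_conj \<sigma> F1 \<phi>) = galois_conj \<sigma> F2 (\<psi> \<phi>)"
    and m0: "lin_iso (ac_poly F1) (ac_poly F2) m0"
  obtains m where "lin_iso (ac_poly F1) (ac_poly F2) m"
    "\<And>\<sigma>. \<sigma> \<in> galois_group \<Longrightarrow> lin_prop {1, - 1} m (lin_conj \<sigma> m)"
proof -
  define G where "G n \<longleftrightarrow> lin_iso (ac_poly F1) (ac_poly F1) n" for n
  define H where "H n \<longleftrightarrow> lin_iso (ac_poly F2) (ac_poly F2) n" for n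
  have G_comp: "G (lin_comp n n')" if "G n" "G n'" for n n'
    using that unfolding G_def by (rule lin_iso_comp)

  have G_id: "G lin_id" and G_hyp: "G lin_hyp" by (simp_all only: G_def lin_iso_id lin_iso_hyp)
  have G_ns: "lin_nonsingular n" if "G n" for n
    using that unfolding G_def by (rule lin_iso_nonsingular)
  have H_ns: "lin_nonsingular n" if "H n" for n
    using that unfolding H_def by (rule lin_iso_nonsingular)
  have A_carrier: "aut_map F1 n \<in> carrier (Aut F1)" if "G n" for n
    using that unfolding G_def carrier_Aut[OF two F1] by blast
  have A_eq: "aut_map F1 n = aut_map F1 n' \<longleftrightarrow> lin_prop {1} n n'" if "G n" for n n'
    by (rule aut_map_eq_iff[OF F1 G_ns[OF that]])
  have B_eq: "aut_map F2 n = aut_map F2 n' \<longleftrightarrow> lin_prop {1} n n'" if "H n" for n n'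
    by (rule aut_map_eq_iff[OF F2 H_ns[OF that]])
  obtain \<beta> where \<beta>: "\<beta> \<in> iso (Aut F1) (dihedral_group 6)" using D12 by (auto simp: is_iso_def)
  have \<beta>_bij: "bij_betw \<beta> (carrier (Aut F1)) dcarrier" and \<beta>_hom: "\<beta> \<in> hom (Aut F1) (dihedral_group 6)"
    using \<beta> by (auto simp: iso_def)
  have \<psi>_bij: "bij_betw \<psi> (carrier (Aut F1)) (carrier (Aut F2))" and \<psi>_hom: "\<psi> \<in> hom (Aut F1) (Aut F2)"
    using \<psi> by (auto simp: iso_def)
  \<comment> \<open>\<open>b\<close> reads off the element of the dihedral group from a tuple; two
    tuples have the same value exactly if they are the same map.\<close>
  define b where "b n = \<beta> (aut_map F1 n)" for n
  have b_mem: "b n \<in> dcarrier" if "G n" for n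
    unfolding b_def using \<beta>_bij A_carrier[OF that] by (rule bij_betwE[rule_format])
  have b_surj: "\<exists>n. G n \<and> b n = x" if "x \<in> dcarrier" for x
  proof -
    have "x \<in> \<beta> ` carrier (Aut F1)" using that \<beta>_bij by (simp add: bij_betw_def)
    then obtain \<phi> where "\<phi> \<in> carrier (Aut F1)" "x = \<beta> \<phi>" by (rule imageE) simp
    then show ?thesis unfolding carrier_Aut[OF two F1] b_def G_def by blast
  qed
  have b_eq: "b n = b n' \<longleftrightarrow> lin_prop {1} n n'" if "G n" "G n'" for n n'
    using \<beta>_bij A_carrier[OF that(1)] A_carrier[OF that(2)] A_eq[OF that(1), of n']
    unfolding b_def bij_betw_def by (metis inj_onD)
  have b_mult: "b (lin_comp n n') = dmul (b n) (b n')" if "G n" "G n'" for n n'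
    using hom_mult[OF \<beta>_hom A_carrier[OF that(1)] A_carrier[OF that(2)]] that aut_map_mult[of F1 n n']
    by (simp add: b_def G_def)
  have b_id: "b lin_id = (0, False)"
  proof -
    obtain u t where ut: "b lin_id = (u, t)" by (cases "b lin_id")
    have "dmul (u, t) (u, t) = (u, t)" using b_mult[OF G_id G_id] ut by (simp add: lin_comp_id)
    moreover have "u \<in> {0, 1, 2, 3, 4, 5}" using b_mem[OF G_id] ut by (simp add: dcarrier_iff)
    ultimately show ?thesis using ut by (auto simp: dmul_simp)
  qed
  \<comment> \<open>The involution is central and, as 2 is nonzero, not the identity. So it
    corresponds to the half-turn.\<close>
  have b_hyp: "b lin_hyp = (3, False)"
  proof -
    have "b lin_hyp \<in> {(0, False), (3, False)}"
    proof (rule dihedral_center_mod_center[OF b_mem[OF G_hyp]])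
      fix x assume "x \<in> dcarrier"
      then obtain n where n: "G n" "x = b n" using b_surj by blast
      have "dmul (b lin_hyp) x = dmul (b lin_id) (dmul x (b lin_hyp))"
        unfolding n(2) using n(1) G_hyp G_id G_comp
        by (simp add: b_mult[symmetric] lin_hyp_central lin_comp_id)
      then show "\<exists>z\<in>{(0, False), (3, False)}. dmul (b lin_hyp) x = dmul z (dmul x (b lin_hyp))"
        by (auto simp: b_id)
    qed
    moreover have "b lin_hyp \<noteq> (0, False)"
      using b_eq[OF G_id G_hyp] lin_prop_hyp_id[OF two] by (simp add: b_id eq_commute)
    ultimately show ?thesis by simp
  qed
  have "\<exists>n2. H n2 \<and> \<psi> (aut_map F1 n) = aut_map F2 n2" if "G n" for n
    using bij_betwE[OF \<psi>_bij] A_carrier[OF that] unfolding carrier_Aut[OF two F2] H_def by blast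
  then obtain p where p: "\<And>n. G n \<Longrightarrow> H (p n)" "\<And>n. G n \<Longrightarrow> \<psi> (aut_map F1 n) = aut_map F2 (p n)"
    by metis
  have m0_ns: "lin_nonsingular m0" by (rule lin_iso_nonsingular[OF m0])
  note m0_inv = lin_comp_inv[OF m0_ns]
  have cancel: "lin_comp m0 (lin_comp (lin_inv m0) n) = n" "lin_comp (lin_inv m0) (lin_comp m0 n) = n" for n
    by (simp_all add: lin_comp_assoc[symmetric] m0_inv lin_comp_id)
  \<comment> \<open>\<open>p n\<close> is a tuple for the image of n under \<psi>; conjugating it
    back by m0 turns \<psi> into an automorphism of the group of F1 alone.\<close>
  define q where "q n = lin_comp (lin_inv m0) (lin_comp (p n) m0)" for n
  have G_q: "G (q n)" if "G n" for n
    using p(1)[OF that] m0 lin_iso_inv[OF m0] unfolding q_def G_def H_def by (intro lin_iso_comp)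
  have q_cong: "lin_prop {1} (q n) (q n')" if "lin_prop {1} (p n) (p n')" for n n'
    unfolding q_def by (intro lin_prop_comp_left lin_prop_comp_right that)
  have q_b: "b (q n) = b (q n') \<longleftrightarrow> b n = b n'" if n: "G n" "G n'" for n n'
  proof
    assume "b (q n) = b (q n')"
    then have "lin_prop {1} (q n) (q n')" using b_eq G_q n by blast
    then have "lin_prop {1} (lin_comp (lin_comp m0 (q n)) (lin_inv m0)) (lin_comp (lin_comp m0 (q n')) (lin_inv m0))"
      by (intro lin_prop_comp_left lin_prop_comp_right)
    then have "lin_prop {1} (p n) (p n')"
      by (simp add: q_def cancel) (simp add: lin_comp_assoc m0_inv lin_comp_id)
    then have "\<psi> (aut_map F1 n) = \<psi> (aut_map F1 n')" using B_eq p n by metis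
    then have "aut_map F1 n = aut_map F1 n'"
      using A_carrier[OF n(1)] A_carrier[OF n(2)]
      by (rule inj_onD[OF bij_betw_imp_inj_on[OF \<psi>_bij]])
    then show "b n = b n'" by (simp add: b_def)
  next
    assume "b n = b n'"
    then have "aut_map F1 n = aut_map F1 n'" using b_eq A_eq n by blast
    then have "aut_map F2 (p n) = aut_map F2 (p n')" using p(2) n by metis
    then have "lin_prop {1} (p n) (p n')" using B_eq p(1) n by blast
    then show "b (q n) = b (q n')" using q_cong b_eq G_q n by blast
  qed
  have q_mult: "b (q (lin_comp n n')) = dmul (b (q n)) (b (q n'))" if n: "G n" "G n'" for n n'
  proof -
    have "aut_map F2 (p (lin_comp n n')) = \<psi> (monoid.mult (Aut F1) (aut_map F1 n) (aut_map F1 n'))"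
      using p(2)[OF G_comp[OF n]] aut_map_mult[of F1 n n'] n by (simp add: G_def)
    also have "\<dots> = monoid.mult (Aut F2) (aut_map F2 (p n)) (aut_map F2 (p n'))"
      using hom_mult[OF \<psi>_hom A_carrier[OF n(1)] A_carrier[OF n(2)]] p(2) n by simp
    also have "\<dots> = aut_map F2 (lin_comp (p n) (p n'))"
      using aut_map_mult[of F2 "p n" "p n'"] p(1) n by (simp add: H_def)
    finally have "lin_prop {1} (p (lin_comp n n')) (lin_comp (p n) (p n'))"
      using B_eq p(1) G_comp[OF n] by blast
    then have "lin_prop {1} (q (lin_comp n n')) (lin_comp (lin_inv m0) (lin_comp (lin_comp (p n) (p n')) m0))"
      unfolding q_def by (intro lin_prop_comp_left lin_prop_comp_right)
    moreover have "lin_comp (lin_inv m0) (lin_comp (lin_comp (p n) (p n')) m0) = lin_comp (q n) (q n')"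
      by (simp add: q_def lin_comp_assoc cancel)
    ultimately have "b (q (lin_comp n n')) = b (lin_comp (q n) (q n'))"
      using b_eq G_q G_comp n by metis
    then show ?thesis using b_mult G_q n by simp
  qed
  \<comment> \<open>A choice of tuple for each dihedral element. The induced \<theta> is independent
    of the choice, since \<open>q\<close> respects equality of maps.\<close>
  define \<nu> where "\<nu> x = (SOME n. G n \<and> b n = x)" for x
  have \<nu>: "G (\<nu> x)" "b (\<nu> x) = x" if "x \<in> dcarrier" for x
    using someI_ex[OF b_surj[OF that]] by (auto simp: \<nu>_def)
  define \<theta> where "\<theta> x = b (q (\<nu> x))" for x
  have \<theta>_b: "\<theta> (b n) = b (q n)" if "G n" for n
    unfolding \<theta>_def using q_b \<nu> b_mem that by metis
  have \<theta>_inj: "inj_on \<theta> dcarrier"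
  proof (rule inj_onI)
    fix x y assume "x \<in> dcarrier" "y \<in> dcarrier" "\<theta> x = \<theta> y"
    then show "x = y" using q_b[of "\<nu> x" "\<nu> y"] \<nu> unfolding \<theta>_def by metis
  qed
  moreover have "finite dcarrier" by (simp add: dihedral_group_def)
  moreover have "\<theta> ` dcarrier \<subseteq> dcarrier" unfolding \<theta>_def using b_mem G_q \<nu> by blast
  ultimately have bij: "bij_betw \<theta> dcarrier dcarrier" by (simp add: bij_betw_def endo_inj_surj)
  have hom: "\<theta> (dmul x y) = dmul (\<theta> x) (\<theta> y)" if xy: "x \<in> dcarrier" "y \<in> dcarrier" for x y
  proof -
    have "dmul x y = b (lin_comp (\<nu> x) (\<nu> y))" using b_mult \<nu> xy by simp
    then have "\<theta> (dmul x y) = b (q (lin_comp (\<nu> x) (\<nu> y)))" using \<theta>_b G_comp \<nu> xy by simp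
    then show ?thesis using q_mult \<nu> xy by (simp add: \<theta>_def)
  qed
  obtain g where g: "g \<in> dcarrier"
    "\<And>x. x \<in> dcarrier \<Longrightarrow> \<exists>z\<in>{(0, False), (3, False)}. dmul (\<theta> x) g = dmul z (dmul g x)"
    by (rule dihedral_automorphism_inner_mod_center[OF bij hom]) (assumption | rule that)+
  define k where "k = \<nu> g"
  have k: "G k" "b k = g" using \<nu>[OF g(1)] by (simp_all add: k_def)
  \<comment> \<open>Changing m0 by the automorphism k absorbs \<theta> up to the centre.\<close>
  define m where "m = lin_comp m0 k"
  have m: "lin_iso (ac_poly F1) (ac_poly F2) m" unfolding m_def using m0 k(1) by (simp add: G_def lin_iso_comp)
  have m_ns: "lin_nonsingular m" by (rule lin_iso_nonsingular[OF m])
  \<comment> \<open>Thus \<psi> is conjugation by m up to the involution, for any tuple n2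
    representing the image of n.\<close>
  have star: "lin_prop {1, - 1} (lin_comp n2 m) (lin_comp m n)"
    if n: "G n" "H n2" "\<psi> (aut_map F1 n) = aut_map F2 n2" for n n2
  proof -
    obtain z where z: "z \<in> {(0, False), (3, False)}" "dmul (b (q n)) g = dmul z (dmul g (b n))"
      using g(2)[OF b_mem[OF n(1)]] \<theta>_b[OF n(1)] by auto
    obtain \<zeta> where \<zeta>: "\<zeta> \<in> {lin_id, lin_hyp}" "b \<zeta> = z" using z(1) b_id b_hyp by blast
    have G\<zeta>: "G \<zeta>" using \<zeta>(1) G_id G_hyp by auto
    have "b (lin_comp (q n) k) = b (lin_comp \<zeta> (lin_comp k n))"
      using z(2) \<zeta>(2) k n(1) G\<zeta> by (simp add: b_mult G_q G_comp)
    then have "lin_prop {1} (lin_comp (q n) k) (lin_comp \<zeta> (lin_comp k n))"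
      using b_eq G_q G_comp k(1) n(1) G\<zeta> by metis
    then have "lin_prop {1} (lin_comp m0 (lin_comp (q n) k)) (lin_comp m0 (lin_comp \<zeta> (lin_comp k n)))"
      by (rule lin_prop_comp_left)
    moreover have "lin_comp m0 (lin_comp (q n) k) = lin_comp (p n) m"
      by (simp add: q_def m_def lin_comp_assoc cancel)
    moreover have "lin_comp m0 (lin_comp \<zeta> (lin_comp k n)) = lin_comp \<zeta> (lin_comp m n)"
    proof -
      have "lin_comp m0 \<zeta> = lin_comp \<zeta> m0" using \<zeta>(1) by (auto simp: lin_hyp_central lin_comp_id)
      then show ?thesis unfolding m_def by (metis lin_comp_assoc)
    qed
    ultimately have "lin_prop {1} (lin_comp (p n) m) (lin_comp \<zeta> (lin_comp m n))" by argo
    then have i1: "lin_prop {1, - 1} (lin_comp (p n) m) (lin_comp \<zeta> (lin_comp m n))"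
      by (rule lin_prop_mono) auto
    have i2: "lin_prop {1, - 1} (lin_comp \<zeta> (lin_comp m n)) (lin_comp m n)"
      by (rule lin_prop_sym[OF lin_prop_central[OF \<zeta>(1)]])
    have "lin_prop {1} (p n) n2" using n p B_eq by metis
    then have "lin_prop {1, - 1} (p n) n2" by (rule lin_prop_mono) auto
    from lin_prop_sym[OF lin_prop_comp_right[OF this]]
    show ?thesis by (rule lin_prop_trans[OF _ lin_prop_trans[OF i1 i2]])
  qed
  have "lin_prop {1, - 1} m (lin_conj \<sigma> m)" if \<sigma>: "\<sigma> \<in> galois_group" for \<sigma>
  proof -
    \<comment> \<open>The value at \<sigma> of the Galois cocycle of m, an automorphism of the curve
      of F1.\<close>
    define c where "c = lin_comp (lin_inv m) (lin_conj \<sigma> m)"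
    have mc: "lin_comp m c = lin_conj \<sigma> m"
      by (simp add: c_def lin_comp_assoc[symmetric] lin_comp_inv[OF m_ns] lin_comp_id)
    have Gc: "G c" unfolding c_def G_def
      by (rule lin_iso_comp[OF lin_iso_inv[OF m] lin_iso_conj[OF \<sigma> m]])
    have "b c \<in> {(0, False), (3, False)}"
    proof (rule dihedral_center_mod_center[OF b_mem[OF Gc]])
      fix x assume "x \<in> dcarrier"
      then obtain n where n: "G n" "x = b n" using b_surj by blast
      \<comment> \<open>n is the conjugate of n'. Conjugating \<open>star\<close> for n' gives a
        relation for m c, and equivariance shows that it involves the same n2 as \<open>star\<close>
        for n.\<close>
      define n' where "n' = lin_conj (inv_into UNIV \<sigma>) n"
      have n': "G n'" "lin_conj \<sigma> n' = n"
        using n(1) lin_iso_conj[OF galois_group_inv(1)[OF \<sigma>]] lin_conj_inv[OF \<sigma>] by (auto simp: G_def n'_def)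
      define n2 where "n2 = lin_conj \<sigma> (p n')"
      have n2: "H n2" using p(1)[OF n'(1)] lin_iso_conj[OF \<sigma>] by (simp add: n2_def H_def)
      have "\<psi> (aut_map F1 n) = galois_conj \<sigma> F2 (\<psi> (aut_map F1 n'))"
        using equiv[OF \<sigma> A_carrier[OF n'(1)]] by (simp add: galois_conj_aut_map[OF \<sigma>] n'(2))
      then have "\<psi> (aut_map F1 n) = aut_map F2 n2"
        using p(2)[OF n'(1)] by (simp add: galois_conj_aut_map[OF \<sigma>] n2_def)
      from star[OF n(1) n2 this] have s1: "lin_prop {1, - 1} (lin_comp n2 m) (lin_comp m n)" .
      have "lin_prop {1, - 1} (lin_comp (p n') m) (lin_comp m n')" using star n'(1) p by blast
      from lin_prop_conj[OF \<sigma> this]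
      have s2: "lin_prop {1, - 1} (lin_comp n2 (lin_comp m c)) (lin_comp (lin_comp m c) n)"
        by (simp add: lin_conj_comp[OF \<sigma>] n2_def n'(2) mc)
      have s3: "lin_prop {1, - 1} (lin_comp (lin_comp n2 m) c) (lin_comp (lin_comp m c) n)"
        using s2 by (simp only: lin_comp_assoc)
      have "lin_prop {1, - 1} (lin_comp (lin_comp m n) c) (lin_comp (lin_comp m c) n)"
        \<comment> \<open>Both products agree up to sign with n2 m c; cancelling m shows that c and
          n commute up to the involution.\<close>
        by (rule lin_prop_trans[OF lin_prop_sym[OF lin_prop_comp_right[OF s1]] s3])
      then have "lin_prop {1, - 1} (lin_comp (lin_inv m) (lin_comp (lin_comp m n) c))
          (lin_comp (lin_inv m) (lin_comp (lin_comp m c) n))" by (rule lin_prop_comp_left)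
      moreover have "lin_comp (lin_inv m) (lin_comp (lin_comp m u) v) = lin_comp u v" for u v
        by (simp add: lin_comp_assoc[symmetric] lin_comp_inv[OF m_ns] lin_comp_id)
      ultimately have "lin_prop {1, - 1} (lin_comp n c) (lin_comp c n)" by simp
      then obtain \<zeta> where \<zeta>: "\<zeta> \<in> {lin_id, lin_hyp}" "lin_prop {1} (lin_comp \<zeta> (lin_comp n c)) (lin_comp c n)"
        by (rule lin_prop_signE)
      have G\<zeta>: "G \<zeta>" using \<zeta>(1) G_id G_hyp by auto
      have "b (lin_comp \<zeta> (lin_comp n c)) = b (lin_comp c n)"
        using b_eq[OF G_comp[OF G\<zeta> G_comp[OF n(1) Gc]] G_comp[OF Gc n(1)]] \<zeta>(2) by simp
      then have "dmul (b c) x = dmul (b \<zeta>) (dmul x (b c))"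
        using n Gc G\<zeta> by (simp add: b_mult G_comp)
      moreover have "b \<zeta> \<in> {(0, False), (3, False)}" using \<zeta>(1) b_id b_hyp by auto
      ultimately show "\<exists>z\<in>{(0, False), (3, False)}. dmul (b c) x = dmul z (dmul x (b c))" by blast
    qed
    then have "\<exists>\<zeta>\<in>{lin_id, lin_hyp}. b \<zeta> = b c" by (auto simp: b_id b_hyp)
    then obtain \<zeta> where \<zeta>: "\<zeta> \<in> {lin_id, lin_hyp}" "b \<zeta> = b c" by (rule bexE)
    moreover from \<zeta>(1) have "G \<zeta>" using G_id G_hyp by auto
    ultimately have "lin_prop {1} \<zeta> c" using b_eq[OF _ Gc] by blast
    then have "lin_prop {1, - 1} (lin_comp m \<zeta>) (lin_comp m c)"
      by (intro lin_prop_comp_left) (rule lin_prop_mono, auto)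
    moreover have "lin_prop {1, - 1} m (lin_comp m \<zeta>)"
      using lin_prop_central[OF \<zeta>(1), of m] \<zeta>(1) by (auto simp: lin_hyp_central lin_comp_id)
    ultimately show ?thesis unfolding mc by (rule lin_prop_trans[rotated])
  qed
  then show ?thesis using that m by blast
qed

section \<open>Descent to the base field\<close>

lemma lin_iso_scalar: "t \<noteq> 0 \<Longrightarrow> lin_iso F F (t, 0, 0, t, t ^ 3)"
  by (simp add: hom_eval_scale flip: power_mult)

text \<open>Divide by a nonzero matrix entry w. If \<sigma> multiplies the matrix by t, then it
  multiplies w by t as well, so the quotients are fixed and e / w^3 changes only by the factor
  s.\<close>

lemma lin_normalize:
  fixes m :: "'k::field alg_closure lin"
  assumes m: "lin_nonsingular m"
  obtains t a b c d e where "t \<noteq> 0" "lin_comp m (t, 0, 0, t, t ^ 3) = (a, b, c, d, e)"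
    "\<And>\<sigma> S. \<sigma> \<in> galois_group \<Longrightarrow> lin_prop S m (lin_conj \<sigma> m) \<Longrightarrow>
       \<sigma> a = a \<and> \<sigma> b = b \<and> \<sigma> c = c \<and> \<sigma> d = d \<and> (\<exists>s\<in>S. \<sigma> e = s * e)"
proof -
  obtain a b c d e where m_eq: "m = (a, b, c, d, e)" by (metis prod_cases5)
  obtain w where w: "w \<in> {a, b, c, d}" "w \<noteq> 0" using m by (auto simp: m_eq)
  have eq: "lin_comp m (1 / w, 0, 0, 1 / w, (1 / w) ^ 3) = (a / w, b / w, c / w, d / w, e / w ^ 3)"
    by (simp add: m_eq power_divide)
  have "\<sigma> (a / w) = a / w \<and> \<sigma> (b / w) = b / w \<and> \<sigma> (c / w) = c / w \<and> \<sigma> (d / w) = d / w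
      \<and> (\<exists>s\<in>S. \<sigma> (e / w ^ 3) = s * (e / w ^ 3))"
    if \<sigma>: "\<sigma> \<in> galois_group" and S: "lin_prop S m (lin_conj \<sigma> m)" for \<sigma> S
  proof -
    obtain t s where ts: "t \<noteq> 0" "s \<in> S" and \<sigma>m: "\<sigma> a = t * a" "\<sigma> b = t * b" "\<sigma> c = t * c" "\<sigma> d = t * d"
      "\<sigma> e = s * t ^ 3 * e"
      using S by (auto simp: m_eq)
    then have \<sigma>w: "\<sigma> w = t * w" using w(1) by auto
    have "\<sigma> (e / w ^ 3) = s * (e / w ^ 3)"
      using ts(1) w(2) by (simp add: galois_groupD(11,12)[OF \<sigma>] \<sigma>m \<sigma>w power_mult_distrib)
    then show ?thesis
      using ts w(2) by (auto simp: galois_groupD(12)[OF \<sigma>] \<sigma>m \<sigma>w)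
  qed
  with that[OF _ eq] w(2) show ?thesis by simp
qed

lemma range_to_ac_closed:
  fixes x y :: "'k::field alg_closure"
  assumes "x \<in> range to_ac" "y \<in> range to_ac"
  shows "x + y \<in> range to_ac" "x * y \<in> range to_ac" "x - y \<in> range to_ac" "x / y \<in> range to_ac"
proof -
  obtain u v :: 'k where "x = to_ac u" "y = to_ac v" using assms by blast
  then show "x + y \<in> range to_ac" "x * y \<in> range to_ac" "x - y \<in> range to_ac" "x / y \<in> range to_ac"
    by (simp_all flip: to_ac_add to_ac_mult to_ac_diff to_ac_divide)
qed

lemma range_to_ac_minus: "x \<in> range to_ac \<Longrightarrow> - x \<in> range to_ac"
  using range_to_ac_closed(3)[of 0 x] by (metis diff_0 rangeI to_ac_0)

lemma range_to_ac_01: "0 \<in> range to_ac" "1 \<in> range to_ac"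
  by (metis rangeI to_ac_0, metis rangeI to_ac_1)

lemma lin_over_inv:
  assumes "lin_over (range to_ac) m"
  shows "lin_over (range to_ac) (lin_inv m)"
  using assms by (cases m rule: lin_nonsingular.cases) (simp add: range_to_ac_closed range_to_ac_minus range_to_ac_01)

lemma lin_over_comp:
  assumes "lin_over (range to_ac) m" "lin_over (range to_ac) n"
  shows "lin_over (range to_ac) (lin_comp m n)"
  using assms by (cases m rule: lin_nonsingular.cases, cases n rule: lin_nonsingular.cases)
    (simp add: range_to_ac_closed)

lemma k_isomorphic_lin:
  assumes "lin_iso (ac_poly F) (ac_poly G) m" "lin_over (range to_ac) m"
  shows "k_isomorphic F G"
proof -
  have "isomorphism_over (range to_ac) (curve F) (curve G) (lin_map m)"
    unfolding curve_eq_proj_curve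
    by (rule isomorphism_over_lin_map[OF assms(1) range_to_ac_01(1) assms(2) lin_over_inv[OF assms(2)]]) simp
  then show ?thesis unfolding isomorphic_over_def by blast
qed

text \<open>A map over k commutes with the Galois action, so its tuple and each conjugate tuple
  define the same map. There is no sign here, so after normalisation the Y-scaling is fixed
  too.\<close>

lemma k_isomorphic_imp_lin:
  fixes F G :: "'k::field poly"
  assumes perf: "perfect_field TYPE('k)" and two: "(2 :: 'k alg_closure) \<noteq> 0"
    and F: "simple_sextic (ac_poly F)" and G: "simple_sextic (ac_poly G)" and iso: "k_isomorphic F G"
  obtains n where "lin_iso (ac_poly F) (ac_poly G) n" "lin_over (range to_ac) n"
proof -
  obtain \<phi> where \<phi>: "isomorphism_over (range to_ac) (curve F) (curve G) \<phi>"
    using iso by (auto simp: isomorphic_over_def)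
  obtain n where n: "lin_iso (ac_poly F) (ac_poly G) n" "\<forall>P\<in>curve F. \<phi> P = lin_map n P"
    using isomorphism_is_linear[OF two F G] \<phi> unfolding curve_eq_proj_curve by blast
  have mor: "morphism_over (range to_ac) (curve F) (curve G) \<phi>" using \<phi> by (simp add: isomorphism_over_def)
  have conj: "lin_prop {1} n (lin_conj \<sigma> n)" if \<sigma>: "\<sigma> \<in> galois_group" for \<sigma>
  proof (rule lin_map_eq_imp_prop[OF F lin_iso_nonsingular[OF n(1)]])
    fix P assume "P \<in> proj_curve (ac_poly F)"
    then have P: "P \<in> curve F" by (simp add: curve_eq_proj_curve)
    define Q where "Q = galois_point (inv_into UNIV \<sigma>) P"
    have Q: "Q \<in> curve F" "galois_point \<sigma> Q = P"
      unfolding Q_def by (rule galois_point_in_curve[OF galois_group_inv(1)[OF \<sigma>] P] galois_point_inv[OF \<sigma> P])+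
    have "lin_map n P = galois_point \<sigma> (\<phi> Q)"
      using rational_morphism_conj[OF \<sigma> mor Q(1)] n(2) P Q(2) by metis
    also have "\<dots> = lin_map (lin_conj \<sigma> n) P"
      using n(2) Q galois_point_lin_map[OF \<sigma> Q(1)] by metis
    finally show "lin_map n P = lin_map (lin_conj \<sigma> n) P" .
  qed
  obtain t a b c d e where t: "t \<noteq> 0" and abcde: "lin_comp n (t, 0, 0, t, t ^ 3) = (a, b, c, d, e)"
    and fixed: "\<And>\<sigma> S. \<sigma> \<in> galois_group \<Longrightarrow> lin_prop S n (lin_conj \<sigma> n) \<Longrightarrow>
       \<sigma> a = a \<and> \<sigma> b = b \<and> \<sigma> c = c \<and> \<sigma> d = d \<and> (\<exists>s\<in>S. \<sigma> e = s * e)"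
    by (rule lin_normalize[OF lin_iso_nonsingular[OF n(1)]]) (erule that, assumption+)
  have fixed': "\<sigma> a = a \<and> \<sigma> b = b \<and> \<sigma> c = c \<and> \<sigma> d = d \<and> \<sigma> e = e" if "\<sigma> \<in> galois_group" for \<sigma>
    using fixed[OF that conj[OF that]] by auto
  have "a \<in> range to_ac" "b \<in> range to_ac" "c \<in> range to_ac" "d \<in> range to_ac" "e \<in> range to_ac"
    using fixed' by (auto intro: fixed_field_galois_group[OF perf])
  then have "lin_over (range to_ac) (a, b, c, d, e)" by simp
  moreover have "lin_iso (ac_poly F) (ac_poly G) (a, b, c, d, e)"
    unfolding abcde[symmetric] by (rule lin_iso_comp[OF n(1) lin_iso_scalar[OF t]])
  ultimately show ?thesis using that by blast
qed

text \<open>The constant is the square of the Y-scaling of the normalised isomorphism. A change of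
  model of the first curve is itself defined over k, so the same constant serves for every
  model.\<close>

theorem theorem4p7:
  fixes F1 F2 :: "'k::field poly"
  assumes "perfect_field TYPE('k)"
    and "CHAR('k) \<noteq> 2" and "CHAR('k) \<noteq> 3"
    and "genus2_model F1" and "genus2_model F2"
    and "Aut F1 \<cong> dihedral_group 6" and "Aut F2 \<cong> dihedral_group 6"
    and "geom_isomorphic F1 F2"
    and "Aut_galois_isomorphic F1 F2"
  shows "\<exists>d::'k. d \<noteq> 0 \<and>
    (\<forall>F. genus2_model F \<and> k_isomorphic F1 F \<longrightarrow> k_isomorphic F2 (Polynomial.smult d F))"
proof -
  note perf = assms(1)
  have two: "(2 :: 'k alg_closure) \<noteq> 0"
  proof
    assume "(2 :: 'k alg_closure) = 0"
    then have "of_nat 2 = (0 :: 'k alg_closure)" by simp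
    then have "CHAR('k alg_closure) dvd 2" unfolding of_nat_eq_0_iff_char_dvd .
    then have "CHAR('k) dvd 2" by simp
    then have "CHAR('k) = 1 \<or> CHAR('k) = 2" by (metis prime_nat_iff two_is_prime_nat)
    then show False using assms(2) by simp
  qed
  have s1: "simple_sextic (ac_poly F1)" and s2: "simple_sextic (ac_poly F2)"
    using simple_sextic_ac_poly[OF perf] assms(4,5) by auto
  obtain \<psi> where \<psi>: "\<psi> \<in> iso (Aut F1) (Aut F2)" and equiv: "\<And>\<sigma> \<phi>. \<sigma> \<in> galois_group \<Longrightarrow> \<phi> \<in> carrier (Aut F1) \<Longrightarrow>
       \<psi> (galois_conj \<sigma> F1 \<phi>) = galois_conj \<sigma> F2 (\<psi> \<phi>)"
    using assms(9) unfolding Aut_galois_isomorphic_def by blast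
  obtain \<phi> where "isomorphism_over UNIV (curve F1) (curve F2) \<phi>"
    using assms(8) by (auto simp: isomorphic_over_def)
  then obtain m0 where m0: "lin_iso (ac_poly F1) (ac_poly F2) m0"
    using isomorphism_is_linear[OF two s1 s2] unfolding curve_eq_proj_curve by blast
  obtain m where m: "lin_iso (ac_poly F1) (ac_poly F2) m"
    and cocycle: "\<And>\<sigma>. \<sigma> \<in> galois_group \<Longrightarrow> lin_prop {1, - 1} m (lin_conj \<sigma> m)"
    by (rule isomorphism_with_central_cocycle[OF two s1 s2 assms(6) \<psi> equiv m0]) (assumption | rule that)+
  obtain t a b c d e where t: "t \<noteq> 0" and abcde: "lin_comp m (t, 0, 0, t, t ^ 3) = (a, b, c, d, e)"
    and fixed: "\<And>\<sigma> S. \<sigma> \<in> galois_group \<Longrightarrow> lin_prop S m (lin_conj \<sigma> m) \<Longrightarrow>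
       \<sigma> a = a \<and> \<sigma> b = b \<and> \<sigma> c = c \<and> \<sigma> d = d \<and> (\<exists>s\<in>S. \<sigma> e = s * e)"
    by (rule lin_normalize[OF lin_iso_nonsingular[OF m]]) (erule that, assumption+)
  have fixed': "\<sigma> a = a \<and> \<sigma> b = b \<and> \<sigma> c = c \<and> \<sigma> d = d \<and> \<sigma> (e\<^sup>2) = e\<^sup>2" if \<sigma>: "\<sigma> \<in> galois_group" for \<sigma>
    using fixed[OF \<sigma> cocycle[OF \<sigma>]] by (auto simp: galois_groupD(11)[OF \<sigma>])
  have rat: "a \<in> range to_ac" "b \<in> range to_ac" "c \<in> range to_ac" "d \<in> range to_ac" "e\<^sup>2 \<in> range to_ac"
    using fixed' by (auto intro: fixed_field_galois_group[OF perf])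
  obtain \<delta> where \<delta>: "e\<^sup>2 = to_ac \<delta>" using rat(5) by blast
  have iso: "lin_iso (ac_poly F1) (ac_poly F2) (a, b, c, d, e)"
    unfolding abcde[symmetric] by (rule lin_iso_comp[OF m lin_iso_scalar[OF t]])
  then have det: "a * d - b * c \<noteq> 0" "e \<noteq> 0" by auto
  have \<delta>0: "\<delta> \<noteq> 0" using det(2) \<delta> by auto
  have "k_isomorphic F2 (Polynomial.smult \<delta> F)" if F: "genus2_model F" "k_isomorphic F1 F" for F
  proof -
    obtain n where n: "lin_iso (ac_poly F1) (ac_poly F) n" "lin_over (range to_ac) n"
      by (rule k_isomorphic_imp_lin[OF perf two s1 simple_sextic_ac_poly[OF perf F(1)] F(2)])
    \<comment> \<open>The inverse is taken with 1 in place of e, which puts the whole tuple over k.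
      The factor left out is 1 / e, whose effect on the sextic is the scaling by \<open>e^2\<close>,
      that is, the twist by \<delta>.\<close>
    define r where "r = lin_comp n (lin_inv (a, b, c, d, 1))"
    have over: "lin_over (range to_ac) r" unfolding r_def
      by (intro lin_over_comp lin_over_inv n(2)) (simp add: rat range_to_ac_01)
    have twist: "hom_eval (ac_poly (Polynomial.smult \<delta> F)) x z = e\<^sup>2 * hom_eval (ac_poly F) x z" for x z
      by (simp add: hom_eval_def coeff_map_poly \<delta> sum_distrib_left mult.assoc)
    have r_e: "lin_comp n (lin_inv (a, b, c, d, e)) = lin_comp r (1, 0, 0, 1, 1 / e)"
      unfolding r_def by (cases n rule: lin_nonsingular.cases) simp
    obtain a' b' c' d' e' where r: "r = (a', b', c', d', e')" by (metis prod_cases5)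
    have "lin_iso (ac_poly F2) (ac_poly F) (a', b', c', d', e' / e)"
      using lin_iso_comp[OF n(1) lin_iso_inv[OF iso]] unfolding r_e by (simp add: r)
    then have "lin_iso (ac_poly F2) (ac_poly (Polynomial.smult \<delta> F)) r"
      using det(2) by (simp add: r twist power_divide)
    then show ?thesis using over by (rule k_isomorphic_lin)
  qed
  then show ?thesis using \<delta>0 by blast
qed

end
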